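(* Let $S$ be a complete non-CMC biconservative regular surface in $\mathbb{R}^3$. Then there exists a constant $\tilde{C}_0>0$ such that, up to an isometry of $\mathbb{R}^3$, $S=\tilde{S}_{\tilde{C}_0}$.
   Context: All manifolds are smooth, connected and oriented. A regular surface in $\mathbb{R}^3$ is a surface $S=\varphi(M)$, where $\varphi:M^2\to\mathbb{R}^3$ is an embedding; it carries the metric induced from $\mathbb{R}^3$, and complete means complete with respect to this induced metric. For a surface in $\mathbb{R}^3$ with unit normal $\eta$ and shape operator $A$, the mean curvature function is $f=\operatorname{trace}A$ (no factor $1/2$), and $\operatorname{grad}$ denotes the gradient with respect to the induced metric. The surface is biconservative if $A(\operatorname{grad}f)=-\frac{f}{2}\operatorname{grad}f$ at every point. It is non-CMC if $\operatorname{grad}f$ is different from zero at some point ($\operatorname{grad} f$ may vanish at other points). For a constant $\tilde{C}_0>0$ define $$u_{\tilde{C}_0}(\rho)=\frac{3}{2\tilde{C}_0}\left(\rho^{1/3}\sqrt{\tilde{C}_0\rho^{2/3}-1}+\frac{1}{\sqrt{\tilde{C}_0}}\log\left(\sqrt{\tilde{C}_0}\,\rho^{1/3}+\sqrt{\tilde{C}_0\rho^{2/3}-1}\right)\right),$$ $$S_{\tilde{C}_0}=\left\{\left(\rho\cos v,\rho\sin v,u_{\tilde{C}_0}(\rho)\right)\ :\ \rho\in\left(\tilde{C}_0^{-3/2},\infty\right),\ v\in\mathbb{R}\right\}\subset\mathbb{R}^3 .$$ Its boundary (closure in $\mathbb{R}^3$ minus $S_{\tilde{C}_0}$) is the circle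 $\left\{\left(\tilde{C}_0^{-3/2}\cos v,\tilde{C}_0^{-3/2}\sin v,0\right): v\in\mathbb{R}\right\}$. The surface $\tilde{S}_{\tilde{C}_0}$ is the union of $S_{\tilde{C}_0}$, this boundary circle, and the reflection of $S_{\tilde{C}_0}$ in the plane $\{z=0\}$; it is a smooth complete regular surface of revolution in $\mathbb{R}^3$. *)

theory Defs
  imports "HOL-Analysis.Analysis"
begin

section \<open>Smooth surfaces and embeddings\<close>

primrec Ck_on :: "nat \<Rightarrow> 'a::real_normed_vector set \<Rightarrow> ('a \<Rightarrow> 'b::real_normed_vector) \<Rightarrow> bool" where
  "Ck_on 0 U f \<longleftrightarrow> continuous_on U f"
| "Ck_on (Suc k) U f \<longleftrightarrow>
     (\<forall>x\<in>U. f differentiable (at x)) \<and> (\<forall>v. Ck_on k U (\<lambda>x. frechet_derivative f (at x) v))"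

text \<open>Only used for open sets \<open>U\<close> in finite-dimensional spaces.\<close>

definition smooth_on :: "'a::real_normed_vector set \<Rightarrow> ('a \<Rightarrow> 'b::real_normed_vector) \<Rightarrow> bool" where
  "smooth_on U f \<longleftrightarrow> (\<forall>k. Ck_on k U f)"

text \<open>A chart is given by its inverse, the parametrization \<open>\<psi>\<close> of an open subset of \<open>M\<close>
  by an open subset \<open>U\<close> of the plane. The maps \<open>inv_into V \<xi> \<circ> \<psi>\<close> below are thus the usual
  coordinate changes, and they are required to be orientation preserving.\<close>

type_synonym 'm chart = "(real^2) set \<times> (real^2 \<Rightarrow> 'm)"

definition is_chart :: "'m topology \<Rightarrow> 'm chart \<Rightarrow> bool" where
  "is_chart M = (\<lambda>(U, \<psi>). open U \<and> openin M (\<psi> ` U) \<and>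
     homeomorphic_map (top_of_set U) (subtopology M (\<psi> ` U)) \<psi>)"

definition oriented_smooth_surface :: "'m topology \<Rightarrow> 'm chart set \<Rightarrow> bool" where
  "oriented_smooth_surface M \<A> \<longleftrightarrow>
     connected_space M \<and> Hausdorff_space M \<and> second_countable M \<and>
     (\<forall>c\<in>\<A>. is_chart M c) \<and>
     (\<Union>(U, \<psi>)\<in>\<A>. \<psi> ` U) = topspace M \<and>
     (\<forall>(U, \<psi>)\<in>\<A>. \<forall>(V, \<xi>)\<in>\<A>.
        smooth_on {u\<in>U. \<psi> u \<in> \<xi> ` V} (inv_into V \<xi> \<circ> \<psi>) \<and>
        (\<forall>u\<in>U. \<psi> u \<in> \<xi> ` V \<longrightarrow>
           det (matrix (frechet_derivative (inv_into V \<xi> \<circ> \<psi>) (at u))) > 0))"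

definition smooth_map :: "'m chart set \<Rightarrow> ('m \<Rightarrow> 'b::real_normed_vector) \<Rightarrow> bool" where
  "smooth_map \<A> F \<longleftrightarrow> (\<forall>(U, \<psi>)\<in>\<A>. smooth_on U (F \<circ> \<psi>))"

definition smooth_embedding :: "'m topology \<Rightarrow> 'm chart set \<Rightarrow> ('m \<Rightarrow> real^3) \<Rightarrow> bool" where
  "smooth_embedding M \<A> \<phi> \<longleftrightarrow>
     smooth_map \<A> \<phi> \<and>
     (\<forall>(U, \<psi>)\<in>\<A>. \<forall>u\<in>U. inj (frechet_derivative (\<phi> \<circ> \<psi>) (at u))) \<and>
     embedding_map M euclidean \<phi>"

section \<open>Geometry of a surface in space\<close>

definition tangent_space :: "(real^3) set \<Rightarrow> real^3 \<Rightarrow> (real^3) set" where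
  "tangent_space S p = {v. \<exists>\<gamma>. \<exists>\<epsilon>>0. smooth_on {-\<epsilon><..<\<epsilon>} \<gamma> \<and> \<gamma> ` {-\<epsilon><..<\<epsilon>} \<subseteq> S \<and>
     \<gamma> 0 = p \<and> (\<gamma> has_vector_derivative v) (at (0::real))}"

text \<open>The field is a function of the points of \<open>S = \<phi> ` topspace M\<close>; its smoothness refers to the
  differentiable structure of \<open>M\<close>.\<close>

definition unit_normal_field ::
    "'m topology \<Rightarrow> 'm chart set \<Rightarrow> ('m \<Rightarrow> real^3) \<Rightarrow> (real^3 \<Rightarrow> real^3) \<Rightarrow> bool" where
  "unit_normal_field M \<A> \<phi> \<eta> \<longleftrightarrow>
     smooth_map \<A> (\<eta> \<circ> \<phi>) \<and>
     (\<forall>p\<in>\<phi> ` topspace M. norm (\<eta> p) = 1 \<and>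
        (\<forall>v\<in>tangent_space (\<phi> ` topspace M) p. \<eta> p \<bullet> v = 0))"

text \<open>The differential at \<open>p\<close> of a function defined on \<open>S\<close> is the derivative within \<open>S\<close>. As a linear
  map on the whole space that derivative is not unique, but by the chain rule all choices agree
  with \<open>(F \<circ> \<gamma>)'(0)\<close> on the velocity of a curve \<open>\<gamma>\<close> in \<open>S\<close> through \<open>p\<close>, so that its values on
  tangent vectors, the only ones used below, are determined.\<close>

definition surface_differential ::
    "(real^3) set \<Rightarrow> (real^3 \<Rightarrow> 'b::real_normed_vector) \<Rightarrow> real^3 \<Rightarrow> real^3 \<Rightarrow> 'b" where
  "surface_differential S F p v = frechet_derivative F (at p within S) v"

definition surface_grad :: "(real^3) set \<Rightarrow> (real^3 \<Rightarrow> real) \<Rightarrow> real^3 \<Rightarrow> real^3" where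
  "surface_grad S f p = (THE w. w \<in> tangent_space S p \<and>
     (\<forall>v\<in>tangent_space S p. w \<bullet> v = surface_differential S f p v))"

definition shape_operator :: "(real^3) set \<Rightarrow> (real^3 \<Rightarrow> real^3) \<Rightarrow> real^3 \<Rightarrow> real^3 \<Rightarrow> real^3" where
  "shape_operator S \<eta> p v = - surface_differential S \<eta> p v"

definition orthonormal_basis_of :: "'a::euclidean_space set \<Rightarrow> 'a set \<Rightarrow> bool" where
  "orthonormal_basis_of V B \<longleftrightarrow> pairwise orthogonal B \<and> (\<forall>b\<in>B. norm b = 1) \<and> span B = V"

text \<open>The value of the trace does not depend on the orthonormal basis chosen.\<close>

definition trace_on :: "'a::euclidean_space set \<Rightarrow> ('a \<Rightarrow> 'a) \<Rightarrow> real" where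
  "trace_on V L = (\<Sum>b\<in>(SOME B. orthonormal_basis_of V B). L b \<bullet> b)"

definition mean_curvature :: "(real^3) set \<Rightarrow> (real^3 \<Rightarrow> real^3) \<Rightarrow> real^3 \<Rightarrow> real" where
  "mean_curvature S \<eta> p = trace_on (tangent_space S p) (shape_operator S \<eta> p)"

definition biconservative :: "(real^3) set \<Rightarrow> (real^3 \<Rightarrow> real^3) \<Rightarrow> bool" where
  "biconservative S \<eta> \<longleftrightarrow> (\<forall>p\<in>S.
     shape_operator S \<eta> p (surface_grad S (mean_curvature S \<eta>) p) =
       - (mean_curvature S \<eta> p / 2) *\<^sub>R surface_grad S (mean_curvature S \<eta>) p)"

definition non_CMC :: "(real^3) set \<Rightarrow> (real^3 \<Rightarrow> real^3) \<Rightarrow> bool" where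
  "non_CMC S \<eta> \<longleftrightarrow> (\<exists>p\<in>S. surface_grad S (mean_curvature S \<eta>) p \<noteq> 0)"

text \<open>\<open>valid_path\<close> allows the speed to be unbounded near a break point. Demanding \<open>has_integral\<close>,
  instead of taking the value of \<open>integral\<close> (which is \<open>0\<close> for a non-integrable speed), excludes
  curves of infinite length.\<close>

definition curve_lengths :: "(real^3) set \<Rightarrow> real^3 \<Rightarrow> real^3 \<Rightarrow> real set" where
  "curve_lengths S p q = {L. \<exists>\<gamma>. valid_path \<gamma> \<and> path_image \<gamma> \<subseteq> S \<and>
     pathstart \<gamma> = p \<and> pathfinish \<gamma> = q \<and>
     ((\<lambda>t. norm (vector_derivative \<gamma> (at t))) has_integral L) {0..1}}"

definition intrinsic_dist :: "(real^3) set \<Rightarrow> real^3 \<Rightarrow> real^3 \<Rightarrow> real" where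
  "intrinsic_dist S p q = Inf (curve_lengths S p q)"

definition complete_surface :: "(real^3) set \<Rightarrow> bool" where
  "complete_surface S \<longleftrightarrow> (\<forall>\<sigma>. range \<sigma> \<subseteq> S \<and>
       (\<forall>\<epsilon>>0. \<exists>N. \<forall>m\<ge>N. \<forall>n\<ge>N. intrinsic_dist S (\<sigma> m) (\<sigma> n) < \<epsilon>) \<longrightarrow>
     (\<exists>p\<in>S. (\<lambda>n::nat. intrinsic_dist S (\<sigma> n) p) \<longlonglongrightarrow> 0))"

section \<open>The model surfaces\<close>

definition profile :: "real \<Rightarrow> real \<Rightarrow> real" where
  "profile C \<rho> = 3 / (2 * C) *
     (\<rho> powr (1/3) * sqrt (C * \<rho> powr (2/3) - 1) +
      1 / sqrt C * ln (sqrt C * \<rho> powr (1/3) + sqrt (C * \<rho> powr (2/3) - 1)))"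

definition upper_half :: "real \<Rightarrow> (real^3) set" where
  "upper_half C = {vector [\<rho> * cos v, \<rho> * sin v, profile C \<rho>] | \<rho> v. \<rho> > C powr (-3/2)}"

definition boundary_circle :: "real \<Rightarrow> (real^3) set" where
  "boundary_circle C =
     {vector [C powr (-3/2) * cos v, C powr (-3/2) * sin v, 0] | v. v \<in> (UNIV :: real set)}"

definition reflect_z :: "real^3 \<Rightarrow> real^3" where
  "reflect_z x = vector [x $ 1, x $ 2, - (x $ 3)]"

definition model_surface :: "real \<Rightarrow> (real^3) set" where
  "model_surface C = upper_half C \<union> boundary_circle C \<union> reflect_z ` upper_half C"

end

theory Submission
  imports Defs
begin

text \<open>
  Let \<open>f\<close> be the mean curvature and \<open>N\<close> the unit normal of the surface \<open>S\<close>. Where the gradient of \<open>f\<close> is not zero,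
  it spans one principal direction with curvature \<open>- f / 2\<close>, and since \<open>f\<close> is the trace, the orthogonal
  direction has curvature \<open>3 * f / 2\<close>. The equations of Codazzi and Gauss (\<open>codazzi\<close>, \<open>dd_h\<close>) then form a closed
  system of ordinary differential equations along the gradient lines. Its first integrals are a length, a
  unit vector and a point (\<open>neck_radius\<close>, \<open>axis_dir\<close>, \<open>centre\<close>; see \<open>first_integrals_constant\<close>). They say that
  \<open>S\<close> locally is an open piece of one half of a model surface with this neck radius, axis and centre.

  The gradient may vanish elsewhere, possibly on an open set, so the local description has to be
  continued. The model surface is parametrized by \<open>t\<close> and an angle \<open>v\<close>, and a parameter is called matched if the
  point belongs to \<open>S\<close> and \<open>S\<close> has there the normal, the mean curvature and the gradient of the model.
  For \<open>t \<noteq> 0\<close> being matched is an open condition, by the local description and invariance of domain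
  (\<open>matched_open\<close>). It passes to limits along segments, because these have finite length and \<open>S\<close> is complete
  (\<open>matched_limit\<close>). Hence one half of the model surface, together with its boundary circle \<open>t = 0\<close>, is in \<open>S\<close>.

  On this circle, the neck, the gradient vanishes, and a priori \<open>S\<close> might continue differently, say with constant
  mean curvature. This is excluded by smoothness (\<open>neck_crossing\<close>): the second derivative of \<open>f\<close> across the
  neck, which can be computed from the half already known, is not zero. So the gradient is not zero just
  beyond the neck, where the first integrals therefore are constant again, and by continuity they have
  the same values as before. The other half is thus in \<open>S\<close> as well.

  The whole model surface is closed in space, and it is open in \<open>S\<close> by invariance of domain; as
  \<open>S\<close> is connected, it is all of \<open>S\<close> (\<open>surface_eq_model\<close>).
\<close>

unbundle cross3_syntax

section \<open>Calculus of functions of class C-k\<close>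

text \<open>As a function of the point, a directional derivative of a function of class C-(k+1) is again of
  class C-k; so the closure properties below follow by induction on \<open>k\<close> from the product and chain rules.\<close>

abbreviation dd :: "'a::real_normed_vector \<Rightarrow> ('a \<Rightarrow> 'b::real_normed_vector) \<Rightarrow> 'a \<Rightarrow> 'b" where
  "dd v Y \<equiv> \<lambda>u. frechet_derivative Y (at u) v"

lemma dd_eqI: "(f has_derivative f') (at u) \<Longrightarrow> dd v f u = f' v"
  using frechet_derivative_at by metis

lemma Ck_on_imp_continuous_on: "Ck_on k U f \<Longrightarrow> continuous_on U f"
  by (cases k) (auto simp: continuous_at_imp_continuous_on differentiable_imp_continuous_within)

lemma Ck_on_imp_has_derivative:
  "Ck_on (Suc k) U f \<Longrightarrow> x \<in> U \<Longrightarrow> (f has_derivative frechet_derivative f (at x)) (at x)"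
  by (simp add: frechet_derivative_works)

lemma Ck_on_SucD: "Ck_on (Suc k) U f \<Longrightarrow> Ck_on k U f"
  by (induction k arbitrary: f) (auto intro: continuous_at_imp_continuous_on differentiable_imp_continuous_within)

lemma Ck_on_subset: "Ck_on k U f \<Longrightarrow> V \<subseteq> U \<Longrightarrow> Ck_on k V f"
  by (induction k arbitrary: f) (auto intro: continuous_on_subset)

lemma Ck_on_cong:
  assumes "open U" "\<And>x. x \<in> U \<Longrightarrow> f x = g x" "Ck_on k U f"
  shows "Ck_on k U g"
  using assms(2,3)
proof (induction k arbitrary: f g)
  case 0
  then show ?case by (metis Ck_on.simps(1) continuous_on_cong)
next
  case (Suc k)
  have D: "(g has_derivative frechet_derivative f (at x)) (at x)" if "x \<in> U" for x
    using has_derivative_transform_within_open[OF Ck_on_imp_has_derivative[OF Suc.prems(2) that] assms(1) that]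
      Suc.prems(1) by blast
  have E: "frechet_derivative g (at x) = frechet_derivative f (at x)" if "x \<in> U" for x
    using frechet_derivative_at[OF D[OF that]] by simp
  show ?case
    using D E Suc.prems Suc.IH[of "dd v f" "dd v g" for v]
    unfolding Ck_on.simps differentiable_def by metis
qed

lemma Ck_on_SucI:
  assumes "open U" "\<And>x. x \<in> U \<Longrightarrow> (f has_derivative f' x) (at x)" "\<And>v. Ck_on k U (\<lambda>x. f' x v)"
  shows "Ck_on (Suc k) U f"
proof -
  have "f' x = frechet_derivative f (at x)" if "x \<in> U" for x
    using frechet_derivative_at assms(2) that by blast
  then show ?thesis
    using assms(2) Ck_on_cong[OF assms(1) _ assms(3)] by (auto simp: differentiable_def)
qed

lemma Ck_on_const: "Ck_on k U (\<lambda>x. c)"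
  by (induction k arbitrary: c) (auto simp: frechet_derivative_const)

lemma Ck_on_compose_linear:
  assumes "open U" "bounded_linear L" "Ck_on k U f"
  shows "Ck_on k U (\<lambda>x. L (f x))"
  using assms(3)
proof (induction k arbitrary: f)
  case 0
  then show ?case using assms(2) by (simp add: bounded_linear.continuous_on)
next
  case (Suc k)
  show ?case
  proof (rule Ck_on_SucI[OF assms(1)])
    show "((\<lambda>x. L (f x)) has_derivative (\<lambda>v. L (frechet_derivative f (at x) v))) (at x)" if "x \<in> U" for x
      by (rule bounded_linear.has_derivative[OF assms(2) Ck_on_imp_has_derivative[OF Suc.prems that]])
    show "Ck_on k U (\<lambda>x. L (frechet_derivative f (at x) v))" for v
      using Suc by auto
  qed
qed

lemma Ck_on_add:
  assumes "open U" "Ck_on k U f" "Ck_on k U g"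
  shows "Ck_on k U (\<lambda>x. f x + g x)"
  using assms(2,3)
proof (induction k arbitrary: f g)
  case 0
  then show ?case by (simp add: continuous_on_add)
next
  case (Suc k)
  show ?case
  proof (rule Ck_on_SucI[OF assms(1)])
    show "((\<lambda>x. f x + g x) has_derivative (\<lambda>v. frechet_derivative f (at x) v + frechet_derivative g (at x) v)) (at x)"
      if "x \<in> U" for x
      by (rule has_derivative_add[OF Suc.prems[THEN Ck_on_imp_has_derivative, OF that]])
    show "Ck_on k U (\<lambda>x. frechet_derivative f (at x) v + frechet_derivative g (at x) v)" for v
      using Suc by auto
  qed
qed

lemma (in bounded_bilinear) Ck_on_bilinear:
  assumes "open U" "Ck_on k U f" "Ck_on k U g"
  shows "Ck_on k U (\<lambda>x. prod (f x) (g x))"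
  using assms(2,3)
proof (induction k arbitrary: f g)
  case 0
  then show ?case by (simp add: continuous_on)
next
  case (Suc k)
  show ?case
  proof (rule Ck_on_SucI[OF assms(1)])
    show "((\<lambda>x. prod (f x) (g x)) has_derivative
       (\<lambda>v. prod (f x) (frechet_derivative g (at x) v) + prod (frechet_derivative f (at x) v) (g x))) (at x)"
      if "x \<in> U" for x
      by (rule FDERIV[OF Suc.prems[THEN Ck_on_imp_has_derivative, OF that]])
    show "Ck_on k U (\<lambda>x. prod (f x) (frechet_derivative g (at x) v) + prod (frechet_derivative f (at x) v) (g x))" for v
      using Suc.prems Ck_on_SucD[OF Suc.prems(1)] Ck_on_SucD[OF Suc.prems(2)]
      by (intro Ck_on_add[OF assms(1)] Suc.IH) auto
  qed
qed

lemmas Ck_on_mult = bounded_bilinear.Ck_on_bilinear[OF bounded_bilinear_mult]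
lemmas Ck_on_scaleR = bounded_bilinear.Ck_on_bilinear[OF bounded_bilinear_scaleR]
lemmas Ck_on_inner = bounded_bilinear.Ck_on_bilinear[OF bounded_bilinear_inner]
lemmas bounded_bilinear_cross3 = bilinear_conv_bounded_bilinear[THEN iffD1, OF bilinear_cross]
lemmas Ck_on_cross3 = bounded_bilinear.Ck_on_bilinear[OF bounded_bilinear_cross3]
lemmas Ck_on_minus = Ck_on_compose_linear[OF _ bounded_linear_minus[OF bounded_linear_ident]]

lemma Ck_on_diff:
  assumes "open U" "Ck_on k U f" "Ck_on k U g"
  shows "Ck_on k U (\<lambda>x. f x - g x)"
  using Ck_on_add[OF assms(1,2) Ck_on_minus[OF assms(1,3)]] by simp

lemma Ck_on_inverse:
  fixes f :: "'a::real_normed_vector \<Rightarrow> real"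
  assumes "open U" "Ck_on k U f" "\<And>x. x \<in> U \<Longrightarrow> f x \<noteq> 0"
  shows "Ck_on k U (\<lambda>x. inverse (f x))"
  using assms(2)
proof (induction k)
  case 0
  then show ?case using assms(3) by (auto intro: continuous_on_inverse)
next
  case (Suc k)
  show ?case
  proof (rule Ck_on_SucI[OF assms(1)])
    show "((\<lambda>x. inverse (f x)) has_derivative
       (\<lambda>v. - (inverse (f x) * frechet_derivative f (at x) v * inverse (f x)))) (at x)" if "x \<in> U" for x
      by (rule Deriv.has_derivative_inverse[OF assms(3)[OF that] Ck_on_imp_has_derivative[OF Suc.prems that]])
    show "Ck_on k U (\<lambda>x. - (inverse (f x) * frechet_derivative f (at x) v * inverse (f x)))" for v
      using Suc.prems Suc.IH[OF Ck_on_SucD[OF Suc.prems]]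
      by (intro Ck_on_minus Ck_on_mult assms(1)) auto
  qed
qed

lemma Ck_on_sqrt:
  fixes f :: "'a::real_normed_vector \<Rightarrow> real"
  assumes "open U" "Ck_on k U f" "\<And>x. x \<in> U \<Longrightarrow> f x > 0"
  shows "Ck_on k U (\<lambda>x. sqrt (f x))"
  using assms(2)
proof (induction k)
  case 0
  then show ?case by (auto intro: continuous_intros)
next
  case (Suc k)
  show ?case
  proof (rule Ck_on_SucI[OF assms(1)])
    show "((\<lambda>x. sqrt (f x)) has_derivative
       (\<lambda>v. (1/2) * (frechet_derivative f (at x) v * inverse (sqrt (f x))))) (at x)" if "x \<in> U" for x
      using assms(3)[OF that]
      by (auto intro!: derivative_eq_intros Ck_on_imp_has_derivative[OF Suc.prems that] simp: field_simps)
    show "Ck_on k U (\<lambda>x. (1/2) * (frechet_derivative f (at x) v * inverse (sqrt (f x))))" for v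
      using Suc.prems Suc.IH[OF Ck_on_SucD[OF Suc.prems]] assms(3)
      by (intro Ck_on_mult Ck_on_inverse assms(1) Ck_on_const) (auto simp: less_imp_neq[symmetric])
  qed
qed

lemma Ck_on_norm:
  fixes f :: "'a::real_normed_vector \<Rightarrow> 'b::real_inner"
  assumes "open U" "Ck_on k U f" "\<And>x. x \<in> U \<Longrightarrow> f x \<noteq> 0"
  shows "Ck_on k U (\<lambda>x. norm (f x))"
  unfolding norm_eq_sqrt_inner
  by (rule Ck_on_sqrt[OF assms(1) Ck_on_inner[OF assms(1,2,2)]]) (simp add: assms(3))

lemma Ck_on_affine:
  assumes "open U" "bounded_linear A" "\<And>x. x \<in> U \<Longrightarrow> p + A x \<in> V" "Ck_on k V f"
  shows "Ck_on k U (\<lambda>x. f (p + A x))"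
  using assms(4)
proof (induction k arbitrary: f)
  case 0
  have "continuous_on U (\<lambda>x. p + A x)"
    by (intro continuous_intros bounded_linear.continuous_on[OF assms(2)])
  then show ?case using 0 assms(3) by (auto intro: continuous_on_compose2)
next
  case (Suc k)
  show ?case
  proof (rule Ck_on_SucI[OF assms(1)])
    fix x assume "x \<in> U"
    have "((\<lambda>x. p + A x) has_derivative A) (at x)"
      using bounded_linear_imp_has_derivative[OF assms(2), of "at x"]
      by (auto intro!: derivative_eq_intros)
    from has_derivative_compose[OF this Ck_on_imp_has_derivative[OF Suc.prems assms(3)[OF \<open>x \<in> U\<close>]]]
    show "((\<lambda>x. f (p + A x)) has_derivative (\<lambda>v. frechet_derivative f (at (p + A x)) (A v))) (at x)" .
  next
    show "Ck_on k U (\<lambda>x. frechet_derivative f (at (p + A x)) (A v))" for v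
      using Suc by auto
  qed
qed

text \<open>The symmetry of second derivatives. Two applications of the mean value theorem turn the second
  difference of \<open>f\<close> over the parallelogram spanned by \<open>s v\<close> and \<open>s w\<close> into a value of one iterated
  derivative nearby; since that difference is symmetric in \<open>v\<close> and \<open>w\<close>, both iterated derivatives have the
  same limit as \<open>s\<close> tends to \<open>0\<close>.\<close>

lemma second_difference:
  fixes f :: "'a::real_normed_vector \<Rightarrow> real"
  assumes C: "Ck_on 2 U f" and s: "s > 0"
    and U: "\<And>x y. 0 \<le> x \<Longrightarrow> x \<le> s \<Longrightarrow> 0 \<le> y \<Longrightarrow> y \<le> s \<Longrightarrow> u + x *\<^sub>R v + y *\<^sub>R w \<in> U"
  obtains x y where "0 < x" "x < s" "0 < y" "y < s"
    "f (u + s *\<^sub>R v + s *\<^sub>R w) - f (u + s *\<^sub>R v) - f (u + s *\<^sub>R w) + f u = s * s * dd w (dd v f) (u + x *\<^sub>R v + y *\<^sub>R w)"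
proof -
  have D: "(f has_derivative frechet_derivative f (at z)) (at z)" if "z \<in> U" for z
    using C that by (simp add: numeral_2_eq_2 frechet_derivative_works)
  have D2: "(dd v f has_derivative frechet_derivative (dd v f) (at z)) (at z)" if "z \<in> U" for z
    using C that by (simp add: numeral_2_eq_2 frechet_derivative_works)
  have 1: "((\<lambda>x. f (u + x *\<^sub>R v + y *\<^sub>R w)) has_real_derivative dd v f (u + x *\<^sub>R v + y *\<^sub>R w)) (at x)"
    if "0 \<le> x" "x \<le> s" "0 \<le> y" "y \<le> s" for x y
  proof -
    have "((\<lambda>x. u + x *\<^sub>R v + y *\<^sub>R w) has_derivative (\<lambda>t. t *\<^sub>R v)) (at x)"
      by (auto intro!: derivative_eq_intros)
    note has_derivative_compose[OF this D[OF U[OF that]]]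
    moreover have "linear (frechet_derivative f (at (u + x *\<^sub>R v + y *\<^sub>R w)))"
      using D[OF U[OF that]] has_derivative_linear by blast
    then have "(\<lambda>t. frechet_derivative f (at (u + x *\<^sub>R v + y *\<^sub>R w)) (t *\<^sub>R v)) = (*) (frechet_derivative f (at (u + x *\<^sub>R v + y *\<^sub>R w)) v)"
      by (simp add: fun_eq_iff linear_cmul)
    ultimately show ?thesis
      by (simp only: has_field_derivative_def)
  qed
  have 2: "((\<lambda>y. dd v f (u + x *\<^sub>R v + y *\<^sub>R w)) has_real_derivative dd w (dd v f) (u + x *\<^sub>R v + y *\<^sub>R w)) (at y)"
    if "0 \<le> x" "x \<le> s" "0 \<le> y" "y \<le> s" for x y
  proof -
    have "((\<lambda>y. u + x *\<^sub>R v + y *\<^sub>R w) has_derivative (\<lambda>t. t *\<^sub>R w)) (at y)"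
      by (auto intro!: derivative_eq_intros)
    note has_derivative_compose[OF this D2[OF U[OF that]]]
    moreover have "linear (frechet_derivative (dd v f) (at (u + x *\<^sub>R v + y *\<^sub>R w)))"
      using D2[OF U[OF that]] has_derivative_linear by blast
    then have "(\<lambda>t. frechet_derivative (dd v f) (at (u + x *\<^sub>R v + y *\<^sub>R w)) (t *\<^sub>R w)) = (*) (frechet_derivative (dd v f) (at (u + x *\<^sub>R v + y *\<^sub>R w)) w)"
      by (simp add: fun_eq_iff linear_cmul)
    ultimately show ?thesis
      by (simp only: has_field_derivative_def)
  qed
  define \<phi> where "\<phi> x = f (u + x *\<^sub>R v + s *\<^sub>R w) - f (u + x *\<^sub>R v + 0 *\<^sub>R w)" for x
  have "(\<phi> has_real_derivative dd v f (u + x *\<^sub>R v + s *\<^sub>R w) - dd v f (u + x *\<^sub>R v + 0 *\<^sub>R w)) (at x)"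
    if "0 \<le> x" "x \<le> s" for x
    unfolding \<phi>_def using that s by (intro DERIV_diff 1) auto
  from MVT2[OF s this] obtain x where x: "0 < x" "x < s"
    "\<phi> s - \<phi> 0 = s * (dd v f (u + x *\<^sub>R v + s *\<^sub>R w) - dd v f (u + x *\<^sub>R v + 0 *\<^sub>R w))" by auto
  from MVT2[OF s 2[of x]] x(1,2) obtain y where y: "0 < y" "y < s"
    "dd v f (u + x *\<^sub>R v + s *\<^sub>R w) - dd v f (u + x *\<^sub>R v + 0 *\<^sub>R w) = s * dd w (dd v f) (u + x *\<^sub>R v + y *\<^sub>R w)"
    by auto
  show ?thesis
    using that[OF x(1,2) y(1,2)] x(3) y(3) unfolding \<phi>_def by simp
qed

lemma dd_commute_real:
  fixes f :: "'a::real_normed_vector \<Rightarrow> real"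
  assumes C: "Ck_on 2 U f" and U: "open U" "u \<in> U"
  shows "dd v (dd w f) u = dd w (dd v f) u"
proof (rule ccontr)
  assume ne: "dd v (dd w f) u \<noteq> dd w (dd v f) u"
  define \<epsilon> where "\<epsilon> = \<bar>dd v (dd w f) u - dd w (dd v f) u\<bar> / 2"
  have \<epsilon>: "\<epsilon> > 0" using ne by (simp add: \<epsilon>_def)
  have "isCont (dd w (dd v f)) u" "isCont (dd v (dd w f)) u"
    using C U by (auto simp: numeral_2_eq_2 continuous_on_eq_continuous_at)
  then obtain d1 d2 where d: "d1 > 0" "\<And>z. dist z u < d1 \<Longrightarrow> dist (dd w (dd v f) z) (dd w (dd v f) u) < \<epsilon>"
     "d2 > 0" "\<And>z. dist z u < d2 \<Longrightarrow> dist (dd v (dd w f) z) (dd v (dd w f) u) < \<epsilon>"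
    using \<epsilon> unfolding continuous_at_eps_delta by metis
  obtain d0 where d0: "d0 > 0" "ball u d0 \<subseteq> U" using U open_contains_ball by blast
  define d where "d = min d0 (min d1 d2)"
  define s where "s = d / (2 * (norm v + norm w + 1))"
  have n: "norm v + norm w + 1 > 0" by (simp add: add_nonneg_pos)
  have dpos: "d > 0" using d d0 by (simp add: d_def)
  have s: "s > 0" using n dpos by (simp add: s_def)
  have near: "dist (u + x *\<^sub>R v + y *\<^sub>R w) u < d" if "0 \<le> x" "x \<le> s" "0 \<le> y" "y \<le> s" for x y
  proof -
    have "dist (u + x *\<^sub>R v + y *\<^sub>R w) u \<le> norm (x *\<^sub>R v) + norm (y *\<^sub>R w)"
      by (simp add: dist_norm add.assoc norm_triangle_ineq del: norm_scaleR)
    also have "\<dots> \<le> s * norm v + s * norm w" using that by (simp add: add_mono mult_right_mono)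
    also have "\<dots> \<le> s * (norm v + norm w + 1)" using s by (simp add: algebra_simps)
    also have "\<dots> = d / 2"
    proof -
      have "d / (2 * m) * m = d / 2" if "m > 0" for m :: real using that by simp
      from this[OF n] show ?thesis by (simp only: s_def)
    qed
    also have "\<dots> < d" using dpos by simp
    finally show ?thesis .
  qed
  have inU: "u + x *\<^sub>R v + y *\<^sub>R w \<in> U" if "0 \<le> x" "x \<le> s" "0 \<le> y" "y \<le> s" for x y
    using near[OF that] d0 by (auto simp: d_def dist_commute)
  have inU': "u + x *\<^sub>R w + y *\<^sub>R v \<in> U" if "0 \<le> x" "x \<le> s" "0 \<le> y" "y \<le> s" for x y
    using inU[of y x] that by (simp add: algebra_simps)
  obtain x y where 1: "0 < x" "x < s" "0 < y" "y < s"
    "f (u + s *\<^sub>R v + s *\<^sub>R w) - f (u + s *\<^sub>R v) - f (u + s *\<^sub>R w) + f u = s * s * dd w (dd v f) (u + x *\<^sub>R v + y *\<^sub>R w)"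
    by (rule second_difference[OF C s, of u v w]) (use inU in blast)+
  obtain x' y' where 2: "0 < x'" "x' < s" "0 < y'" "y' < s"
    "f (u + s *\<^sub>R w + s *\<^sub>R v) - f (u + s *\<^sub>R w) - f (u + s *\<^sub>R v) + f u = s * s * dd v (dd w f) (u + x' *\<^sub>R w + y' *\<^sub>R v)"
    by (rule second_difference[OF C s, of u w v]) (use inU' in blast)+
  have "s * s * dd w (dd v f) (u + x *\<^sub>R v + y *\<^sub>R w) = s * s * dd v (dd w f) (u + x' *\<^sub>R w + y' *\<^sub>R v)"
    using 1(5) 2(5) by (simp add: algebra_simps)
  then have eq: "dd w (dd v f) (u + x *\<^sub>R v + y *\<^sub>R w) = dd v (dd w f) (u + y' *\<^sub>R v + x' *\<^sub>R w)"
    using s by (simp add: algebra_simps)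
  have "dist (dd w (dd v f) (u + x *\<^sub>R v + y *\<^sub>R w)) (dd w (dd v f) u) < \<epsilon>"
    using near[of x y] 1 d by (auto simp: d_def)
  moreover have "dist (dd v (dd w f) (u + y' *\<^sub>R v + x' *\<^sub>R w)) (dd v (dd w f) u) < \<epsilon>"
    using near[of y' x'] 2 d by (auto simp: d_def)
  ultimately have "dist (dd v (dd w f) u) (dd w (dd v f) u) < dist (dd v (dd w f) u) (dd w (dd v f) u)"
    unfolding eq \<epsilon>_def dist_real_def[symmetric] by (rule dist_triangle_half_r[rotated])
  then show False by simp
qed

lemma dd_inner_left:
  fixes f :: "'a::real_normed_vector \<Rightarrow> 'b::real_inner"
  assumes "f differentiable (at u)"
  shows "dd v (\<lambda>x. f x \<bullet> z) u = dd v f u \<bullet> z"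
  by (rule dd_eqI[OF has_derivative_inner_left[OF assms[unfolded frechet_derivative_works]]])

lemma dd_commute:
  fixes f :: "'a::real_normed_vector \<Rightarrow> 'b::real_inner"
  assumes C: "Ck_on 2 U f" and U: "open U" "u \<in> U"
  shows "dd v (dd w f) u = dd w (dd v f) u"
proof -
  have eq: "dd a (dd b (\<lambda>x. f x \<bullet> z)) u = dd a (dd b f) u \<bullet> z" for a b z
  proof -
    have D: "f differentiable (at x)" "dd b f differentiable (at x)" if "x \<in> U" for x
      using C that by (auto simp: numeral_2_eq_2)
    have "((\<lambda>x. dd b f x \<bullet> z) has_derivative (\<lambda>a. dd a (dd b f) u \<bullet> z)) (at u)"
      by (rule has_derivative_inner_left[OF D(2)[OF U(2), unfolded frechet_derivative_works]])
    then have "(dd b (\<lambda>x. f x \<bullet> z) has_derivative (\<lambda>a. dd a (dd b f) u \<bullet> z)) (at u)"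
      by (rule has_derivative_transform_within_open[OF _ U]) (simp add: dd_inner_left D)
    from dd_eqI[OF this] show ?thesis .
  qed
  have "dd v (dd w f) u \<bullet> z = dd w (dd v f) u \<bullet> z" for z
    using dd_commute_real[OF Ck_on_inner[OF U(1) C Ck_on_const[where c=z]] U, of v w] by (simp only: eq)
  then have "\<forall>z. dd v (dd w f) u \<bullet> z = dd w (dd v f) u \<bullet> z" by (rule allI)
  then show ?thesis by (simp only: vector_eq_rdot)
qed

section \<open>The structure equations\<close>

lemma orthonormal_frame_expansion:
  fixes N e z :: "real^3"
  assumes "norm N = 1" "norm e = 1" "e \<bullet> N = 0"
  shows "norm (N \<times> e) = 1"
    and "z = (z \<bullet> e) *\<^sub>R e + (z \<bullet> (N \<times> e)) *\<^sub>R (N \<times> e) + (z \<bullet> N) *\<^sub>R N"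
proof -
  have NN: "N \<bullet> N = 1" and ee: "e \<bullet> e = 1" using assms by (auto simp: dot_square_norm)
  have Ne: "N \<bullet> e = 0" using assms by (simp add: inner_commute)
  have "(norm (N \<times> e))\<^sup>2 = 1" using norm_cross[of N e] assms Ne by simp
  then show n: "norm (N \<times> e) = 1" by (smt (verit) norm_ge_zero power2_eq_1_iff)
  then have EE: "(N \<times> e) \<bullet> (N \<times> e) = 1" by (simp add: dot_square_norm)
  define d where "d = z - ((z \<bullet> e) *\<^sub>R e + (z \<bullet> (N \<times> e)) *\<^sub>R (N \<times> e) + (z \<bullet> N) *\<^sub>R N)"
  have d: "d \<bullet> e = 0" "d \<bullet> N = 0" "d \<bullet> (N \<times> e) = 0"
    using NN ee EE assms(3) Ne
    by (simp_all add: d_def inner_diff_left inner_add_left dot_cross_self)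
  have "d \<times> (N \<times> e) = 0" by (simp add: Lagrange d)
  then have "(norm d)\<^sup>2 = 0" using norm_cross[of d "N \<times> e"] d n by simp
  then show "z = (z \<bullet> e) *\<^sub>R e + (z \<bullet> (N \<times> e)) *\<^sub>R (N \<times> e) + (z \<bullet> N) *\<^sub>R N"
    by (simp add: d_def)
qed

text \<open>The exterior derivative of an identity between 1-forms. Because second derivatives
  are symmetric, antisymmetrizing in the two directions removes those of \<open>Y\<close> and \<open>X\<close>. The equations of
  Codazzi and Gauss and the closedness of the differential of \<open>f\<close> are all instances.\<close>

lemma exterior_derivative_identity:
  fixes Y :: "'a::real_normed_vector \<Rightarrow> 'b::real_inner" and X :: "'a \<Rightarrow> 'c::real_inner"
  assumes B: "open B" "u \<in> B" and C2: "Ck_on 2 B Y" "Ck_on 2 B X"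
    and D: "Z differentiable (at u)" "Z' differentiable (at u)" "k differentiable (at u)"
    and eq: "\<And>x v. x \<in> B \<Longrightarrow> dd v Y x \<bullet> Z x = k x * (dd v X x \<bullet> Z' x)"
  shows "dd v Y u \<bullet> dd w Z u - dd w Y u \<bullet> dd v Z u =
    dd w k u * (dd v X u \<bullet> Z' u) - dd v k u * (dd w X u \<bullet> Z' u)
      + k u * (dd v X u \<bullet> dd w Z' u - dd w X u \<bullet> dd v Z' u)"
proof -
  have main: "dd w (dd v Y) u \<bullet> Z u + dd v Y u \<bullet> dd w Z u =
     dd w k u * (dd v X u \<bullet> Z' u) + k u * (dd w (dd v X) u \<bullet> Z' u + dd v X u \<bullet> dd w Z' u)" for v w
  proof -
    have DY: "(dd v Y has_derivative (\<lambda>w. dd w (dd v Y) u)) (at u)"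
      and DX: "(dd v X has_derivative (\<lambda>w. dd w (dd v X) u)) (at u)"
      using C2 B by (auto simp: numeral_2_eq_2 frechet_derivative_works[symmetric])
    note D' = D[unfolded frechet_derivative_works]
    have "((\<lambda>x. dd v Y x \<bullet> Z x) has_derivative (\<lambda>w. dd v Y u \<bullet> dd w Z u + dd w (dd v Y) u \<bullet> Z u)) (at u)"
      by (rule has_derivative_inner[OF DY D'(1)])
    then have 1: "dd w (\<lambda>x. dd v Y x \<bullet> Z x) u = dd v Y u \<bullet> dd w Z u + dd w (dd v Y) u \<bullet> Z u"
      by (rule dd_eqI)
    have "((\<lambda>x. k x * (dd v X x \<bullet> Z' x)) has_derivative
       (\<lambda>w. k u * (dd v X u \<bullet> dd w Z' u + dd w (dd v X) u \<bullet> Z' u) + dd w k u * (dd v X u \<bullet> Z' u))) (at u)"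
      by (rule has_derivative_mult[OF D'(3) has_derivative_inner[OF DX D'(2)]])
    then have "((\<lambda>x. dd v Y x \<bullet> Z x) has_derivative
       (\<lambda>w. k u * (dd v X u \<bullet> dd w Z' u + dd w (dd v X) u \<bullet> Z' u) + dd w k u * (dd v X u \<bullet> Z' u))) (at u)"
      by (rule has_derivative_transform_within_open[OF _ B]) (simp add: eq)
    then have "dd w (\<lambda>x. dd v Y x \<bullet> Z x) u =
      k u * (dd v X u \<bullet> dd w Z' u + dd w (dd v X) u \<bullet> Z' u) + dd w k u * (dd v X u \<bullet> Z' u)"
      by (rule dd_eqI)
    with 1 show ?thesis by (simp add: algebra_simps)
  qed
  show ?thesis
    using main[of w v] main[of v w] dd_commute[OF C2(1) B, of v w] dd_commute[OF C2(2) B, of v w]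
    by (simp add: algebra_simps)
qed

lemma dd_inner_const:
  fixes Y Z :: "'a::real_normed_vector \<Rightarrow> 'b::real_inner"
  assumes B: "open B" "u \<in> B" and D: "Y differentiable (at u)" "Z differentiable (at u)"
    and eq: "\<And>x. x \<in> B \<Longrightarrow> Y x \<bullet> Z x = c"
  shows "dd v Y u \<bullet> Z u = - (Y u \<bullet> dd v Z u)"
proof -
  have "((\<lambda>x. Y x \<bullet> Z x) has_derivative (\<lambda>v. Y u \<bullet> dd v Z u + dd v Y u \<bullet> Z u)) (at u)"
    by (rule has_derivative_inner[OF D[unfolded frechet_derivative_works]])
  moreover have "((\<lambda>x. Y x \<bullet> Z x) has_derivative (\<lambda>v. 0)) (at u)"
    by (rule has_derivative_transform_within_open[OF has_derivative_const B]) (simp add: eq)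
  ultimately have "Y u \<bullet> dd v Z u + dd v Y u \<bullet> Z u = 0"
    using has_derivative_unique by metis
  then show ?thesis by simp
qed

text \<open>A surface patch \<open>X\<close> with unit normal \<open>N\<close> and a principal frame \<open>e\<close>, \<open>E = N \<times> e\<close> for the curvatures
  \<open>- f / 2\<close> and \<open>3 * f / 2\<close>, in which the gradient of the mean curvature \<open>f\<close> is \<open>F e\<close>. The sign of \<open>F\<close> is
  left open because on the two sides of the neck of the model surface, where the gradient vanishes, a
  smoothly varying frame has \<open>F\<close> of opposite signs.\<close>

locale principal_frame =
  fixes B :: "(real^2) set" and X N e :: "real^2 \<Rightarrow> real^3" and f F :: "real^2 \<Rightarrow> real"
  assumes B: "open B"
    and C2: "Ck_on 2 B X" "Ck_on 2 B N" "Ck_on 2 B e" "Ck_on 2 B f"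
    and C1: "Ck_on 1 B F"
    and norms: "\<And>u. u \<in> B \<Longrightarrow> norm (N u) = 1" "\<And>u. u \<in> B \<Longrightarrow> norm (e u) = 1" "\<And>u. u \<in> B \<Longrightarrow> e u \<bullet> N u = 0"
    and tangent: "\<And>u v. u \<in> B \<Longrightarrow> dd v X u \<bullet> N u = 0"
    and immersion: "\<And>u v. u \<in> B \<Longrightarrow> dd v X u = 0 \<Longrightarrow> v = 0"
    and tangent_surj: "\<And>u z. u \<in> B \<Longrightarrow> z \<bullet> N u = 0 \<Longrightarrow> \<exists>v. dd v X u = z"
    and gradient: "\<And>u v. u \<in> B \<Longrightarrow> dd v f u = F u * (dd v X u \<bullet> e u)"
    and shape: "\<And>u v. u \<in> B \<Longrightarrow> dd v N u =
          (f u / 2 * (dd v X u \<bullet> e u)) *\<^sub>R e u - (3 * f u / 2 * (dd v X u \<bullet> (N u \<times> e u))) *\<^sub>R (N u \<times> e u)"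
    and F_nz: "\<And>u. u \<in> B \<Longrightarrow> F u \<noteq> 0"
begin

definition E where "E u = N u \<times> e u"

text \<open>By the Codazzi equations below, \<open>h\<close> is the geodesic curvature of the level curves of \<open>f\<close>.\<close>

definition h where "h u = 3 * F u / (4 * f u)"

lemma E_C2: "Ck_on 2 B E"
  unfolding E_def[abs_def] by (rule Ck_on_cross3[OF B C2(2,3)])

lemma diff_at:
  assumes "u \<in> B"
  shows "X differentiable (at u)" "N differentiable (at u)" "e differentiable (at u)"
     "E differentiable (at u)" "f differentiable (at u)" "F differentiable (at u)"
  using C2 C1 E_C2 assms by (auto simp: numeral_2_eq_2)

lemma frame_inner:
  assumes "u \<in> B"
  shows "e u \<bullet> e u = 1" "E u \<bullet> E u = 1" "N u \<bullet> N u = 1" "e u \<bullet> E u = 0" "E u \<bullet> e u = 0"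
    "e u \<bullet> N u = 0" "N u \<bullet> e u = 0" "E u \<bullet> N u = 0" "N u \<bullet> E u = 0"
  using norms[OF assms] orthonormal_frame_expansion(1)[OF norms[OF assms]]
  by (auto simp: dot_square_norm E_def dot_cross_self inner_commute)

lemma expansion:
  assumes "u \<in> B"
  shows "z = (z \<bullet> e u) *\<^sub>R e u + (z \<bullet> E u) *\<^sub>R E u + (z \<bullet> N u) *\<^sub>R N u"
  using orthonormal_frame_expansion(2)[OF norms[OF assms]] unfolding E_def .

lemma inner_expansion:
  assumes "u \<in> B"
  shows "y \<bullet> z = (y \<bullet> e u) * (z \<bullet> e u) + (y \<bullet> E u) * (z \<bullet> E u) + (y \<bullet> N u) * (z \<bullet> N u)"
  by (subst expansion[OF assms, of y]) (simp add: inner_add_left inner_add_right inner_commute)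

lemma shape_inner:
  assumes "u \<in> B"
  shows "dd v N u \<bullet> e u = f u / 2 * (dd v X u \<bullet> e u)"
    "dd v N u \<bullet> E u = - (3 * f u / 2) * (dd v X u \<bullet> E u)" "dd v N u \<bullet> N u = 0"
  using shape[OF assms, of v] frame_inner[OF assms]
  by (auto simp: inner_diff_left E_def[symmetric])

lemma connection:
  assumes u: "u \<in> B"
  shows "dd v e u \<bullet> e u = 0" "dd v e u \<bullet> N u = - (f u / 2 * (dd v X u \<bullet> e u))"
    "dd v E u \<bullet> E u = 0" "dd v E u \<bullet> N u = 3 * f u / 2 * (dd v X u \<bullet> E u)"
    "dd v E u \<bullet> e u = - (dd v e u \<bullet> E u)"
proof -
  note d = diff_at[OF u]
  show "dd v e u \<bullet> e u = 0"
    using dd_inner_const[OF B u d(3) d(3), of 1 v] frame_inner by (simp add: inner_commute)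
  show "dd v E u \<bullet> E u = 0"
    using dd_inner_const[OF B u d(4) d(4), of 1 v] frame_inner by (simp add: inner_commute)
  show "dd v e u \<bullet> N u = - (f u / 2 * (dd v X u \<bullet> e u))"
    using dd_inner_const[OF B u d(3) d(2), of 0 v] frame_inner shape_inner[OF u, of v]
    by (simp add: inner_commute)
  show "dd v E u \<bullet> N u = 3 * f u / 2 * (dd v X u \<bullet> E u)"
    using dd_inner_const[OF B u d(4) d(2), of 0 v] frame_inner shape_inner[OF u, of v]
    by (simp add: inner_commute)
  show "dd v E u \<bullet> e u = - (dd v e u \<bullet> E u)"
    using dd_inner_const[OF B u d(4) d(3), of 0 v] frame_inner by (simp add: inner_commute)
qed

text \<open>The frame is reached by the directions \<open>a\<close> and \<open>b\<close> of the parameter plane, so a linear identity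
  between 1-forms at \<open>u\<close> need only be checked on them.\<close>

lemma dual_directions:
  assumes u: "u \<in> B"
  obtains a b where "dd a X u = e u" "dd b X u = E u"
    "\<And>v. v = (dd v X u \<bullet> e u) *\<^sub>R a + (dd v X u \<bullet> E u) *\<^sub>R b"
proof -
  obtain a b where ab: "dd a X u = e u" "dd b X u = E u"
    using tangent_surj[OF u] frame_inner[OF u] by metis
  have lin: "linear (frechet_derivative X (at u))"
    by (rule linear_frechet_derivative[OF diff_at(1)[OF u]])
  have "v = (dd v X u \<bullet> e u) *\<^sub>R a + (dd v X u \<bullet> E u) *\<^sub>R b" for v
  proof -
    have "dd (v - ((dd v X u \<bullet> e u) *\<^sub>R a + (dd v X u \<bullet> E u) *\<^sub>R b)) X u = 0"
      using expansion[OF u, of "dd v X u"]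
      by (simp add: linear_diff[OF lin] linear_add[OF lin] linear_cmul[OF lin] ab tangent[OF u])
    from immersion[OF u this] show ?thesis by simp
  qed
  then show ?thesis using that ab by blast
qed

lemma linear_by_directions:
  assumes u: "u \<in> B" and Y: "Y differentiable (at u)"
    and v: "v = \<alpha> *\<^sub>R a + \<beta> *\<^sub>R b"
  shows "dd v Y u = \<alpha> *\<^sub>R dd a Y u + \<beta> *\<^sub>R dd b Y u"
  unfolding v using linear_frechet_derivative[OF Y] by (simp add: linear_add linear_cmul)

text \<open>The two Codazzi equations are the exterior derivatives of the components of \<open>dN\<close> along \<open>e\<close> and \<open>E\<close>.
  The first one reads \<open>f \<omega>(a) = 0\<close> and the second one \<open>2 f \<omega>(b) = - 3 F / 2\<close> for the connection form
  \<open>\<omega> = de \<bullet> E\<close>. As \<open>F\<close> has no zero, the second one also excludes zeros of \<open>f\<close>.\<close>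

lemma codazzi:
  assumes u: "u \<in> B" and ab: "dd a X u = e u" "dd b X u = E u"
  shows "f u \<noteq> 0" "dd a e u \<bullet> E u = 0" "dd b e u \<bullet> E u = - h u" "dd b F u = 0"
proof -
  note d = diff_at[OF u]
  note fi = frame_inner[OF u]
  note sh = shape_inner[OF u] and cn = connection[OF u]
  have X: "dd a X u \<bullet> z = e u \<bullet> z" "dd b X u \<bullet> z = E u \<bullet> z" for z by (auto simp: ab)
  have df: "(\<lambda>x. f x / 2) differentiable (at u)" "(\<lambda>x. - (3 * f x / 2)) differentiable (at u)"
    using d(5) by (auto intro!: derivative_intros)
  have df': "dd v (\<lambda>x. f x / 2) u = dd v f u / 2" "dd v (\<lambda>x. - (3 * f x / 2)) u = - 3 / 2 * dd v f u" for v
  proof -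
    have "((\<lambda>x. f x / 2) has_derivative (\<lambda>v. dd v f u / 2)) (at u)"
      "((\<lambda>x. - (3 * f x / 2)) has_derivative (\<lambda>v. - 3 / 2 * dd v f u)) (at u)"
      using d(5) by (auto intro!: derivative_eq_intros simp: frechet_derivative_works)
    from this[THEN dd_eqI] show "dd v (\<lambda>x. f x / 2) u = dd v f u / 2"
      "dd v (\<lambda>x. - (3 * f x / 2)) u = - 3 / 2 * dd v f u" .
  qed
  define \<omega>a \<omega>b where "\<omega>a = dd a e u \<bullet> E u" and "\<omega>b = dd b e u \<bullet> E u"
  have exp: "dd v Y u \<bullet> dd w Z u = (dd v Y u \<bullet> e u) * (dd w Z u \<bullet> e u)
      + (dd v Y u \<bullet> E u) * (dd w Z u \<bullet> E u) + (dd v Y u \<bullet> N u) * (dd w Z u \<bullet> N u)"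
    for v w and Y Z :: "real^2 \<Rightarrow> real^3" by (rule inner_expansion[OF u])
  have g: "dd a f u = F u" "dd b f u = 0" using gradient[OF u] by (auto simp: X fi)
  have c1: "f u * \<omega>a = 0"
    using exterior_derivative_identity[OF B u C2(2) C2(1) d(3) d(3) df(1), of a b]
      shape_inner(1)
    by (simp add: exp sh cn X fi df' g \<omega>a_def \<omega>b_def)
  have c2: "2 * f u * \<omega>b = - (3 / 2 * F u)"
    using exterior_derivative_identity[OF B u C2(2) C2(1) d(4) d(4) df(2) shape_inner(2), of a b]
    unfolding exp sh cn X fi df' g \<omega>a_def \<omega>b_def by (simp add: algebra_simps)
  show nz: "f u \<noteq> 0" using c2 F_nz[OF u] by auto
  show "dd a e u \<bullet> E u = 0" using c1 nz by (simp add: \<omega>a_def)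
  have "\<omega>b = - h u" using c2 nz by (simp add: h_def field_simps)
  then show "dd b e u \<bullet> E u = - h u" by (simp add: \<omega>b_def)
  have one: "(\<lambda>x. 1::real) differentiable (at u)" by simp
  show "dd b F u = 0"
    using exterior_derivative_identity[OF B u C2(4) C2(1) one d(3) d(6), of a b] gradient nz c1
    by (simp add: exp cn X fi frechet_derivative_const \<omega>a_def)
qed

lemma f_nz: "u \<in> B \<Longrightarrow> f u \<noteq> 0"
  using codazzi(1) dual_directions by metis

lemma dd_e:
  assumes u: "u \<in> B"
  shows "dd v e u \<bullet> E u = - h u * (dd v X u \<bullet> E u)"
proof -
  obtain a b where ab: "dd a X u = e u" "dd b X u = E u"
    "\<And>v. v = (dd v X u \<bullet> e u) *\<^sub>R a + (dd v X u \<bullet> E u) *\<^sub>R b"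
    using dual_directions[OF u] by metis
  show ?thesis
    using linear_by_directions[OF u diff_at(3)[OF u] ab(3)[of v]] codazzi[OF u ab(1,2)]
    by (simp add: inner_add_left)
qed

lemma h_has_derivative:
  assumes u: "u \<in> B"
  shows "(h has_derivative (\<lambda>v. 3 / 4 * (dd v F u / f u - F u * dd v f u / (f u)\<^sup>2))) (at u)"
  unfolding h_def[abs_def] using diff_at[OF u] f_nz[OF u]
  by (auto intro!: derivative_eq_intros simp: frechet_derivative_works field_simps power2_eq_square)

text \<open>The Gauss equation is the exterior derivative of \<open>\<omega>(v) = - h (dX v \<bullet> E)\<close>. Together with the fact that
  \<open>h\<close> is constant along the level curves of \<open>f\<close> it becomes a Riccati equation for \<open>h\<close> along \<open>e\<close>.\<close>

lemma dd_h:
  assumes u: "u \<in> B"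
  shows "dd v h u = ((h u)\<^sup>2 - 3 / 4 * (f u)\<^sup>2) * (dd v X u \<bullet> e u)"
proof -
  obtain a b where ab: "dd a X u = e u" "dd b X u = E u"
    "\<And>v. v = (dd v X u \<bullet> e u) *\<^sub>R a + (dd v X u \<bullet> E u) *\<^sub>R b"
    using dual_directions[OF u] by metis
  note d = diff_at[OF u]
  note fi = frame_inner[OF u] and cn = connection[OF u] and cod = codazzi[OF u ab(1,2)]
  have X: "dd a X u \<bullet> z = e u \<bullet> z" "dd b X u \<bullet> z = E u \<bullet> z" for z by (auto simp: ab)
  have dh: "h differentiable (at u)" using h_has_derivative[OF u] differentiable_def by blast
  have hb: "dd b h u = 0"
    using dd_eqI[OF h_has_derivative[OF u], of b] gradient[OF u, of b] cod by (simp add: X fi)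
  have dh': "(\<lambda>x. - h x) differentiable (at u)" using dh by (auto intro!: derivative_intros)
  have dh'': "dd v (\<lambda>x. - h x) u = - dd v h u" for v
    by (rule dd_eqI[OF has_derivative_minus[OF dh[unfolded frechet_derivative_works]]])
  have exp: "dd v Y u \<bullet> dd w Z u = (dd v Y u \<bullet> e u) * (dd w Z u \<bullet> e u)
      + (dd v Y u \<bullet> E u) * (dd w Z u \<bullet> E u) + (dd v Y u \<bullet> N u) * (dd w Z u \<bullet> N u)"
    for v w and Y Z :: "real^2 \<Rightarrow> real^3" by (rule inner_expansion[OF u])
  have ha: "dd a h u = (h u)\<^sup>2 - 3 / 4 * (f u)\<^sup>2"
    using exterior_derivative_identity[OF B u C2(3) C2(1) d(4) d(4) dh', of a b] dd_e
    by (simp add: exp cn X fi dh'' hb cod power2_eq_square algebra_simps)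
  show ?thesis
    using linear_by_directions[OF u dh ab(3)[of v]] ha hb by simp
qed

lemma dd_h_has_derivative:
  "u \<in> B \<Longrightarrow> (h has_derivative (\<lambda>v. ((h u)\<^sup>2 - 3 / 4 * (f u)\<^sup>2) * (dd v X u \<bullet> e u))) (at u)"
  using h_has_derivative[of u] dd_h[of u] dd_eqI[OF h_has_derivative[of u]] by simp

lemma dd_e_has_derivative:
  assumes u: "u \<in> B"
  shows "(e has_derivative (\<lambda>v. - (h u * (dd v X u \<bullet> E u)) *\<^sub>R E u - (f u / 2 * (dd v X u \<bullet> e u)) *\<^sub>R N u)) (at u)"
proof -
  have "dd v e u = - (h u * (dd v X u \<bullet> E u)) *\<^sub>R E u - (f u / 2 * (dd v X u \<bullet> e u)) *\<^sub>R N u" for v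
    using expansion[OF u, of "dd v e u"] connection(1,2)[OF u, of v] dd_e[OF u, of v] by simp
  then show ?thesis
    using diff_at(3)[OF u] unfolding frechet_derivative_works by (rule has_derivative_eq_rhs[rotated, OF ext])
qed

lemma dd_f_has_derivative:
  assumes u: "u \<in> B"
  shows "(f has_derivative (\<lambda>v. 4 / 3 * f u * h u * (dd v X u \<bullet> e u))) (at u)"
proof -
  have "dd v f u = 4 / 3 * f u * h u * (dd v X u \<bullet> e u)" for v
    using gradient[OF u, of v] f_nz[OF u] by (simp add: h_def)
  then show ?thesis
    using diff_at(5)[OF u] unfolding frechet_derivative_works by (rule has_derivative_eq_rhs[rotated, OF ext])
qed

end

section \<open>The first integrals\<close>

definition model_height :: "real \<Rightarrow> real \<Rightarrow> real" where
  "model_height R t = 3 * R / 2 * (sinh t * cosh t + t)"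

lemma sech_tanh: "1 / cosh t * (1 / cosh t) + tanh t * tanh t = (1::real)"
proof -
  have "1 / cosh t * (1 / cosh t) + tanh t * tanh t = ((sinh t)\<^sup>2 + 1) / (cosh t)\<^sup>2"
    by (simp add: tanh_def power2_eq_square add_divide_distrib)
  then show ?thesis by (simp add: cosh_square_eq[symmetric])
qed

locale positive_principal_frame = principal_frame +
  assumes f_pos: "\<And>u. u \<in> B \<Longrightarrow> f u > 0"
begin

text \<open>The level curves of \<open>f\<close> have the curvature vector \<open>h e + (3 f / 2) N\<close>, whose squared length is \<open>P\<close>. They are
  circles of radius \<open>1 / sqrt P\<close> about a common axis: \<open>radial\<close> points from the axis to the surface and
  \<open>axis_dir\<close> completes it to an orthonormal basis of the plane of \<open>e\<close> and \<open>N\<close>. On the model surface with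
  neck radius \<open>R\<close> and parameter \<open>t\<close> one has \<open>f = 2 / (3 R cosh t ^ 4)\<close> and \<open>P = 1 / (R\<^sup>2 cosh t ^ 6)\<close>; solving
  these equations for \<open>R\<close> and \<open>sinh t\<close> gives \<open>neck_radius\<close> and \<open>param\<close>.\<close>

definition P where "P u = (h u)\<^sup>2 + 9 / 4 * (f u)\<^sup>2"
definition neck_radius where "neck_radius u = 27 / 8 * (f u) ^ 3 / (P u)\<^sup>2"
definition axis_dir where "axis_dir u = (1 / sqrt (P u)) *\<^sub>R ((3 / 2 * f u) *\<^sub>R e u - h u *\<^sub>R N u)"
definition radial where "radial u = - (1 / sqrt (P u)) *\<^sub>R (h u *\<^sub>R e u + (3 / 2 * f u) *\<^sub>R N u)"
definition param where "param u = arsinh (- 2 * h u / (3 * f u))"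
definition centre where
  "centre u = X u - (1 / sqrt (P u)) *\<^sub>R radial u - model_height (neck_radius u) (param u) *\<^sub>R axis_dir u"

lemma P_pos: "u \<in> B \<Longrightarrow> P u > 0"
  using f_pos[of u] unfolding P_def by (intro add_nonneg_pos) auto

lemma cosh_param:
  assumes u: "u \<in> B"
  shows "cosh (param u) = 2 * sqrt (P u) / (3 * f u)"
proof -
  have f: "f u > 0" by (rule f_pos[OF u])
  have "(- 2 * h u / (3 * f u))\<^sup>2 + 1 = 4 * P u / (9 * (f u)\<^sup>2)"
    using f by (simp add: P_def power_divide field_simps)
  also have "\<dots> = (2 * sqrt (P u) / (3 * f u))\<^sup>2"
    using P_pos[OF u] by (simp add: power_divide power_mult_distrib)
  finally show ?thesis
    using f P_pos[OF u] unfolding param_def cosh_arsinh_real by simp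
qed

lemma sinh_param: "sinh (param u) = - 2 * h u / (3 * f u)"
  by (simp add: param_def)

lemma h_eq:
  assumes u: "u \<in> B"
  shows "h u = - (3 / 2 * f u * sinh (param u))"
  using f_pos[OF u] by (simp add: sinh_param)

lemma radius_eq:
  assumes u: "u \<in> B"
  shows "neck_radius u * cosh (param u) ^ 3 = 1 / sqrt (P u)"
proof -
  have f: "f u > 0" and P: "P u > 0" using f_pos P_pos u by auto
  have "27 / 8 * x ^ 3 / (y\<^sup>2)\<^sup>2 * (2 * y / (3 * x)) ^ 3 = 1 / y" if "x > 0" "y > 0" for x y :: real
    using that by (simp add: field_simps eval_nat_numeral)
  from this[OF f, of "sqrt (P u)"] show ?thesis
    using P by (simp add: cosh_param[OF u] neck_radius_def)
qed

lemma neck_radius_pos: "u \<in> B \<Longrightarrow> neck_radius u > 0"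
  unfolding neck_radius_def using f_pos[of u] P_pos[of u] by simp

lemma f_eq:
  assumes u: "u \<in> B"
  shows "f u = 2 / (3 * neck_radius u * cosh (param u) ^ 4)"
proof -
  have f: "f u > 0" and P: "P u > 0" using f_pos P_pos u by auto
  have "neck_radius u * cosh (param u) ^ 4 = (neck_radius u * cosh (param u) ^ 3) * cosh (param u)"
    by (simp add: power_numeral_reduce)
  also have "\<dots> = 1 / sqrt (P u) * cosh (param u)" by (simp only: radius_eq[OF u])
  also have "\<dots> = 2 / (3 * f u)" using f P by (simp add: cosh_param[OF u])
  finally have "3 * neck_radius u * cosh (param u) ^ 4 = 2 / f u" by simp
  then show ?thesis using f by simp
qed

lemma F_eq:
  assumes u: "u \<in> B"
  shows "F u = - 8 * sinh (param u) / (9 * (neck_radius u)\<^sup>2 * cosh (param u) ^ 8)"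
proof -
  have "F u = 4 / 3 * f u * h u" using f_pos[OF u] by (simp add: h_def)
  also have "\<dots> = - 2 * (f u)\<^sup>2 * sinh (param u)" by (simp add: h_eq[OF u] power2_eq_square)
  also have "(f u)\<^sup>2 = 4 / (9 * (neck_radius u)\<^sup>2 * cosh (param u) ^ 8)"
    by (subst f_eq[OF u]) (simp add: power_divide power_mult_distrib flip: power_mult)
  finally show ?thesis by simp
qed

lemma quotients:
  assumes u: "u \<in> B"
  shows "3 / 2 * f u / sqrt (P u) = 1 / cosh (param u)" "h u / sqrt (P u) = - tanh (param u)"
proof -
  have f: "f u > 0" and P: "P u > 0" using f_pos P_pos u by auto
  show "3 / 2 * f u / sqrt (P u) = 1 / cosh (param u)" unfolding cosh_param[OF u] using f P by simp
  show "h u / sqrt (P u) = - tanh (param u)"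
    unfolding tanh_def cosh_param[OF u] sinh_param using f P by (simp add: field_simps)
qed

lemma axis_dir_eq: "u \<in> B \<Longrightarrow> axis_dir u = (1 / cosh (param u)) *\<^sub>R e u + tanh (param u) *\<^sub>R N u"
  using quotients[of u] by (simp add: axis_dir_def scaleR_diff_right)

lemma radial_eq: "u \<in> B \<Longrightarrow> radial u = tanh (param u) *\<^sub>R e u - (1 / cosh (param u)) *\<^sub>R N u"
  using quotients[of u] by (simp add: radial_def scaleR_add_right)

lemma radial_axis_orthonormal:
  assumes u: "u \<in> B"
  shows "norm (axis_dir u) = 1" "norm (radial u) = 1" "axis_dir u \<bullet> radial u = 0"
proof -
  note fi = frame_inner[OF u]
  have "axis_dir u \<bullet> axis_dir u = 1" "radial u \<bullet> radial u = 1"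
    using sech_tanh[of "param u"]
    by (simp_all add: axis_dir_eq[OF u] radial_eq[OF u] inner_add_left inner_add_right inner_diff_left inner_diff_right fi)
  then show "norm (axis_dir u) = 1" "norm (radial u) = 1" by (simp_all add: norm_eq_sqrt_inner)
  show "axis_dir u \<bullet> radial u = 0"
    by (simp add: axis_dir_eq[OF u] radial_eq[OF u] inner_add_left inner_diff_right fi)
qed

lemma N_eq:
  assumes u: "u \<in> B"
  shows "N u = tanh (param u) *\<^sub>R axis_dir u - (1 / cosh (param u)) *\<^sub>R radial u"
proof -
  have "tanh (param u) *\<^sub>R axis_dir u - (1 / cosh (param u)) *\<^sub>R radial u
    = (1 / cosh (param u) * (1 / cosh (param u)) + tanh (param u) * tanh (param u)) *\<^sub>R N u"
    by (simp add: axis_dir_eq[OF u] radial_eq[OF u] algebra_simps)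
  then show ?thesis by (simp only: sech_tanh scaleR_one)
qed

lemma e_eq:
  assumes u: "u \<in> B"
  shows "e u = (1 / cosh (param u)) *\<^sub>R axis_dir u + tanh (param u) *\<^sub>R radial u"
proof -
  have "(1 / cosh (param u)) *\<^sub>R axis_dir u + tanh (param u) *\<^sub>R radial u
    = (1 / cosh (param u) * (1 / cosh (param u)) + tanh (param u) * tanh (param u)) *\<^sub>R e u"
    by (simp add: axis_dir_eq[OF u] radial_eq[OF u] algebra_simps)
  then show ?thesis by (simp only: sech_tanh scaleR_one)
qed

lemma X_eq:
  assumes u: "u \<in> B"
  shows "X u = centre u + (neck_radius u * cosh (param u) ^ 3) *\<^sub>R radial u + model_height (neck_radius u) (param u) *\<^sub>R axis_dir u"
  unfolding radius_eq[OF u] by (simp add: centre_def)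

lemma dd_X: "u \<in> B \<Longrightarrow> dd v X u = (dd v X u \<bullet> e u) *\<^sub>R e u + (dd v X u \<bullet> E u) *\<^sub>R E u"
  using expansion[of u "dd v X u"] tangent[of u v] by simp

lemma dd_N_has_derivative:
  assumes u: "u \<in> B"
  shows "(N has_derivative (\<lambda>v. (f u / 2 * (dd v X u \<bullet> e u)) *\<^sub>R e u - (3 * f u / 2 * (dd v X u \<bullet> E u)) *\<^sub>R E u)) (at u)"
  using diff_at(2)[OF u] unfolding frechet_derivative_works
  by (rule has_derivative_eq_rhs) (simp add: fun_eq_iff shape[OF u] E_def)

lemma P_has_derivative:
  assumes u: "u \<in> B"
  shows "(P has_derivative (\<lambda>v. 2 * h u * P u * (dd v X u \<bullet> e u))) (at u)"
  unfolding P_def[abs_def]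
  by (rule has_derivative_eq_rhs, (rule derivative_eq_intros dd_h_has_derivative[OF u] dd_f_has_derivative[OF u] refl)+)
    (auto simp: algebra_simps power2_eq_square)

lemma inverse_sqrt_P_has_derivative:
  assumes u: "u \<in> B"
  shows "((\<lambda>u. 1 / sqrt (P u)) has_derivative (\<lambda>v. - (h u * (dd v X u \<bullet> e u)) / sqrt (P u))) (at u)"
proof -
  have P: "P u > 0" by (rule P_pos[OF u])
  have "((\<lambda>x. 1 / sqrt x) has_real_derivative (- (1 / (2 * P u * sqrt (P u))))) (at (P u))"
    using P by (auto intro!: derivative_eq_intros simp: field_simps)
  from has_derivative_compose[OF P_has_derivative[OF u] this[unfolded has_field_derivative_def]]
  show ?thesis by (rule has_derivative_eq_rhs) (use P in \<open>auto simp: field_simps\<close>)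
qed

text \<open>A constancy that rests on \<open>df = (4 / 3) f h \<theta>\<close> and \<open>dP = 2 h P \<theta>\<close> for the form \<open>\<theta>(v) = dX v \<bullet> e\<close>.\<close>

lemma neck_radius_has_derivative:
  assumes u: "u \<in> B"
  shows "(neck_radius has_derivative (\<lambda>v. 0)) (at u)"
proof -
  have P: "P u > 0" by (rule P_pos[OF u])
  have "((\<lambda>u. 27 / 8 * (f u) ^ 3 * (1 / sqrt (P u)) ^ 4) has_derivative (\<lambda>v. 0)) (at u)"
    by (rule has_derivative_eq_rhs, (rule derivative_eq_intros inverse_sqrt_P_has_derivative[OF u] dd_f_has_derivative[OF u] refl)+)
      (use P in \<open>auto simp: fun_eq_iff field_simps eval_nat_numeral\<close>)
  then show ?thesis
  proof (rule has_derivative_transform_within_open[OF _ B u])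
    fix x assume "x \<in> B"
    then have "P x > 0" by (rule P_pos)
    then have "sqrt (P x) ^ 4 = (P x)\<^sup>2"
      by (metis less_imp_le mult_2_right numeral_Bit0 power2_eq_square power_add real_sqrt_pow2)
    then show "27 / 8 * (f x) ^ 3 * (1 / sqrt (P x)) ^ 4 = neck_radius x"
      by (simp add: neck_radius_def power_divide)
  qed
qed

text \<open>The vector \<open>(3 f / 2) e - h N\<close> is multiplied by the same factor \<open>h \<theta>\<close> as its length, so its
  direction does not change.\<close>

lemma axis_dir_has_derivative:
  assumes u: "u \<in> B"
  shows "(axis_dir has_derivative (\<lambda>v. 0)) (at u)"
proof -
  have "((\<lambda>u. (3 / 2 * f u) *\<^sub>R e u - h u *\<^sub>R N u) has_derivative
     (\<lambda>v. (h u * (dd v X u \<bullet> e u)) *\<^sub>R ((3 / 2 * f u) *\<^sub>R e u - h u *\<^sub>R N u))) (at u)"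
    by (rule has_derivative_eq_rhs, (rule derivative_eq_intros dd_f_has_derivative[OF u] dd_h_has_derivative[OF u]
        dd_e_has_derivative[OF u] dd_N_has_derivative[OF u] refl)+)
      (simp add: fun_eq_iff algebra_simps power2_eq_square flip: scaleR_add_left)
  from has_derivative_scaleR[OF inverse_sqrt_P_has_derivative[OF u] this]
  show ?thesis unfolding axis_dir_def[abs_def]
    by (rule has_derivative_eq_rhs) (simp add: fun_eq_iff algebra_simps)
qed

lemma curvature_vector_has_derivative:
  assumes u: "u \<in> B"
  shows "((\<lambda>u. (1 / sqrt (P u)) *\<^sub>R radial u) has_derivative
     (\<lambda>v. (dd v X u \<bullet> E u) *\<^sub>R E u - (h u * (dd v X u \<bullet> e u) / sqrt (P u)) *\<^sub>R radial u)) (at u)"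
proof -
  have P: "P u > 0" by (rule P_pos[OF u])
  have q: "P u * y / sqrt (P u) = sqrt (P u) * y" for y
  proof -
    have "P u * y / sqrt (P u) = (P u / sqrt (P u)) * y" by simp
    then show ?thesis using P by (simp add: real_div_sqrt)
  qed
  have "((\<lambda>u. h u *\<^sub>R e u + (3 / 2 * f u) *\<^sub>R N u) has_derivative
     (\<lambda>v. (h u * (dd v X u \<bullet> e u)) *\<^sub>R (h u *\<^sub>R e u + (3 / 2 * f u) *\<^sub>R N u) - ((dd v X u \<bullet> E u) * P u) *\<^sub>R E u)) (at u)"
    unfolding P_def
    by (rule has_derivative_eq_rhs, (rule derivative_eq_intros dd_f_has_derivative[OF u] dd_h_has_derivative[OF u]
        dd_e_has_derivative[OF u] dd_N_has_derivative[OF u] refl)+)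
      (simp add: fun_eq_iff algebra_simps power2_eq_square flip: scaleR_add_left)
  note * = has_derivative_scaleR[OF has_derivative_minus[OF inverse_sqrt_P_has_derivative[OF u]] this]
  have "(radial has_derivative (\<lambda>v. (sqrt (P u) * (dd v X u \<bullet> E u)) *\<^sub>R E u)) (at u)"
    unfolding radial_def[abs_def]
    by (rule has_derivative_eq_rhs[OF *]) (use P in \<open>simp add: fun_eq_iff algebra_simps q\<close>)
  from has_derivative_scaleR[OF inverse_sqrt_P_has_derivative[OF u] this]
  show ?thesis by (rule has_derivative_eq_rhs) (use P in \<open>simp add: fun_eq_iff algebra_simps\<close>)
qed

lemma height_has_derivative:
  assumes u: "u \<in> B"
  shows "((\<lambda>u. model_height (neck_radius u) (param u)) has_derivative (\<lambda>v. 1 / cosh (param u) * (dd v X u \<bullet> e u))) (at u)"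
proof -
  have f: "f u > 0" and P: "P u > 0" using f_pos P_pos u by auto
  define s where "s u = - 2 * h u / (3 * f u)" for u
  have ds: "(s has_derivative (\<lambda>v. 2 * P u / (9 * f u) * (dd v X u \<bullet> e u))) (at u)"
    unfolding s_def[abs_def]
    by (rule has_derivative_eq_rhs, (rule derivative_eq_intros dd_f_has_derivative[OF u] dd_h_has_derivative[OF u] refl | (use f in \<open>simp; fail\<close>))+)
      (use f in \<open>auto simp: fun_eq_iff P_def field_simps power2_eq_square\<close>)
  have sq: "s u ^ 2 + 1 > 0" by (intro add_nonneg_pos) auto
  have "((\<lambda>s. s * sqrt (s\<^sup>2 + 1) + arsinh s) has_real_derivative 2 * sqrt (s u ^ 2 + 1)) (at (s u))"
    using sq by (auto intro!: derivative_eq_intros simp: field_simps power2_eq_square)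
  from has_derivative_compose[OF ds this[unfolded has_field_derivative_def]]
  have "((\<lambda>u. s u * sqrt (s u ^ 2 + 1) + arsinh (s u)) has_derivative
     (\<lambda>v. 2 * sqrt (s u ^ 2 + 1) * (2 * P u / (9 * f u) * (dd v X u \<bullet> e u)))) (at u)" .
  moreover have "s x * sqrt (s x ^ 2 + 1) + arsinh (s x) = sinh (param x) * cosh (param x) + param x" for x
    by (simp add: param_def s_def cosh_arsinh_real)
  moreover have "sqrt (s u ^ 2 + 1) = cosh (param u)"
    by (simp add: param_def s_def cosh_arsinh_real)
  ultimately have "((\<lambda>u. sinh (param u) * cosh (param u) + param u) has_derivative
     (\<lambda>v. 2 * cosh (param u) * (2 * P u / (9 * f u) * (dd v X u \<bullet> e u)))) (at u)" by simp
  from has_derivative_mult[OF has_derivative_mult[OF has_derivative_const[of "3/2"] neck_radius_has_derivative[OF u]] this]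
  have "((\<lambda>u. model_height (neck_radius u) (param u)) has_derivative
    (\<lambda>v. 3 / 2 * neck_radius u * (2 * cosh (param u) * (2 * P u / (9 * f u) * (dd v X u \<bullet> e u))))) (at u)"
    by (simp add: model_height_def)
  then have "((\<lambda>u. model_height (neck_radius u) (param u)) has_derivative
    (\<lambda>v. 3 / 2 * neck_radius u * (2 * cosh (param u) * (2 * P u / (9 * f u))) * (dd v X u \<bullet> e u))) (at u)"
    by (rule has_derivative_eq_rhs) (simp add: ac_simps)
  moreover have "3 / 2 * neck_radius u * (2 * cosh (param u) * (2 * P u / (9 * f u))) = 1 / cosh (param u)"
  proof -
    have "P u = (sqrt (P u))\<^sup>2" using P by simp
    also have "sqrt (P u) = 3 / 2 * f u * cosh (param u)" using f by (simp add: cosh_param[OF u])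
    finally have "P u = 9 / 4 * (f u)\<^sup>2 * (cosh (param u))\<^sup>2" by (simp add: power_mult_distrib power2_eq_square)
    then have "3 / 2 * neck_radius u * (2 * cosh (param u) * (2 * P u / (9 * f u)))
        = 3 / 2 * neck_radius u * f u * cosh (param u) ^ 3"
      using f by (simp add: field_simps eval_nat_numeral)
    also have "\<dots> = 1 / cosh (param u)"
      by (subst f_eq[OF u]) (use neck_radius_pos[OF u] in \<open>simp add: field_simps eval_nat_numeral\<close>)
    finally show ?thesis .
  qed
  ultimately show ?thesis by (simp only:)
qed

text \<open>The centres of the level circles move along the axis, and the height of the model surface has
  been chosen to move at the same rate.\<close>

lemma centre_has_derivative:
  assumes u: "u \<in> B"
  shows "(centre has_derivative (\<lambda>v. 0)) (at u)"
proof -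
  note * = has_derivative_diff[OF has_derivative_diff[OF diff_at(1)[OF u, unfolded frechet_derivative_works]
     curvature_vector_has_derivative[OF u]]
     has_derivative_scaleR[OF height_has_derivative[OF u] axis_dir_has_derivative[OF u]]]
  have "dd v X u - ((dd v X u \<bullet> E u) *\<^sub>R E u - (h u * (dd v X u \<bullet> e u) / sqrt (P u)) *\<^sub>R radial u)
     - (1 / cosh (param u) * (dd v X u \<bullet> e u)) *\<^sub>R axis_dir u = 0" for v
  proof -
    define \<alpha> where "\<alpha> = dd v X u \<bullet> e u"
    have 1: "dd v X u - (dd v X u \<bullet> E u) *\<^sub>R E u = \<alpha> *\<^sub>R e u"
      using dd_X[OF u, of v] unfolding \<alpha>_def by (metis add_diff_cancel_right')
    have "h u * \<alpha> / sqrt (P u) = h u / sqrt (P u) * \<alpha>" by simp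
    then have 2: "h u * \<alpha> / sqrt (P u) = - tanh (param u) * \<alpha>" by (simp only: quotients(2)[OF u])
    have 3: "\<alpha> *\<^sub>R e u = (1 / cosh (param u) * \<alpha>) *\<^sub>R axis_dir u + (tanh (param u) * \<alpha>) *\<^sub>R radial u"
      by (subst e_eq[OF u]) (simp add: algebra_simps)
    show ?thesis
      using 1 3 unfolding \<alpha>_def[symmetric] 2 by (simp add: algebra_simps)
  qed
  then show ?thesis unfolding centre_def[abs_def]
    by (intro has_derivative_eq_rhs[OF *]) (simp add: fun_eq_iff)
qed

lemma first_integrals_constant:
  assumes "convex K" "K \<subseteq> B" "u \<in> K" "w \<in> K"
  shows "neck_radius u = neck_radius w" "axis_dir u = axis_dir w" "centre u = centre w"
proof -
  have *: "Y u = Y w" if "\<And>x. x \<in> B \<Longrightarrow> (Y has_derivative (\<lambda>v. 0)) (at x)" for Y :: "real^2 \<Rightarrow> 'c::real_normed_vector"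
    using has_derivative_zero_constant[OF assms(1), of Y] that assms by (metis has_derivative_at_withinI subsetD)
  show "neck_radius u = neck_radius w" "axis_dir u = axis_dir w" "centre u = centre w"
    using *[of neck_radius] *[of axis_dir] *[of centre] neck_radius_has_derivative axis_dir_has_derivative centre_has_derivative
    by blast+
qed

end

section \<open>Charts of a surface in space\<close>

lemma at_within_openin:
  assumes "openin (top_of_set S) V" "x \<in> V"
  shows "at x within S = at x within V"
proof -
  obtain T where T: "open T" "V = S \<inter> T" using assms(1) by (auto simp: openin_open)
  show ?thesis by (rule at_within_nhd[of x T]) (use T assms in auto)
qed

text \<open>The inverse of a chart is differentiable within the surface: near \<open>u\<close> the distance \<open>norm (z - u)\<close> is
  at most a multiple of \<open>norm (X z - X u)\<close>, so the error of the linear approximation of \<open>X\<close> is small also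
  compared with the latter.\<close>

lemma chart_inverse_has_derivative:
  fixes X :: "'a::euclidean_space \<Rightarrow> 'b::euclidean_space"
  assumes u: "u \<in> U" and inj: "inj_on X U" and op: "openin (top_of_set S) (X ` U)"
    and cont: "continuous_on (X ` U) (inv_into U X)"
    and D: "(X has_derivative D) (at u)" and L: "linear L" "L \<circ> D = id"
  shows "(inv_into U X has_derivative L) (at (X u) within S)"
proof -
  let ?g = "inv_into U X"
  have bl: "bounded_linear L" using L(1) linear_conv_bounded_linear by blast
  obtain K where K: "K > 0" "\<And>z. norm (L z) \<le> K * norm z"
    using bounded_linear.pos_bounded[OF bl] by (metis mult.commute)
  have LD: "L (D z) = z" for z using L(2) by (metis comp_apply id_apply)
  have gu: "?g (X u) = u" using inj u by simp
  have "(?g has_derivative L) (at (X u) within X ` U)"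
    unfolding has_derivative_within_alt
  proof (intro conjI bl allI impI)
    fix e :: real assume e: "e > 0"
    define e1 where "e1 = min (1 / (2 * K)) (e / (2 * K\<^sup>2))"
    have e1: "e1 > 0" "K * e1 \<le> 1 / 2" "K * e1 * (2 * K) \<le> e"
      using K e by (auto simp: e1_def min_def field_simps power2_eq_square)
    obtain d where d: "d > 0"
      "\<And>y. norm (y - u) < d \<Longrightarrow> norm (X y - X u - D (y - u)) \<le> e1 * norm (y - u)"
      using D e1(1) unfolding has_derivative_at_alt by blast
    have "X u \<in> X ` U" using u by simp
    then obtain d' where d': "d' > 0" "\<And>y. y \<in> X ` U \<Longrightarrow> dist y (X u) < d' \<Longrightarrow> dist (?g y) (?g (X u)) < d"
      using cont d(1) unfolding continuous_on_iff by metis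
    show "\<exists>d>0. \<forall>y\<in>X ` U. norm (y - X u) < d \<longrightarrow>
        norm (?g y - ?g (X u) - L (y - X u)) \<le> e * norm (y - X u)"
    proof (intro exI[of _ d'] conjI d' ballI impI)
      fix y assume y: "y \<in> X ` U" "norm (y - X u) < d'"
      define z where "z = ?g y"
      have Xz: "X z = y" using y by (simp add: z_def f_inv_into_f)
      have "norm (z - u) < d" using d'(2)[OF y(1)] y(2) by (simp add: z_def gu dist_norm)
      note * = d(2)[OF this]
      have "z - u - L (y - X u) = - L (X z - X u - D (z - u))"
        using L(1) by (simp add: linear_diff LD Xz)
      then have "norm (z - u - L (y - X u)) = norm (L (X z - X u - D (z - u)))" by simp
      also have "\<dots> \<le> K * (e1 * norm (z - u))"
        using K(2) order_trans mult_left_mono[OF *] K(1) by (meson less_imp_le)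
      finally have 1: "norm (z - u - L (y - X u)) \<le> K * e1 * norm (z - u)" by simp
      also have "\<dots> \<le> 1 / 2 * norm (z - u)" using e1(2) by (rule mult_right_mono) simp
      finally have "norm (z - u) \<le> 2 * norm (L (y - X u))"
        using norm_triangle_ineq2[of "z - u" "L (y - X u)"] by simp
      also have "\<dots> \<le> 2 * K * norm (y - X u)" using K(2)[of "y - X u"] by simp
      finally have "norm (z - u) \<le> 2 * K * norm (y - X u)" .
      then have "K * e1 * norm (z - u) \<le> K * e1 * (2 * K * norm (y - X u))"
        using K(1) e1(1) by (intro mult_left_mono) auto
      also have "\<dots> \<le> e * norm (y - X u)"
        using mult_right_mono[OF e1(3), of "norm (y - X u)"] by (simp add: mult.assoc)
      finally show "norm (?g y - ?g (X u) - L (y - X u)) \<le> e * norm (y - X u)"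
        using 1 by (simp add: z_def[symmetric] gu)
    qed
  qed
  then show ?thesis using at_within_openin[OF op] u by simp
qed

text \<open>Hence derivatives within the surface are computed in charts.\<close>

lemma chart_pullback:
  fixes X :: "'a::euclidean_space \<Rightarrow> 'b::euclidean_space"
  assumes u: "u \<in> U" and inj: "inj_on X U" and op: "openin (top_of_set S) (X ` U)"
    and cont: "continuous_on (X ` U) (inv_into U X)"
    and D: "(X has_derivative D) (at u)" and injD: "inj D"
  shows "\<exists>L. linear L \<and> (\<forall>v. L (D v) = v) \<and>
    (\<forall>(F :: 'b \<Rightarrow> 'c::real_normed_vector) D'. ((F \<circ> X) has_derivative D') (at u) \<longrightarrow>
        (F has_derivative (\<lambda>z. D' (L z))) (at (X u) within S))"
proof -
  obtain L where L: "linear L" "L \<circ> D = id"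
    using linear_injective_left_inverse[OF has_derivative_linear[OF D] injD] by blast
  have gu: "inv_into U X (X u) = u" using inj u by simp
  show ?thesis
  proof (intro exI[of _ L] conjI allI impI L(1))
    show "L (D v) = v" for v using L(2) by (simp add: fun_eq_iff)
    fix F :: "'b \<Rightarrow> 'c" and D' assume F: "((F \<circ> X) has_derivative D') (at u)"
    have "((\<lambda>y. (F \<circ> X) (inv_into U X y)) has_derivative (\<lambda>z. D' (L z))) (at (X u) within X ` U)"
      using has_derivative_compose[OF chart_inverse_has_derivative[OF u inj op cont D L], of "F \<circ> X" D'] F
        at_within_openin[OF op, of "X u"] u by (simp only: gu imageI)
    then have "(F has_derivative (\<lambda>z. D' (L z))) (at (X u) within X ` U)"
      by (rule has_derivative_transform[rotated 2]) (use u in \<open>auto simp: f_inv_into_f\<close>)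
    then show "(F has_derivative (\<lambda>z. D' (L z))) (at (X u) within S)"
      using at_within_openin[OF op] u by simp
  qed
qed

lemma injective_onto_orthogonal_complement:
  fixes D :: "real^2 \<Rightarrow> real^3"
  assumes D: "linear D" "\<And>v. D v = 0 \<Longrightarrow> v = 0" and N: "N \<noteq> 0" "\<And>v. D v \<bullet> N = 0"
  shows "range D = {z. z \<bullet> N = 0}"
proof -
  have inj: "inj D" using D by (simp add: linear_injective_0)
  have 1: "subspace (range D)" using D(1) by (simp add: linear_subspace_image)
  have "dim (range D) = 2" using dim_image_eq[OF D(1), of UNIV] inj by simp
  moreover have "{z. z \<bullet> N = 0} = {z. N \<bullet> z = 0}" by (simp add: inner_commute)
  then have 2: "subspace {z. z \<bullet> N = 0}" "dim {z. z \<bullet> N = 0} = 2"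
    using subspace_hyperplane[of N] dim_hyperplane[OF N(1)] by auto
  ultimately show ?thesis
    using subspace_dim_equal[OF 1 2(1)] N(2) by auto
qed

text \<open>The chart \<open>X\<close> is adapted to a unit normal \<open>N\<close>, a mean curvature \<open>f\<close> and its gradient \<open>G\<close>; the last
  clause combines the biconservative equation with \<open>f\<close> being the trace. It says that \<open>G\<close> and \<open>N \<times> G\<close> are principal directions for
  \<open>- f / 2\<close> and \<open>3 * f / 2\<close> and is written without division so as to make sense where \<open>G = 0\<close>.\<close>

definition adapted_chart ::
  "(real^3) set \<Rightarrow> (real^3 \<Rightarrow> real^3) \<Rightarrow> (real^3 \<Rightarrow> real) \<Rightarrow> (real^3 \<Rightarrow> real^3) \<Rightarrow> (real^2) set \<Rightarrow> (real^2 \<Rightarrow> real^3) \<Rightarrow> bool"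
  where "adapted_chart S N f G U X \<longleftrightarrow>
    open U \<and> inj_on X U \<and> openin (top_of_set S) (X ` U) \<and> continuous_on (X ` U) (inv_into U X) \<and>
    smooth_on U X \<and> smooth_on U (N \<circ> X) \<and> smooth_on U (f \<circ> X) \<and> smooth_on U (G \<circ> X) \<and>
    (\<forall>u\<in>U. norm (N (X u)) = 1 \<and> G (X u) \<bullet> N (X u) = 0 \<and>
      (\<forall>v. dd v X u \<bullet> N (X u) = 0 \<and> (dd v X u = 0 \<longrightarrow> v = 0) \<and>
        dd v (f \<circ> X) u = G (X u) \<bullet> dd v X u \<and>
        (G (X u) \<bullet> G (X u)) *\<^sub>R dd v (N \<circ> X) u =
          (f (X u) / 2 * (dd v X u \<bullet> G (X u))) *\<^sub>R G (X u)
          - (3 * f (X u) / 2 * (dd v X u \<bullet> (N (X u) \<times> G (X u)))) *\<^sub>R (N (X u) \<times> G (X u))))"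

lemma adapted_chart_has_derivative:
  assumes A: "adapted_chart S N f G U X" and u: "u \<in> U"
  shows "(X has_derivative frechet_derivative X (at u)) (at u)"
    "((N \<circ> X) has_derivative frechet_derivative (N \<circ> X) (at u)) (at u)"
    "((f \<circ> X) has_derivative frechet_derivative (f \<circ> X) (at u)) (at u)"
    "((G \<circ> X) has_derivative frechet_derivative (G \<circ> X) (at u)) (at u)"
  using A u unfolding adapted_chart_def smooth_on_def by (auto intro!: Ck_on_imp_has_derivative[of 0 U])

lemma adapted_chart_pullback:
  assumes A: "adapted_chart S N f G U X" and u: "u \<in> U"
  shows "\<exists>L. linear L \<and> (\<forall>v. L (dd v X u) = v) \<and>
    (\<forall>(F :: real^3 \<Rightarrow> 'c::real_normed_vector) D'. ((F \<circ> X) has_derivative D') (at u) \<longrightarrow>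
        (F has_derivative (\<lambda>z. D' (L z))) (at (X u) within S))"
proof -
  note D = adapted_chart_has_derivative(1)[OF A u]
  have "inj (frechet_derivative X (at u))"
    using A u has_derivative_linear[OF D] by (auto simp: adapted_chart_def linear_injective_0)
  then show ?thesis
    using A by (intro chart_pullback[OF u _ _ _ D]) (auto simp: adapted_chart_def)
qed

lemma adapted_chart_tangent_surj:
  assumes A: "adapted_chart S N f G U X" and u: "u \<in> U" and z: "z \<bullet> N (X u) = 0"
  obtains w where "dd w X u = z"
proof -
  have "range (frechet_derivative X (at u)) = {z. z \<bullet> N (X u) = 0}"
    using A u by (intro injective_onto_orthogonal_complement has_derivative_linear[OF adapted_chart_has_derivative(1)[OF A u]])
      (auto simp: adapted_chart_def)
  with z have "z \<in> range (frechet_derivative X (at u))" by simp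
  then obtain w where "z = frechet_derivative X (at u) w" by (rule rangeE)
  then show ?thesis using that by simp
qed

text \<open>Where the gradient does not vanish, normalizing it gives a principal frame; \<open>\<sigma>\<close> chooses its sign.\<close>

lemma adapted_chart_principal_frame:
  assumes A: "adapted_chart S N f G U X" and \<sigma>: "\<sigma> = 1 \<or> \<sigma> = - 1"
    and B: "B \<subseteq> U" "open B" "\<And>u. u \<in> B \<Longrightarrow> G (X u) \<noteq> 0"
  shows "principal_frame B X (N \<circ> X) (\<lambda>u. (\<sigma> * inverse (norm (G (X u)))) *\<^sub>R G (X u)) (f \<circ> X) (\<lambda>u. \<sigma> * norm (G (X u)))"
proof -
  have Ck: "Ck_on k B X" "Ck_on k B (N \<circ> X)" "Ck_on k B (f \<circ> X)" "Ck_on k B (\<lambda>u. G (X u))" for k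
    using A B(1) unfolding adapted_chart_def smooth_on_def by (auto intro: Ck_on_subset simp: o_def)
  have n: "Ck_on k B (\<lambda>u. norm (G (X u)))" for k
    by (rule Ck_on_norm[OF B(2) Ck(4) B(3)])
  have \<sigma>2: "\<sigma> * \<sigma> = 1" "\<bar>\<sigma>\<bar> = 1" "\<sigma> \<noteq> 0" using \<sigma> by auto
  show ?thesis
  proof
    show "open B" by (rule B)
    show "Ck_on 2 B X" "Ck_on 2 B (N \<circ> X)" "Ck_on 2 B (f \<circ> X)" by (rule Ck)+
    show "Ck_on 2 B (\<lambda>u. (\<sigma> * inverse (norm (G (X u)))) *\<^sub>R G (X u))"
      by (intro Ck_on_scaleR Ck_on_mult Ck_on_const Ck_on_inverse n B Ck) (use B in auto)
    show "Ck_on 1 B (\<lambda>u. \<sigma> * norm (G (X u)))"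
      by (intro Ck_on_mult Ck_on_const n B)
    fix u assume u: "u \<in> B"
    then have uU: "u \<in> U" and G: "G (X u) \<noteq> 0" using B by auto
    define g where "g = norm (G (X u))"
    have g: "g > 0" "G (X u) \<bullet> G (X u) = g * g" using G by (auto simp: g_def dot_square_norm power2_eq_square)
    note A' = A[unfolded adapted_chart_def, THEN conjunct2, THEN conjunct2, THEN conjunct2, THEN conjunct2,
      THEN conjunct2, THEN conjunct2, THEN conjunct2, THEN conjunct2, rule_format, OF uU]
    show "norm ((N \<circ> X) u) = 1" using A' by simp
    show "norm ((\<sigma> * inverse (norm (G (X u)))) *\<^sub>R G (X u)) = 1" using G \<sigma>2 by (simp add: abs_mult)
    show "(\<sigma> * inverse (norm (G (X u)))) *\<^sub>R G (X u) \<bullet> (N \<circ> X) u = 0" using A' by simp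
    show "\<sigma> * norm (G (X u)) \<noteq> 0" using G \<sigma>2 by simp
    fix v
    show "dd v X u \<bullet> (N \<circ> X) u = 0" using A' by simp
    show "dd v X u = 0 \<Longrightarrow> v = 0" using A' by blast
    show "dd v (f \<circ> X) u = \<sigma> * norm (G (X u)) * (dd v X u \<bullet> (\<sigma> * inverse (norm (G (X u)))) *\<^sub>R G (X u))"
    proof -
      have "\<sigma> * g * (z \<bullet> (\<sigma> * inverse g) *\<^sub>R y) = (\<sigma> * \<sigma>) * (g * inverse g) * (z \<bullet> y)" for z y :: "real^3"
        by simp
      then show ?thesis using A' g(1) \<sigma>2 by (simp add: g_def[symmetric] inner_commute)
    qed
    have "(g * g) *\<^sub>R dd v (N \<circ> X) u =
          (f (X u) / 2 * (dd v X u \<bullet> G (X u))) *\<^sub>R G (X u)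
          - (3 * f (X u) / 2 * (dd v X u \<bullet> (N (X u) \<times> G (X u)))) *\<^sub>R (N (X u) \<times> G (X u))"
      using A' g(2) by simp
    then have *: "(1 / (g * g)) *\<^sub>R (g * g) *\<^sub>R dd v (N \<circ> X) u = (1 / (g * g)) *\<^sub>R
          ((f (X u) / 2 * (dd v X u \<bullet> G (X u))) *\<^sub>R G (X u)
          - (3 * f (X u) / 2 * (dd v X u \<bullet> (N (X u) \<times> G (X u)))) *\<^sub>R (N (X u) \<times> G (X u)))" by simp
    have **: "dd v (N \<circ> X) u = (1 / (g * g)) *\<^sub>R
          ((f (X u) / 2 * (dd v X u \<bullet> G (X u))) *\<^sub>R G (X u)
          - (3 * f (X u) / 2 * (dd v X u \<bullet> (N (X u) \<times> G (X u)))) *\<^sub>R (N (X u) \<times> G (X u)))"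
      using * g by simp
    have eq: "(k / 2 * (z \<bullet> (\<sigma> * inverse g) *\<^sub>R y)) *\<^sub>R (\<sigma> * inverse g) *\<^sub>R y = (1 / (g * g)) *\<^sub>R ((k / 2 * (z \<bullet> y)) *\<^sub>R y)"
      for k and z y :: "real^3"
    proof -
      have "k / 2 * (\<sigma> * inverse g * (z \<bullet> y)) * (\<sigma> * inverse g) = (\<sigma> * \<sigma>) * (1 / (g * g)) * (k / 2 * (z \<bullet> y))"
        by (simp add: field_simps)
      then show ?thesis by (simp add: \<sigma>2)
    qed
    show "dd v (N \<circ> X) u =
       ((f \<circ> X) u / 2 * (dd v X u \<bullet> (\<sigma> * inverse (norm (G (X u)))) *\<^sub>R G (X u))) *\<^sub>R (\<sigma> * inverse (norm (G (X u)))) *\<^sub>R G (X u) -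
       (3 * (f \<circ> X) u / 2 * (dd v X u \<bullet> ((N \<circ> X) u \<times> ((\<sigma> * inverse (norm (G (X u)))) *\<^sub>R G (X u))))) *\<^sub>R
       ((N \<circ> X) u \<times> ((\<sigma> * inverse (norm (G (X u)))) *\<^sub>R G (X u)))"
      unfolding ** g_def[symmetric] cross_mult_right o_apply eq by (simp only: scaleR_diff_right)
  next
    fix u and z :: "real^3" assume u: "u \<in> B" and z: "z \<bullet> (N \<circ> X) u = 0"
    then have "u \<in> U" using B by auto
    then obtain v where "dd v X u = z" using adapted_chart_tangent_surj[OF A, of u z] z by auto
    then show "\<exists>v. dd v X u = z" by blast
  qed
qed

section \<open>Completeness of the intrinsic distance\<close>

lemma curve_lengths_nonneg: "L \<in> curve_lengths S p q \<Longrightarrow> 0 \<le> L"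
  unfolding curve_lengths_def by (auto dest: has_integral_nonneg)

lemma valid_path_derivative:
  assumes "valid_path g"
  obtains s where "finite s" "\<And>x. x \<in> {0..1} - s \<Longrightarrow> (g has_vector_derivative vector_derivative g (at x)) (at x)"
  using assms
  by (auto simp: valid_path_def piecewise_C1_differentiable_on_def C1_differentiable_on_eq vector_derivative_works)

lemma dist_le_curve_length:
  assumes "L \<in> curve_lengths S p q"
  shows "dist p q \<le> L"
proof -
  obtain g where g: "valid_path g" "pathstart g = p" "pathfinish g = q"
    "((\<lambda>t. norm (vector_derivative g (at t))) has_integral L) {0..1}"
    using assms by (auto simp: curve_lengths_def)
  obtain s where s: "finite s"
    "\<And>x. x \<in> {0..1} - s \<Longrightarrow> (g has_vector_derivative vector_derivative g (at x)) (at x)"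
    by (rule valid_path_derivative[OF g(1)]) blast
  have "((\<lambda>t. vector_derivative g (at t)) has_integral (g 1 - g 0)) {0..1}"
    using s g(1) by (intro fundamental_theorem_of_calculus_interior_strong[of s])
      (auto simp: valid_path_def piecewise_C1_differentiable_on_def)
  then have "norm (g 1 - g 0) \<le> L"
    using g(4) by (metis (no_types, lifting) has_integral_integrable integral_norm_bound_integral integral_unique order_refl)
  then show ?thesis using g by (simp add: pathstart_def pathfinish_def dist_norm norm_minus_commute)
qed

lemma intrinsic_dist_le: "L \<in> curve_lengths S p q \<Longrightarrow> intrinsic_dist S p q \<le> L"
  unfolding intrinsic_dist_def by (intro cInf_lower bdd_belowI[of _ 0]) (auto dest: curve_lengths_nonneg)

text \<open>The infimum of the empty set of reals is an arbitrary number, hence the hypothesis.\<close>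

lemma dist_le_intrinsic_dist: "curve_lengths S p q \<noteq> {} \<Longrightarrow> dist p q \<le> intrinsic_dist S p q"
  unfolding intrinsic_dist_def by (intro cInf_greatest dist_le_curve_length)

lemma curve_lengths_join:
  assumes "L1 \<in> curve_lengths S p q" "L2 \<in> curve_lengths S q r"
  shows "L1 + L2 \<in> curve_lengths S p r"
proof -
  obtain g1 where g1: "valid_path g1" "path_image g1 \<subseteq> S" "pathstart g1 = p" "pathfinish g1 = q"
    "((\<lambda>t. norm (vector_derivative g1 (at t))) has_integral L1) {0..1}"
    using assms(1) by (auto simp: curve_lengths_def)
  obtain g2 where g2: "valid_path g2" "path_image g2 \<subseteq> S" "pathstart g2 = q" "pathfinish g2 = r"
    "((\<lambda>t. norm (vector_derivative g2 (at t))) has_integral L2) {0..1}"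
    using assms(2) by (auto simp: curve_lengths_def)
  obtain s1 where s1: "finite s1"
    "\<And>x. x \<in> {0..1} - s1 \<Longrightarrow> (g1 has_vector_derivative vector_derivative g1 (at x)) (at x)"
    by (rule valid_path_derivative[OF g1(1)]) blast
  obtain s2 where s2: "finite s2"
    "\<And>x. x \<in> {0..1} - s2 \<Longrightarrow> (g2 has_vector_derivative vector_derivative g2 (at x)) (at x)"
    by (rule valid_path_derivative[OF g2(1)]) blast
  have i1: "((\<lambda>x. 2 * norm (vector_derivative g1 (at (2 * x)))) has_integral L1) {0..1/2}"
    using has_integral_affinity[OF g1(5)[folded cbox_interval], of 2 0, THEN has_integral_cmul[where c = 2]]
    by (simp add: image_affinity_atLeastAtMost_div_diff image_affinity_atLeastAtMost_div)
  have i2: "((\<lambda>x. 2 * norm (vector_derivative g2 (at (2 * x - 1)))) has_integral L2) {1/2..1}"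
    using has_integral_affinity[OF g2(5)[folded cbox_interval], of 2 "- 1", THEN has_integral_cmul[where c = 2]]
    by (simp add: image_affinity_atLeastAtMost_div_diff image_affinity_atLeastAtMost_div)
  have d1: "vector_derivative (g1 +++ g2) (at z) = 2 *\<^sub>R vector_derivative g1 (at (2 * z))"
    if "0 \<le> z" "z < 1 / 2" "2 * z \<notin> s1" for z
  proof (rule vector_derivative_at [OF has_vector_derivative_transform_within])
    show "0 < \<bar>z - 1/2\<bar>" using that by auto
    have "((*) 2 has_vector_derivative 2) (at z)"
      by (simp add: has_vector_derivative_def has_derivative_def bounded_linear_mult_left)
    then show "((\<lambda>x. g1 (2 * x)) has_vector_derivative 2 *\<^sub>R vector_derivative g1 (at (2 * z))) (at z)"
      using that s1(2)[of "2 * z"] by (intro vector_diff_chain_at [simplified o_def]) auto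
  qed (use that in \<open>simp_all add: joinpaths_def dist_real_def abs_if split: if_split_asm\<close>)
  have d2: "vector_derivative (g1 +++ g2) (at z) = 2 *\<^sub>R vector_derivative g2 (at (2 * z - 1))"
    if "1 / 2 < z" "z \<le> 1" "2 * z - 1 \<notin> s2" for z
  proof (rule vector_derivative_at [OF has_vector_derivative_transform_within])
    show "0 < \<bar>z - 1/2\<bar>" using that by auto
    have "((\<lambda>x. 2 * x - 1) has_vector_derivative 2) (at z)"
      by (simp add: has_vector_derivative_def has_derivative_def bounded_linear_mult_left)
    then show "((\<lambda>x. g2 (2 * x - 1)) has_vector_derivative 2 *\<^sub>R vector_derivative g2 (at (2 * z - 1))) (at z)"
      using that s2(2)[of "2 * z - 1"] by (intro vector_diff_chain_at [simplified o_def]) auto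
  qed (use that in \<open>simp_all add: joinpaths_def dist_real_def abs_if split: if_split_asm\<close>)
  have 1: "((\<lambda>t. norm (vector_derivative (g1 +++ g2) (at t))) has_integral L1) {0..1/2}"
  proof (rule has_integral_spike_finite [OF _ _ i1])
    show "finite (insert (1/2) ((*) 2 -` s1))"
      using s1 by (force intro: finite_vimageI [where h = "(*)2"] inj_onI)
  qed (auto simp: d1)
  have 2: "((\<lambda>t. norm (vector_derivative (g1 +++ g2) (at t))) has_integral L2) {1/2..1}"
  proof (rule has_integral_spike_finite [OF _ _ i2])
    show "finite (insert (1/2) ((\<lambda>x. 2 * x - 1) -` s2))"
      using s2 by (force intro: finite_vimageI [where h = "\<lambda>x. 2*x-1"] inj_onI)
  qed (auto simp: d2)
  have "((\<lambda>t. norm (vector_derivative (g1 +++ g2) (at t))) has_integral (L1 + L2)) {0..1}"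
    by (rule has_integral_combine[OF _ _ 1 2]) auto
  moreover have "valid_path (g1 +++ g2)" using g1 g2 by (intro valid_path_join) auto
  moreover have "path_image (g1 +++ g2) \<subseteq> S" using g1 g2 by (intro subset_path_image_join)
  moreover have "pathstart (g1 +++ g2) = p" "pathfinish (g1 +++ g2) = r" using g1 g2 by auto
  ultimately show ?thesis unfolding curve_lengths_def by (intro CollectI exI[of _ "g1 +++ g2"] conjI)
qed

lemma C1_curve_length:
  assumes d: "\<And>x. x \<in> {0..1} \<Longrightarrow> (g has_vector_derivative g' x) (at x)" and c: "continuous_on {0..1} g'"
    and S: "g ` {0..1} \<subseteq> S" and M: "\<And>x. x \<in> {0..1} \<Longrightarrow> norm (g' x) \<le> M"
  obtains L where "L \<in> curve_lengths S (g 0) (g 1)" "L \<le> M"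
proof -
  have eq: "vector_derivative g (at x) = g' x" if "x \<in> {0..1}" for x
    using vector_derivative_at[OF d[OF that]] .
  have "valid_path g"
    unfolding valid_path_def
    by (rule C1_differentiable_imp_piecewise) (unfold C1_differentiable_on_def, use d c in blast)
  moreover have "(\<lambda>t. norm (g' t)) integrable_on {0..1}"
    using c by (intro integrable_continuous_real continuous_intros)
  then have i: "((\<lambda>t. norm (g' t)) has_integral integral {0..1} (\<lambda>t. norm (g' t))) {0..1}"
    by (rule integrable_integral)
  moreover have "((\<lambda>t. norm (vector_derivative g (at t))) has_integral integral {0..1} (\<lambda>t. norm (g' t))) {0..1}"
    by (rule has_integral_eq[OF _ i]) (simp add: eq)
  ultimately have "integral {0..1} (\<lambda>t. norm (g' t)) \<in> curve_lengths S (g 0) (g 1)"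
    using S unfolding curve_lengths_def
    by (auto simp: path_image_def pathstart_def pathfinish_def intro!: exI[of _ g])
  moreover have "integral {0..1} (\<lambda>t. norm (g' t)) \<le> M"
    using has_integral_le[OF i has_integral_const_real[of M 0 1]] M by auto
  ultimately show ?thesis by (rule that)
qed

text \<open>A curve of finite length in a complete surface cannot leave it at its end point: parameters that
  converge to the end give an intrinsic Cauchy sequence, whose limit in \<open>S\<close> is also its limit in space.\<close>

lemma complete_surface_curve_end:
  assumes compl: "complete_surface S" and conn: "\<And>p q. p \<in> S \<Longrightarrow> q \<in> S \<Longrightarrow> curve_lengths S p q \<noteq> {}"
    and d: "\<And>x. (g has_vector_derivative g' x) (at x)" and c: "continuous_on UNIV g'"
    and s: "s > 0" and S: "\<And>x. 0 \<le> x \<Longrightarrow> x < s \<Longrightarrow> g x \<in> S"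
  shows "g s \<in> S"
proof -
  have "compact (g' ` {0..s})"
    using c by (intro compact_continuous_image) (auto intro: continuous_on_subset)
  from compact_imp_bounded[OF this, unfolded bounded_pos]
  obtain M where "M > 0" and M': "\<forall>y\<in>g' ` {0..s}. norm y \<le> M"
    by (elim exE conjE)
  have M: "norm (g' x) \<le> M" if "x \<in> {0..s}" for x
    using M' that by blast
  have id: "intrinsic_dist S (g x) (g y) \<le> M * \<bar>x - y\<bar>" if xy: "0 \<le> x" "x < s" "0 \<le> y" "y < s" for x y
  proof -
    define k where "k t = g (x + t * (y - x))" for t
    define k' where "k' t = (y - x) *\<^sub>R g' (x + t * (y - x))" for t
    have seg: "0 \<le> x + t * (y - x) \<and> x + t * (y - x) < s" if "t \<in> {0..1}" for t
    proof -
      have "x + t * (y - x) = (1 - t) * x + t * y" by (simp add: algebra_simps)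
      moreover have "(1 - t) * x + t * y \<in> {0..<s}"
        using convexD[of "{0..<s}" x y "1 - t" t] that xy by simp
      ultimately show ?thesis by simp
    qed
    have "(k has_vector_derivative k' t) (at t)" for t
      unfolding k_def k'_def
      by (rule vector_diff_chain_at[of "\<lambda>t. x + t * (y - x)", unfolded o_def, OF _ d])
        (auto intro!: derivative_eq_intros simp: has_real_derivative_iff_has_vector_derivative[symmetric])
    moreover have "continuous_on {0..1} k'"
      unfolding k'_def by (intro continuous_intros continuous_on_compose2[OF c]) auto
    moreover have "k ` {0..1} \<subseteq> S" using seg S by (auto simp: k_def)
    moreover have "norm (k' t) \<le> M * \<bar>x - y\<bar>" if "t \<in> {0..1}" for t
      using M[of "x + t * (y - x)"] seg[OF that]
      by (simp add: k'_def abs_minus_commute mult.commute[of M] mult_left_mono)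
    ultimately obtain L where "L \<in> curve_lengths S (k 0) (k 1)" "L \<le> M * \<bar>x - y\<bar>"
      by (rule C1_curve_length)
    then show ?thesis using intrinsic_dist_le[of L S "g x" "g y"] by (simp add: k_def)
  qed
  define x where "x n = s - s / real (Suc n)" for n
  have x: "0 \<le> x n" "x n < s" for n
    using s by (auto simp: x_def field_simps)
  have xlim: "x \<longlonglongrightarrow> s"
  proof -
    have "(\<lambda>n. s - s * inverse (real (Suc n))) \<longlonglongrightarrow> s - s * 0"
      by (intro tendsto_intros LIMSEQ_inverse_real_of_nat)
    then show ?thesis by (simp add: x_def[abs_def] divide_inverse)
  qed
  then have xC: "Cauchy x" by (rule LIMSEQ_imp_Cauchy)
  have "\<exists>N. \<forall>m\<ge>N. \<forall>n\<ge>N. intrinsic_dist S (g (x m)) (g (x n)) < \<epsilon>" if "\<epsilon> > 0" for \<epsilon>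
  proof -
    from that \<open>M > 0\<close> have "\<epsilon> / M > 0" by simp
    then obtain N where N: "\<And>m n. m \<ge> N \<Longrightarrow> n \<ge> N \<Longrightarrow> \<bar>x m - x n\<bar> < \<epsilon> / M"
      using xC unfolding Cauchy_def dist_real_def by metis
    show ?thesis
    proof (intro exI[of _ N] allI impI)
      fix m n assume "m \<ge> N" "n \<ge> N"
      then have "M * \<bar>x m - x n\<bar> < \<epsilon>" using N \<open>M > 0\<close> by (simp add: field_simps)
      then show "intrinsic_dist S (g (x m)) (g (x n)) < \<epsilon>"
        using id[OF x(1,2) x(1,2), of m n] by simp
    qed
  qed
  moreover have "range (\<lambda>n. g (x n)) \<subseteq> S" using S x by auto
  ultimately obtain p where p: "p \<in> S" "(\<lambda>n. intrinsic_dist S (g (x n)) p) \<longlonglongrightarrow> 0"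
    using compl[unfolded complete_surface_def, rule_format, of "\<lambda>n. g (x n)"] by blast
  have "(\<lambda>n. dist (g (x n)) p) \<longlonglongrightarrow> 0"
  proof (rule tendsto_sandwich[OF _ _ tendsto_const p(2)])
    show "\<forall>\<^sub>F n in sequentially. dist (g (x n)) p \<le> intrinsic_dist S (g (x n)) p"
      by (rule always_eventually, rule allI, rule dist_le_intrinsic_dist[OF conn[OF S[OF x] p(1)]])
  qed simp
  then have 1: "(\<lambda>n. g (x n)) \<longlonglongrightarrow> p" by (rule tendsto_dist_iff[THEN iffD2])
  have "isCont g s" using d[of s] has_vector_derivative_continuous by blast
  then have "(\<lambda>n. g (x n)) \<longlonglongrightarrow> g s" using xlim isCont_tendsto_compose by blast
  then show ?thesis using LIMSEQ_unique[OF 1] p by simp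
qed

section \<open>The model surface in a frame\<close>

text \<open>The substitution \<open>\<rho> = R * cosh t ^ 3\<close> parametrises both halves of the model surface and the circle
  between them smoothly by \<open>t\<close> and the angle \<open>v\<close>.\<close>

definition ring_dir :: "real^3 \<Rightarrow> real^3 \<Rightarrow> real \<Rightarrow> real^3" where
  "ring_dir a b v = cos v *\<^sub>R b + sin v *\<^sub>R (a \<times> b)"

definition model_point :: "real^3 \<Rightarrow> real^3 \<Rightarrow> real^3 \<Rightarrow> real \<Rightarrow> real \<Rightarrow> real \<Rightarrow> real^3" where
  "model_point q a b R t v = q + (R * cosh t ^ 3) *\<^sub>R ring_dir a b v + model_height R t *\<^sub>R a"

text \<open>The unit normal, the unit tangent of the meridians, the mean curvature, and its derivative along
  the meridians by arc length.\<close>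

definition model_normal :: "real^3 \<Rightarrow> real^3 \<Rightarrow> real \<Rightarrow> real \<Rightarrow> real^3" where
  "model_normal a b t v = tanh t *\<^sub>R a - (1 / cosh t) *\<^sub>R ring_dir a b v"

definition model_dir :: "real^3 \<Rightarrow> real^3 \<Rightarrow> real \<Rightarrow> real \<Rightarrow> real^3" where
  "model_dir a b t v = (1 / cosh t) *\<^sub>R a + tanh t *\<^sub>R ring_dir a b v"

definition model_curvature :: "real \<Rightarrow> real \<Rightarrow> real" where
  "model_curvature R t = 2 / (3 * R * cosh t ^ 4)"

definition model_slope :: "real \<Rightarrow> real \<Rightarrow> real" where
  "model_slope R t = - 8 * sinh t / (9 * R\<^sup>2 * cosh t ^ 8)"

definition model_velocity :: "real^3 \<Rightarrow> real^3 \<Rightarrow> real \<Rightarrow> real \<Rightarrow> real \<Rightarrow> real \<Rightarrow> real \<Rightarrow> real^3" where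
  "model_velocity a b R t v t' v' = (3 * R * (cosh t)\<^sup>2 * sinh t * t') *\<^sub>R ring_dir a b v
     + (R * cosh t ^ 3 * v') *\<^sub>R (cos v *\<^sub>R (a \<times> b) - sin v *\<^sub>R b) + (3 * R * (cosh t)\<^sup>2 * t') *\<^sub>R a"

lemma cosh_sinh_square: "cosh x * cosh x = 1 + sinh x * sinh (x::real)"
  using cosh_square_eq[of x] by (simp add: power2_eq_square)

lemma model_height_has_derivative:
  "(model_height R has_real_derivative 3 * R * (cosh t)\<^sup>2) (at t)"
  unfolding model_height_def[abs_def]
  by (rule derivative_eq_intros refl)+ (simp add: power2_eq_square cosh_sinh_square algebra_simps)

lemma model_point_has_vector_derivative:
  "((\<lambda>x. model_point q a b R (t0 + x * t') (v0 + x * v')) has_vector_derivative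
     model_velocity a b R (t0 + x * t') (v0 + x * v') t' v') (at x)"
proof -
  have t: "((\<lambda>x. t0 + x * t') has_real_derivative t') (at x)" and v: "((\<lambda>x. v0 + x * v') has_real_derivative v') (at x)"
    by (auto intro!: derivative_eq_intros)
  have h: "((\<lambda>x. model_height R (t0 + x * t')) has_real_derivative 3 * R * (cosh (t0 + x * t'))\<^sup>2 * t') (at x)"
    by (rule DERIV_chain2[OF model_height_has_derivative t])
  have r: "((\<lambda>x. R * cosh (t0 + x * t') ^ 3) has_real_derivative 3 * R * (cosh (t0 + x * t'))\<^sup>2 * sinh (t0 + x * t') * t') (at x)"
    by (rule derivative_eq_intros t refl)+ simp
  have c: "((\<lambda>x. cos (v0 + x * v')) has_real_derivative - sin (v0 + x * v') * v') (at x)"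
    and s: "((\<lambda>x. sin (v0 + x * v')) has_real_derivative cos (v0 + x * v') * v') (at x)"
    by (rule derivative_eq_intros v refl)+ simp
  note * = h r c s
  show ?thesis
    unfolding model_point_def ring_dir_def
    by (rule has_vector_derivative_eq_rhs, (rule derivative_intros *)+)
      (simp add: model_velocity_def ring_dir_def algebra_simps)
qed

lemma model_velocity_continuous:
  "continuous_on UNIV (\<lambda>x. model_velocity a b R (t0 + x * t') (v0 + x * v') t' v')"
  unfolding model_velocity_def ring_dir_def by (intro continuous_intros)

lemma continuous_model_height: "continuous_on UNIV (model_height R)"
  unfolding model_height_def by (intro continuous_intros)

lemma continuous_model_point:
  "continuous_on UNIV (\<lambda>z. model_point q a b R (fst z) (snd z))"
  unfolding model_point_def ring_dir_def
  by (intro continuous_intros continuous_on_compose2[OF continuous_model_height]) auto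

lemma continuous_model_data:
  assumes "R > 0"
  shows "continuous_on UNIV (\<lambda>z. model_normal a b (fst z) (snd z))" "continuous_on UNIV (\<lambda>z. model_dir a b (fst z) (snd z))"
    "continuous_on UNIV (model_curvature R)" "continuous_on UNIV (model_slope R)"
  unfolding model_normal_def model_dir_def ring_dir_def model_curvature_def model_slope_def
  by (intro continuous_intros; use assms cosh_real_nonzero in simp)+

lemma ring_dir_orthonormal:
  assumes "norm a = 1" "norm b = 1" "b \<bullet> a = 0"
  shows "norm (ring_dir a b v) = 1" "ring_dir a b v \<bullet> a = 0" "ring_dir a b v \<bullet> b = cos v"
    "ring_dir a b v \<bullet> (a \<times> b) = sin v" "ring_dir a b v \<bullet> ring_dir a b v = 1"
proof -
  have i: "a \<bullet> a = 1" "b \<bullet> b = 1" "(a \<times> b) \<bullet> (a \<times> b) = 1"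
    using assms orthonormal_frame_expansion(1)[OF assms] by (auto simp: dot_square_norm)
  note s = i dot_cross_self assms(3) inner_commute[of a b] inner_commute[of b "a \<times> b"]
  show "ring_dir a b v \<bullet> a = 0" "ring_dir a b v \<bullet> b = cos v" "ring_dir a b v \<bullet> (a \<times> b) = sin v"
    by (simp_all add: ring_dir_def inner_add_left s)
  then show n: "ring_dir a b v \<bullet> ring_dir a b v = 1"
    by (subst (2) ring_dir_def) (simp add: inner_add_right power2_eq_square[symmetric])
  then show "norm (ring_dir a b v) = 1" by (simp add: norm_eq_sqrt_inner)
qed

lemma ring_dir_exists:
  assumes "norm a = 1" "norm b = 1" "b \<bullet> a = 0" "norm z = 1" "z \<bullet> a = 0"
  obtains v where "z = ring_dir a b v"
proof -
  have z: "z = (z \<bullet> b) *\<^sub>R b + (z \<bullet> (a \<times> b)) *\<^sub>R (a \<times> b)"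
    using orthonormal_frame_expansion(2)[OF assms(1-3), of z] assms(5) by simp
  have i: "b \<bullet> b = 1" "(a \<times> b) \<bullet> (a \<times> b) = 1" "z \<bullet> z = 1"
    using assms orthonormal_frame_expansion(1)[OF assms(1-3)] by (auto simp: dot_square_norm)
  have "z \<bullet> z = (z \<bullet> b)\<^sup>2 + (z \<bullet> (a \<times> b))\<^sup>2"
    by (subst (2) z) (simp add: inner_add_right power2_eq_square)
  then have "(z \<bullet> b)\<^sup>2 + (z \<bullet> (a \<times> b))\<^sup>2 = 1" using i by simp
  then obtain v where "z \<bullet> b = cos v" "z \<bullet> (a \<times> b) = sin v" by (rule sincos_total_2pi)
  then show ?thesis using that[of v] z by (simp add: ring_dir_def)
qed

lemma ring_dir_eqI:
  assumes "norm a = 1" "norm b = 1" "b \<bullet> a = 0"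
    and "ring_dir a b v \<bullet> b = ring_dir a b w \<bullet> b" "ring_dir a b v \<bullet> (a \<times> b) = ring_dir a b w \<bullet> (a \<times> b)"
  shows "ring_dir a b v = ring_dir a b w"
  using assms(4,5) unfolding ring_dir_orthonormal[OF assms(1-3)] by (simp add: ring_dir_def)

lemma model_coordinates:
  assumes "norm a = 1" "norm b = 1" "b \<bullet> a = 0"
  shows "(model_point q a b R t v - q) \<bullet> a = model_height R t"
    "(model_point q a b R t v - q) \<bullet> b = R * cosh t ^ 3 * cos v"
    "(model_point q a b R t v - q) \<bullet> (a \<times> b) = R * cosh t ^ 3 * sin v"
  using assms ring_dir_orthonormal[OF assms]
  by (auto simp: model_point_def inner_add_left dot_square_norm dot_cross_self inner_commute[of a b])

lemma model_dir_norm: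
  assumes "norm a = 1" "norm b = 1" "b \<bullet> a = 0"
  shows "norm (model_dir a b t v) = 1"
proof -
  have "a \<bullet> a = 1" using assms by (simp add: dot_square_norm)
  then have "model_dir a b t v \<bullet> model_dir a b t v = 1 / cosh t * (1 / cosh t) + tanh t * tanh t"
    using ring_dir_orthonormal(2,5)[OF assms, of v]
    by (simp add: model_dir_def inner_add_left inner_add_right inner_commute[of a "ring_dir a b v"])
  also have "\<dots> = ((sinh t)\<^sup>2 + 1) / (cosh t)\<^sup>2"
    by (simp add: tanh_def power2_eq_square add_divide_distrib)
  also have "\<dots> = 1" by (simp add: cosh_square_eq[symmetric])
  finally show ?thesis by (simp add: norm_eq_sqrt_inner)
qed

text \<open>The first integrals and the data of a model surface determine each other: a patch lies on the
  model surface with its own first integrals, and a patch that has the normal, the mean curvature and the gradient of a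
  model surface at one point has the first integrals of that surface there.\<close>

context positive_principal_frame
begin

lemma on_model:
  assumes u: "u \<in> B" and b: "norm b = 1" "b \<bullet> axis_dir u = 0"
  obtains v where "X u = model_point (centre u) (axis_dir u) b (neck_radius u) (param u) v"
    "N u = model_normal (axis_dir u) b (param u) v" "e u = model_dir (axis_dir u) b (param u) v"
    "f u = model_curvature (neck_radius u) (param u)" "F u = model_slope (neck_radius u) (param u)"
proof -
  note o = radial_axis_orthonormal[OF u]
  obtain v where v: "radial u = ring_dir (axis_dir u) b v"
    by (rule ring_dir_exists[OF o(1) b o(2)]) (use o in \<open>auto simp: inner_commute\<close>)
  show ?thesis
    by (rule that[of v])
      (simp_all add: model_point_def model_normal_def model_dir_def model_curvature_def model_slope_def
        v[symmetric] X_eq[OF u, symmetric] N_eq[OF u, symmetric] e_eq[OF u, symmetric] f_eq[OF u] F_eq[OF u])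
qed

lemma integrals_of_model_data:
  assumes u: "u \<in> B" and ab: "norm a = 1" "norm b = 1" "b \<bullet> a = 0" and R: "R > 0"
    and data: "X u = model_point q a b R t v" "N u = model_normal a b t v" "e u = model_dir a b t v"
      "f u = model_curvature R t" "F u = model_slope R t"
  shows "param u = t" "neck_radius u = R" "axis_dir u = a" "centre u = q"
proof -
  have c: "cosh t > 0" by simp
  have "h u = 3 * model_slope R t / (4 * model_curvature R t)" unfolding h_def data ..
  also have "\<dots> = - (3 / 2 * model_curvature R t * sinh t)"
    using R c by (simp add: model_slope_def model_curvature_def field_simps eval_nat_numeral)
  finally have h: "h u = - (3 / 2 * f u * sinh t)" using data by simp
  then have "sinh (param u) = sinh t" using f_pos[OF u] unfolding sinh_param by (simp add: field_simps)
  then show t: "param u = t" by simp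
  have "model_curvature R t = model_curvature (neck_radius u) t"
    using f_eq[OF u] data(4) by (simp add: model_curvature_def t)
  then show R': "neck_radius u = R"
    using R c neck_radius_pos[OF u] by (simp add: model_curvature_def field_simps)
  have st: "1 / cosh t * (1 / cosh t) + tanh t * tanh t = 1" by (rule sech_tanh)
  have "(1 / cosh t) *\<^sub>R model_dir a b t v + tanh t *\<^sub>R model_normal a b t v
      = (1 / cosh t * (1 / cosh t) + tanh t * tanh t) *\<^sub>R a"
    by (simp add: model_dir_def model_normal_def algebra_simps)
  then show a: "axis_dir u = a"
    unfolding axis_dir_eq[OF u] t data st by simp
  have "tanh t *\<^sub>R model_dir a b t v - (1 / cosh t) *\<^sub>R model_normal a b t v
      = (1 / cosh t * (1 / cosh t) + tanh t * tanh t) *\<^sub>R ring_dir a b v"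
    by (simp add: model_dir_def model_normal_def algebra_simps)
  then have r: "radial u = ring_dir a b v"
    unfolding radial_eq[OF u] t data st by simp
  show "centre u = q"
    using X_eq[OF u] unfolding data(1) R' a r t by (simp add: model_point_def)
qed

end

section \<open>Continuation along the model surface\<close>

lemma adapted_chart_image_open:
  assumes A: "adapted_chart S N f G U X" and B: "B \<subseteq> U" "open B"
  shows "openin (top_of_set S) (X ` B)"
proof -
  have "X ` B = X ` U \<inter> inv_into U X -` B"
    using A B(1) unfolding adapted_chart_def by (auto simp: inj_on_def inv_into_f_f)
  moreover have "openin (top_of_set (X ` U)) (X ` U \<inter> inv_into U X -` B)"
    using A B(2) unfolding adapted_chart_def by (intro continuous_openin_preimage_gen) auto
  ultimately show ?thesis
    using A openin_trans unfolding adapted_chart_def by metis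
qed

lemma adapted_chart_continuous:
  fixes F :: "real^3 \<Rightarrow> 'c::real_normed_vector"
  assumes A: "adapted_chart S N f G U X" and u: "u \<in> U" and F: "((F \<circ> X) has_derivative D') (at u)"
  shows "continuous (at (X u) within S) F"
proof -
  obtain L where "linear L \<and> (\<forall>v. L (dd v X u) = v) \<and>
    (\<forall>(F :: real^3 \<Rightarrow> 'c) D'. ((F \<circ> X) has_derivative D') (at u) \<longrightarrow>
        (F has_derivative (\<lambda>z. D' (L z))) (at (X u) within S))"
    using adapted_chart_pullback[OF A u, where 'c = 'c] ..
  then have "(F has_derivative (\<lambda>z. D' (L z))) (at (X u) within S)" using F by simp
  then show ?thesis by (rule has_derivative_continuous)
qed

locale biconservative_surface =
  fixes S :: "(real^3) set" and N :: "real^3 \<Rightarrow> real^3" and f :: "real^3 \<Rightarrow> real" and G :: "real^3 \<Rightarrow> real^3"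
  assumes charts: "\<And>p. p \<in> S \<Longrightarrow> \<exists>U X. adapted_chart S N f G U X \<and> p \<in> X ` U"
    and connected: "connected S"
    and complete: "complete_surface S"
begin

lemma chart_at:
  assumes "p \<in> S"
  obtains U X u where "adapted_chart S N f G U X" "u \<in> U" "X u = p" "open U"
  using charts[OF assms] unfolding adapted_chart_def by blast

lemma chart_in_surface: "adapted_chart S N f G U X \<Longrightarrow> u \<in> U \<Longrightarrow> X u \<in> S"
  unfolding adapted_chart_def using openin_imp_subset by fast

lemma continuous_on_data: "continuous_on S N" "continuous_on S f" "continuous_on S G"
proof -
  have "continuous (at p within S) N \<and> continuous (at p within S) f \<and> continuous (at p within S) G" if p: "p \<in> S" for p
  proof -
    obtain U X u where A: "adapted_chart S N f G U X" "u \<in> U" "X u = p" "open U" by (rule chart_at[OF p])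
    note D = adapted_chart_has_derivative[OF A(1,2)]
    have "continuous (at p within S) N" "continuous (at p within S) f" "continuous (at p within S) G"
      using D(2-4)[THEN adapted_chart_continuous[OF A(1,2)]] unfolding A(3) .
    then show ?thesis by simp
  qed
  then show "continuous_on S N" "continuous_on S f" "continuous_on S G"
    by (auto simp: continuous_on_eq_continuous_within)
qed

text \<open>A straight segment in a chart has finite length, so having finite intrinsic distance is an
  open and closed condition.\<close>

lemma curve_lengths_nonempty:
  assumes "p \<in> S" "q \<in> S"
  shows "curve_lengths S p q \<noteq> {}"
proof (rule connected_induction_simple[OF connected assms, of "\<lambda>q. curve_lengths S p q \<noteq> {}"])
  obtain L where "L \<in> curve_lengths S p p"
    by (rule C1_curve_length[of "\<lambda>_. p" "\<lambda>_. 0" S 0]) (use assms in auto)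
  then show "curve_lengths S p p \<noteq> {}" by blast
next
  fix x assume "x \<in> S"
  then obtain U X u where A: "adapted_chart S N f G U X" "u \<in> U" "X u = x" "open U" by (rule chart_at)
  then obtain d where d: "d > 0" "ball u d \<subseteq> U" using open_contains_ball by blast
  have join: "curve_lengths S (X y) (X z) \<noteq> {}" if yz: "y \<in> ball u d" "z \<in> ball u d" for y z
  proof -
    have seg: "y + s *\<^sub>R (z - y) \<in> U" if "s \<in> {0..1}" for s
    proof -
      have "y + s *\<^sub>R (z - y) = (1 - s) *\<^sub>R y + s *\<^sub>R z" by (simp add: algebra_simps)
      then show ?thesis using convexD[OF convex_ball yz, of "1 - s" s] that d by auto
    qed
    define k where "k s = X (y + s *\<^sub>R (z - y))" for s
    define k' where "k' s = dd (z - y) X (y + s *\<^sub>R (z - y))" for s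
    have dk: "(k has_vector_derivative k' s) (at s)" if "s \<in> {0..1}" for s
    proof -
      have "((\<lambda>s. y + s *\<^sub>R (z - y)) has_derivative (\<lambda>t. t *\<^sub>R (z - y))) (at s)"
        by (auto intro!: derivative_eq_intros)
      from has_derivative_compose[OF this adapted_chart_has_derivative(1)[OF A(1) seg[OF that]]]
      show ?thesis
        unfolding has_vector_derivative_def k_def k'_def
        by (rule has_derivative_eq_rhs)
          (use linear_cmul[OF has_derivative_linear[OF adapted_chart_has_derivative(1)[OF A(1) seg[OF that]]]] in \<open>simp add: fun_eq_iff\<close>)
    qed
    have "continuous_on U (dd (z - y) X)"
    proof -
      have "Ck_on 1 U X" using A(1) by (simp add: adapted_chart_def smooth_on_def)
      then show ?thesis by simp
    qed
    then have ck: "continuous_on {0..1} k'"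
      unfolding k'_def
      by (rule continuous_on_compose2[where f = "\<lambda>s. y + s *\<^sub>R (z - y)"]) (use seg in \<open>auto intro!: continuous_intros\<close>)
    then have "bounded (k' ` {0..1})" using compact_continuous_image compact_imp_bounded by blast
    then obtain M where M: "\<forall>v\<in>k' ` {0..1}. norm v \<le> M" unfolding bounded_iff by blast
    obtain L where "L \<in> curve_lengths S (k 0) (k 1)"
      by (rule C1_curve_length[OF dk ck, of S M]) (use seg chart_in_surface[OF A(1)] M in \<open>auto simp: k_def\<close>)
    then show ?thesis by (auto simp: k_def)
  qed
  show "\<exists>T. openin (top_of_set S) T \<and> x \<in> T \<and>
      (\<forall>y\<in>T. \<forall>z\<in>T. curve_lengths S p y \<noteq> {} \<longrightarrow> curve_lengths S p z \<noteq> {})"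
  proof (intro exI[of _ "X ` ball u d"] conjI ballI impI)
    show "openin (top_of_set S) (X ` ball u d)" by (rule adapted_chart_image_open[OF A(1) d(2)]) simp
    show "x \<in> X ` ball u d" using A(3) d(1) by auto
    fix y z assume "y \<in> X ` ball u d" "z \<in> X ` ball u d" and py: "curve_lengths S p y \<noteq> {}"
    then have "curve_lengths S y z \<noteq> {}" using join by auto
    then show "curve_lengths S p z \<noteq> {}" using py curve_lengths_join by blast
  qed
qed

end

text \<open>The candidate for \<open>S\<close> is the model surface with centre \<open>q\<close>, axis \<open>a\<close> and neck radius \<open>R\<close>, with angles
  measured from \<open>b\<close>. One matched parameter \<open>t > 0\<close> will turn out to suffice for \<open>S\<close> to be this surface.\<close>

locale biconservative_model = biconservative_surface +
  fixes q a b :: "real^3" and R :: real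
  assumes a: "norm a = 1" and b: "norm b = 1" "b \<bullet> a = 0" and R: "R > 0"
begin

abbreviation "mp \<equiv> model_point q a b R"

text \<open>Besides the points, normal, mean curvature and gradient have to agree, since these determine the
  first integrals and with them the model surface on which the neighbouring points lie.\<close>

definition matched :: "real \<Rightarrow> real \<Rightarrow> bool" where
  "matched t v \<longleftrightarrow> mp t v \<in> S \<and> N (mp t v) = model_normal a b t v \<and> f (mp t v) = model_curvature R t \<and>
     G (mp t v) = model_slope R t *\<^sub>R model_dir a b t v"

lemma matched_cong: "ring_dir a b v = ring_dir a b w \<Longrightarrow> matched t v = matched t w"
  by (simp add: matched_def model_point_def model_normal_def model_dir_def)

text \<open>Matching passes to limits along segments of the parameter plane by completeness.\<close>

lemma matched_limit:
  assumes s: "s > 0" and m: "\<And>x. 0 \<le> x \<Longrightarrow> x < s \<Longrightarrow> matched (t0 + x * t') (v0 + x * v')"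
  shows "matched (t0 + s * t') (v0 + s * v')"
proof -
  define g where "g x = mp (t0 + x * t') (v0 + x * v')" for x
  have dg: "(g has_vector_derivative model_velocity a b R (t0 + x * t') (v0 + x * v') t' v') (at x)" for x
    unfolding g_def by (rule model_point_has_vector_derivative)
  have gS: "g x \<in> S" if "0 \<le> x" "x < s" for x using m[OF that] by (simp add: matched_def g_def)
  have sS: "g s \<in> S"
    by (rule complete_surface_curve_end[OF complete curve_lengths_nonempty dg model_velocity_continuous s gS])
  have glim: "(g \<longlongrightarrow> g s) (at_left s)"
    using has_vector_derivative_continuous[OF dg[of s]] unfolding isCont_def
    by (rule filterlim_mono[OF _ order_refl at_le]) simp
  have ev: "eventually (\<lambda>x. 0 \<le> x \<and> x < s) (at_left s)"
    using eventually_at_left_real[OF s] by (rule eventually_mono) auto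
  have lim: "Y (g s) = M s"
    if "continuous_on S Y" "isCont M s" "\<And>x. 0 \<le> x \<Longrightarrow> x < s \<Longrightarrow> Y (g x) = M x"
    for Y :: "real^3 \<Rightarrow> 'z::t2_space" and M
  proof -
    have "((\<lambda>x. Y (g x)) \<longlongrightarrow> Y (g s)) (at_left s)"
      using that(1) sS glim ev gS
      by (intro continuous_within_tendsto_compose[of "g s" S Y g])
        (auto simp: continuous_on_eq_continuous_within elim!: eventually_mono)
    moreover have "(M \<longlongrightarrow> M s) (at_left s)"
      using that(2) unfolding isCont_def by (rule filterlim_mono[OF _ order_refl at_le]) simp
    then have "((\<lambda>x. Y (g x)) \<longlongrightarrow> M s) (at_left s)"
      by (rule Lim_transform_eventually) (use ev that(3) in \<open>auto elim!: eventually_mono\<close>)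
    ultimately show ?thesis by (rule tendsto_unique[OF trivial_limit_at_left_real])
  qed
  have pair: "isCont (\<lambda>x. Z (fst (t0 + x * t', v0 + x * v')) (snd (t0 + x * t', v0 + x * v'))) s"
    if "continuous_on UNIV (\<lambda>z. Z (fst z) (snd z))" for Z :: "real \<Rightarrow> real \<Rightarrow> 'z::topological_space"
    using continuous_on_compose2[OF that, of UNIV "\<lambda>x. (t0 + x * t', v0 + x * v')"]
    by (auto intro!: continuous_intros simp: continuous_on_eq_continuous_at)
  have single: "isCont (\<lambda>x. Z (t0 + x * t')) s"
    if "continuous_on UNIV Z" for Z :: "real \<Rightarrow> 'z::topological_space"
    using continuous_on_compose2[OF that, of UNIV "\<lambda>x. t0 + x * t'"]
    by (auto intro!: continuous_intros simp: continuous_on_eq_continuous_at)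
  note c = continuous_model_data[OF R]
  have "N (g s) = model_normal a b (t0 + s * t') (v0 + s * v')"
    by (rule lim[OF continuous_on_data(1) pair[OF c(1), simplified]]) (use m in \<open>simp add: matched_def g_def\<close>)
  moreover have "f (g s) = model_curvature R (t0 + s * t')"
    by (rule lim[OF continuous_on_data(2) single[OF c(3)]]) (use m in \<open>simp add: matched_def g_def\<close>)
  moreover have "G (g s) = model_slope R (t0 + s * t') *\<^sub>R model_dir a b (t0 + s * t') (v0 + s * v')"
    by (rule lim[OF continuous_on_data(3) isCont_scaleR[OF single[OF c(4)] pair[OF c(2), simplified]]])
      (use m in \<open>simp add: matched_def g_def\<close>)
  ultimately show ?thesis using sS by (simp add: matched_def g_def)
qed

end

lemma adapted_chart_regular_part:
  assumes A: "adapted_chart S N f G U X"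
  shows "open {u \<in> U. G (X u) \<noteq> 0 \<and> f (X u) > 0}"
proof -
  have "smooth_on U (G \<circ> X)" "smooth_on U (f \<circ> X)" and U: "open U" using A by (auto simp: adapted_chart_def)
  then have c: "continuous_on U (G \<circ> X)" "continuous_on U (f \<circ> X)"
    unfolding smooth_on_def using Ck_on_imp_continuous_on by blast+
  have "{u \<in> U. G (X u) \<noteq> 0 \<and> f (X u) > 0} = (U \<inter> (G \<circ> X) -` (- {0})) \<inter> (U \<inter> (f \<circ> X) -` {0<..})"
    by auto
  then show ?thesis
    using continuous_open_preimage[OF c(1) U, of "- {0}"] continuous_open_preimage[OF c(2) U, of "{0<..}"] by auto
qed

lemma adapted_chart_positive_frame:
  assumes A: "adapted_chart S N f G U X" and \<sigma>: "\<sigma> = 1 \<or> \<sigma> = - 1"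
    and B: "B = {u \<in> U. G (X u) \<noteq> 0 \<and> f (X u) > 0}"
  shows "positive_principal_frame B X (N \<circ> X) (\<lambda>u. (\<sigma> * inverse (norm (G (X u)))) *\<^sub>R G (X u)) (f \<circ> X) (\<lambda>u. \<sigma> * norm (G (X u)))"
proof -
  interpret principal_frame B X "N \<circ> X" "\<lambda>u. (\<sigma> * inverse (norm (G (X u)))) *\<^sub>R G (X u)" "f \<circ> X" "\<lambda>u. \<sigma> * norm (G (X u))"
    using adapted_chart_regular_part[OF A] by (intro adapted_chart_principal_frame[OF A \<sigma>]) (auto simp: B)
  show ?thesis by unfold_locales (simp add: assms(3))
qed

lemma polar_coordinates_unique:
  fixes x y :: real
  assumes "x * cos v = y * cos w" "x * sin v = y * sin w" "x > 0" "y > 0"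
  shows "x = y" "cos v = cos w" "sin v = sin w"
proof -
  have "x\<^sup>2 = (x * cos v)\<^sup>2 + (x * sin v)\<^sup>2" by (simp add: power_mult_distrib flip: distrib_left)
  also have "\<dots> = y\<^sup>2" unfolding assms(1,2) by (simp add: power_mult_distrib flip: distrib_left)
  finally show "x = y" using assms(3,4) by (simp add: power2_eq_iff)
  then show "cos v = cos w" "sin v = sin w" using assms by auto
qed

context biconservative_model
begin

lemma model_slope_sgn: "sgn (model_slope R t) = - sgn t"
proof -
  have pos: "9 * R\<^sup>2 * cosh t ^ 8 > 0" using R by simp
  have sd: "sgn (x / y) = sgn x" if "y > 0" for x y :: real using that by (simp add: sgn_if divide_less_0_iff zero_less_divide_iff)
  show ?thesis unfolding model_slope_def sd[OF pos] by (simp add: sgn_if)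
qed

lemma matched_of_integrals:
  assumes I: "positive_principal_frame B X (N \<circ> X) e (f \<circ> X) F" and u: "u \<in> B" "X u \<in> S" and G: "G (X u) = F u *\<^sub>R e u"
    and eq: "positive_principal_frame.neck_radius (f \<circ> X) F u = R"
      "positive_principal_frame.axis_dir (N \<circ> X) e (f \<circ> X) F u = a"
      "positive_principal_frame.centre X (N \<circ> X) e (f \<circ> X) F u = q"
  obtains t v where "X u = mp t v" "matched t v" "sgn t = - sgn (F u)" "t = positive_principal_frame.param (f \<circ> X) F u"
proof -
  interpret positive_principal_frame B X "N \<circ> X" e "f \<circ> X" F by (rule I)
  have b': "b \<bullet> axis_dir u = 0" using b eq by simp
  obtain v where v: "X u = model_point (centre u) (axis_dir u) b (neck_radius u) (param u) v"
    "(N \<circ> X) u = model_normal (axis_dir u) b (param u) v" "e u = model_dir (axis_dir u) b (param u) v"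
    "(f \<circ> X) u = model_curvature (neck_radius u) (param u)" "F u = model_slope (neck_radius u) (param u)"
    by (rule on_model[OF u(1) b(1) b'])
  note v = v[unfolded eq]
  show ?thesis
  proof (rule that[OF v(1) _ _ refl])
    show "matched (param u) v"
      using v u(2) G unfolding matched_def v(1)[symmetric] by simp
    show "sgn (param u) = - sgn (F u)" using model_slope_sgn[of "param u"] v(5) by simp
  qed
qed

definition proj :: "real^3 \<Rightarrow> real^2" where
  "proj z = (\<chi> i. if i = 1 then (z - q) \<bullet> b else (z - q) \<bullet> (a \<times> b))"

lemma continuous_on_proj: "continuous_on A proj"
  unfolding proj_def
proof (rule continuous_on_vec_lambda)
  show "continuous_on A (\<lambda>z. if i = 1 then (z - q) \<bullet> b else (z - q) \<bullet> (a \<times> b))" for i :: 2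
    by (cases "i = 1") (auto intro!: continuous_intros)
qed

lemma proj_model_inj:
  assumes eq: "proj (mp t v) = proj (mp t' v')" and s: "sgn t = sgn t'"
  shows "t = t'" "ring_dir a b v = ring_dir a b v'"
proof -
  have p: "R * cosh t ^ 3 * cos v = R * cosh t' ^ 3 * cos v'" "R * cosh t ^ 3 * sin v = R * cosh t' ^ 3 * sin v'"
    using eq unfolding proj_def model_coordinates[OF a b] by (simp_all add: vec_eq_iff forall_2)
  note * = polar_coordinates_unique[OF p]
  have "cosh t ^ 3 = cosh t' ^ 3" using *(1) R by simp
  then have "cosh t = cosh t'" by (simp add: power_eq_iff_eq_base)
  then have "cosh \<bar>t\<bar> = cosh \<bar>t'\<bar>" by simp
  then have "\<bar>t\<bar> = \<bar>t'\<bar>" by (metis abs_ge_zero cosh_real_nonneg_le_iff order_antisym order_refl)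
  then show "t = t'" using s by (auto simp: abs_eq_iff sgn_if split: if_splits)
  show "ring_dir a b v = ring_dir a b v'" using *(2,3) R by (simp add: ring_dir_def)
qed

text \<open>Away from the neck a match extends to a neighbourhood: the first integrals are constant, so
  \<open>S\<close> lies on the model surface near the point, and by invariance of domain it fills an open piece
  of the model surface, because that projects injectively to the plane orthogonal to the axis.\<close>

lemma matched_open:
  assumes m: "matched t0 v0" and t0: "t0 \<noteq> 0"
  obtains d where "d > 0" "\<And>t v. \<bar>t - t0\<bar> < d \<Longrightarrow> \<bar>v - v0\<bar> < d \<Longrightarrow> matched t v"
proof -
  have "mp t0 v0 \<in> S" using m by (simp add: matched_def)
  then obtain U X u0 where A: "adapted_chart S N f G U X" "u0 \<in> U" "X u0 = mp t0 v0" "open U" by (rule chart_at)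
  \<comment> \<open>The gradient points towards the neck, and \<open>e\<close> has to agree with the direction of increasing \<open>t\<close>.\<close>
  define \<sigma> where "\<sigma> = - sgn t0"
  have \<sigma>: "\<sigma> = 1 \<or> \<sigma> = - 1" using t0 by (auto simp: \<sigma>_def sgn_if)
  define B where "B = {u \<in> U. G (X u) \<noteq> 0 \<and> f (X u) > 0}"
  define e where "e u = (\<sigma> * inverse (norm (G (X u)))) *\<^sub>R G (X u)" for u
  define F where "F u = \<sigma> * norm (G (X u))" for u
  have I: "positive_principal_frame B X (N \<circ> X) e (f \<circ> X) F"
    using adapted_chart_positive_frame[OF A(1) \<sigma> B_def] unfolding e_def[abs_def] F_def[abs_def] .
  interpret I: positive_principal_frame B X "N \<circ> X" e "f \<circ> X" F by (rule I)
  have slope: "model_slope R t0 \<noteq> 0" using model_slope_sgn[of t0] t0 by (metis neg_equal_0_iff_equal sgn_0_0)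
  have G0: "G (X u0) = model_slope R t0 *\<^sub>R model_dir a b t0 v0" using m A by (simp add: matched_def)
  have n0: "norm (G (X u0)) = \<bar>model_slope R t0\<bar>" unfolding G0 using model_dir_norm[OF a b] by simp
  have u0: "u0 \<in> B"
    using m A n0 slope R by (auto simp: B_def matched_def model_curvature_def)
  have F0: "F u0 = model_slope R t0"
  proof -
    have "\<sigma> = sgn (model_slope R t0)" by (simp add: \<sigma>_def model_slope_sgn)
    then show ?thesis by (simp add: F_def n0 sgn_mult_abs)
  qed
  have e0: "e u0 = model_dir a b t0 v0"
  proof -
    have "e u0 = (\<sigma> * inverse (norm (G (X u0))) * model_slope R t0) *\<^sub>R model_dir a b t0 v0"
      by (simp add: e_def G0)
    also have "model_slope R t0 = \<sigma> * norm (G (X u0))" using F0 by (simp add: F_def)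
    also have "\<sigma> * inverse (norm (G (X u0))) * (\<sigma> * norm (G (X u0))) = \<sigma> * \<sigma>"
      using n0 slope by simp
    also have "\<sigma> * \<sigma> = 1" using \<sigma> by auto
    finally show ?thesis by simp
  qed
  note int0 = I.integrals_of_model_data[OF u0 a b R A(3) _ e0 _ F0]
  have int0: "I.neck_radius u0 = R" "I.axis_dir u0 = a" "I.centre u0 = q"
    by (rule int0; use m A in \<open>simp add: matched_def\<close>)+
  obtain r where r: "r > 0" "ball u0 r \<subseteq> B" using I.B u0 open_contains_ball by blast
  have on: "\<exists>t v. X u = mp t v \<and> matched t v \<and> sgn t = sgn t0" if u: "u \<in> ball u0 r" for u
  proof -
    have uB: "u \<in> B" using r u by auto
    then have uU: "X u \<in> S" using chart_in_surface[OF A(1)] by (simp add: B_def)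
    note c = I.first_integrals_constant[OF convex_ball r(2) u, of u0]
    have G: "G (X u) = F u *\<^sub>R e u" using uB \<sigma> by (auto simp: F_def e_def B_def)
    obtain t v where "X u = mp t v" "matched t v" "sgn t = - sgn (F u)"
      by (rule matched_of_integrals[OF I uB uU G]) (use c int0 r in auto)
    moreover have "sgn (F u) = - sgn t0"
      using uB \<sigma> by (auto simp: F_def \<sigma>_def B_def sgn_mult)
    ultimately show ?thesis by auto
  qed
  have injX: "inj_on X U" using A(1) by (simp add: adapted_chart_def)
  have "inj_on (proj \<circ> X) (ball u0 r)"
  proof (rule inj_onI)
    fix u w assume uw: "u \<in> ball u0 r" "w \<in> ball u0 r" and eq: "(proj \<circ> X) u = (proj \<circ> X) w"
    obtain t v t' v' where tv: "X u = mp t v" "sgn t = sgn t0" "X w = mp t' v'" "sgn t' = sgn t0"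
      using on uw by metis
    have "X u = X w"
      using proj_model_inj[of t v t' v'] eq tv by (simp add: model_point_def)
    moreover have "u \<in> U" "w \<in> U" using uw r(2) by (auto simp: B_def)
    ultimately show "u = w" using injX by (simp add: inj_on_def)
  qed
  moreover have "continuous_on (ball u0 r) (proj \<circ> X)"
  proof -
    have "continuous_on U X" using A(1) Ck_on_imp_continuous_on by (auto simp: adapted_chart_def smooth_on_def)
    moreover have "ball u0 r \<subseteq> U" using r(2) by (auto simp: B_def)
    ultimately have "continuous_on (ball u0 r) X" by (rule continuous_on_subset)
    then show ?thesis by (rule continuous_on_compose[OF _ continuous_on_proj])
  qed
  ultimately have W: "open ((proj \<circ> X) ` ball u0 r)"
    by (intro invariance_of_domain) auto
  define Q where "Q = (\<lambda>z. proj (mp (fst z) (snd z))) -` ((proj \<circ> X) ` ball u0 r) \<inter> {z. fst z * t0 > 0}"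
  have "open Q"
    unfolding Q_def
    by (intro open_Int open_vimage[OF W] open_Collect_less continuous_on_compose2[OF continuous_on_proj continuous_model_point])
      (auto intro!: continuous_intros)
  moreover have "(t0, v0) \<in> Q"
    using t0 r A(3) by (auto simp: Q_def intro!: image_eqI[of _ _ u0] simp: not_less[symmetric] zero_less_mult_iff)
  ultimately obtain V W where VW: "open V" "open W" "(t0, v0) \<in> Sigma V (\<lambda>_. W)" "Sigma V (\<lambda>_. W) \<subseteq> Q" by (rule open_prod_elim)
  obtain d1 where d1: "d1 > 0" "ball t0 d1 \<subseteq> V" using VW open_contains_ball by blast
  obtain d2 where d2: "d2 > 0" "ball v0 d2 \<subseteq> W" using VW open_contains_ball by blast
  show ?thesis
  proof (rule that[of "min d1 d2"])
    show "min d1 d2 > 0" using d1 d2 by simp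
    fix t v assume "\<bar>t - t0\<bar> < min d1 d2" "\<bar>v - v0\<bar> < min d1 d2"
    then have "t \<in> ball t0 d1" "v \<in> ball v0 d2" by (simp_all add: dist_real_def abs_minus_commute)
    then have Q: "(t, v) \<in> Q" using VW(4) d1 d2 by blast
    then obtain u where u: "u \<in> ball u0 r" "proj (mp t v) = proj (X u)" by (auto simp: Q_def)
    obtain t' v' where t': "X u = mp t' v'" "matched t' v'" "sgn t' = sgn t0" using on[OF u(1)] by blast
    have s: "sgn t = sgn t'" using Q t'(3) by (auto simp: Q_def zero_less_mult_iff sgn_if split: if_splits)
    have eq: "proj (mp t v) = proj (mp t' v')" using u(2) t'(1) by simp
    show "matched t v"
      using proj_model_inj[OF eq s] matched_cong[of v v' t'] t'(2) by simp
  qed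
qed

text \<open>The first parameter of a segment at which the match fails cannot exist: it would be matched as a
  limit, and then so would be the parameters just after it. The segment may meet the neck
  only at its end point.\<close>

lemma matched_segment:
  assumes m: "matched t0 v0" and nz: "\<And>x. 0 \<le> x \<Longrightarrow> x < 1 \<Longrightarrow> t0 + x * t' \<noteq> 0"
  shows "matched (t0 + t') (v0 + v')"
proof (rule ccontr)
  assume no: "\<not> matched (t0 + t') (v0 + v')"
  define c where "c x \<longleftrightarrow> matched (t0 + x * t') (v0 + x * v')" for x
  define Z where "Z = {x. 0 \<le> x \<and> x \<le> 1 \<and> \<not> c x}"
  define i where "i = Inf Z"
  have Z1: "1 \<in> Z" using no by (simp add: Z_def c_def)
  have bdd: "bdd_below Z" by (rule bdd_belowI[of _ 0]) (simp add: Z_def)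
  have "Z \<noteq> {}" using Z1 by blast
  then have "0 \<le> Inf Z" by (rule cInf_greatest) (simp add: Z_def)
  then have i01: "0 \<le> i" "i \<le> 1"
    using cInf_lower[OF Z1 bdd] by (simp_all only: i_def)
  have below: "c x" if "0 \<le> x" "x < i" for x
  proof (rule ccontr)
    assume "\<not> c x"
    then have "x \<in> Z" using that i01 by (simp add: Z_def)
    from cInf_lower[OF this bdd] show False using that by (simp add: i_def)
  qed
  have ci: "c i"
  proof (cases "i = 0")
    case True
    then show ?thesis using m by (simp add: c_def)
  next
    case False
    then show ?thesis
      using matched_limit[of i t0 t' v0 v'] below i01 by (simp add: c_def)
  qed
  then have "i \<noteq> 1" using no by (auto simp: c_def)
  then have i1: "i < 1" using i01 by simp
  obtain d where d: "d > 0" "\<And>t v. \<bar>t - (t0 + i * t')\<bar> < d \<Longrightarrow> \<bar>v - (v0 + i * v')\<bar> < d \<Longrightarrow> matched t v"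
    by (rule matched_open[OF ci[unfolded c_def] nz[OF i01(1) i1]]) blast
  define k where "k = d / (\<bar>t'\<bar> + \<bar>v'\<bar> + 1)"
  have k: "k > 0" unfolding k_def using d(1) by (intro divide_pos_pos add_nonneg_pos) auto
  obtain z where z: "z \<in> Z" "z < i + k"
    using cInf_lessD[OF \<open>Z \<noteq> {}\<close>, of "i + k"] k unfolding i_def by auto
  have "z \<ge> i" using z cInf_lower[OF z(1) bdd] by (simp add: i_def)
  then have zi: "\<bar>z - i\<bar> < k" using z by simp
  have "\<bar>z - i\<bar> * (\<bar>t'\<bar> + \<bar>v'\<bar> + 1) < d"
    using zi unfolding k_def by (subst (asm) pos_less_divide_eq) auto
  moreover have "\<bar>z - i\<bar> * \<bar>t'\<bar> \<le> \<bar>z - i\<bar> * (\<bar>t'\<bar> + \<bar>v'\<bar> + 1)" "\<bar>z - i\<bar> * \<bar>v'\<bar> \<le> \<bar>z - i\<bar> * (\<bar>t'\<bar> + \<bar>v'\<bar> + 1)"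
    by (intro mult_left_mono; simp)+
  ultimately have "\<bar>(z - i) * t'\<bar> < d" "\<bar>(z - i) * v'\<bar> < d" by (simp_all add: abs_mult)
  then have "c z" unfolding c_def by (intro d(2)) (simp_all add: algebra_simps)
  then show False using z by (simp add: Z_def)
qed

lemma matched_upper: assumes "matched t0 v0" "t0 > 0" "t \<ge> 0" shows "matched t v"
proof -
  have "matched (t0 + (t - t0)) (v0 + (v - v0))"
  proof (rule matched_segment[OF assms(1)])
    fix x :: real assume "0 \<le> x" "x < 1"
    moreover have "t0 + x * (t - t0) = (1 - x) * t0 + x * t" by (simp add: algebra_simps)
    ultimately show "t0 + x * (t - t0) \<noteq> 0"
      using assms by (metis add_pos_nonneg diff_gt_0_iff_gt less_irrefl mult_nonneg_nonneg mult_pos_pos)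
  qed
  then show ?thesis by simp
qed

lemma matched_lower: assumes "matched t0 v0" "t0 < 0" "t \<le> 0" shows "matched t v"
proof -
  have "matched (t0 + (t - t0)) (v0 + (v - v0))"
  proof (rule matched_segment[OF assms(1)])
    fix x :: real assume "0 \<le> x" "x < 1"
    then have "(1 - x) * t0 < 0" "x * t \<le> 0"
      using assms by (simp_all add: mult_pos_neg mult_nonneg_nonpos)
    then show "t0 + x * (t - t0) \<noteq> 0" by (simp add: algebra_simps)
  qed
  then show ?thesis by simp
qed

end

section \<open>Crossing the neck\<close>

lemma has_vector_derivative_at_left_limit:
  fixes g :: "real \<Rightarrow> 'a::real_normed_vector"
  assumes "(g has_vector_derivative d) (at 0)" "g 0 = 0"
  shows "((\<lambda>x. (1 / x) *\<^sub>R g x) \<longlongrightarrow> d) (at_left 0)"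
proof -
  have "((\<lambda>x. (1 / norm x) *\<^sub>R (g x - x *\<^sub>R d)) \<longlongrightarrow> 0) (at 0)"
    using assms unfolding has_vector_derivative_def has_derivative_at2 by simp
  then have "((\<lambda>x. (1 / norm x) *\<^sub>R (g x - x *\<^sub>R d)) \<longlongrightarrow> 0) (at_left 0)"
    by (rule filterlim_mono[OF _ order_refl at_le]) simp
  from tendsto_minus[OF this]
  have "((\<lambda>x. - ((1 / norm x) *\<^sub>R (g x - x *\<^sub>R d))) \<longlongrightarrow> 0) (at_left 0)" by simp
  moreover have "eventually (\<lambda>x. - ((1 / norm x) *\<^sub>R (g x - x *\<^sub>R d)) = (1 / x) *\<^sub>R g x - d) (at_left (0::real))"
    using eventually_at_left_real[of "- 1" "0::real"]
    by (rule eventually_mono) (auto simp: algebra_simps)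
  ultimately have "((\<lambda>x. (1 / x) *\<^sub>R g x - d) \<longlongrightarrow> 0) (at_left 0)"
    by (rule Lim_transform_eventually)
  from tendsto_add[OF this tendsto_const[of d]] show ?thesis by simp
qed

context biconservative_model
begin

lemma model_gradient_derivative_at_neck:
  "((\<lambda>t. model_slope R t *\<^sub>R model_dir a b t v) has_vector_derivative (- 8 / (9 * R\<^sup>2)) *\<^sub>R a) (at 0)"
proof -
  have s: "(model_slope R has_real_derivative - 8 / (9 * R\<^sup>2)) (at 0)"
    unfolding model_slope_def using R
    by (auto intro!: derivative_eq_intros simp: power2_eq_square)
  have c: "((\<lambda>t::real. 1 / cosh t) has_real_derivative 0) (at 0)" "((tanh :: real \<Rightarrow> real) has_real_derivative 1) (at 0)"
    by (auto intro!: derivative_eq_intros)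
  have "((\<lambda>t. model_dir a b t v) has_vector_derivative ring_dir a b v) (at 0)"
    unfolding model_dir_def
    by (rule has_vector_derivative_eq_rhs, (rule derivative_intros c)+) simp
  from has_vector_derivative_scaleR[OF s this] show ?thesis
    by (simp add: model_slope_def model_dir_def)
qed

text \<open>The meridian \<open>t \<ge> 0\<close> of the model surface lies in \<open>S\<close> and prescribes the derivative of \<open>G\<close> at the
  neck in the direction of the axis, from one side. Since \<open>G\<close> is differentiable on \<open>S\<close>, this is its
  derivative from both sides.\<close>

lemma gradient_across_neck:
  assumes up: "\<And>t. t \<ge> 0 \<Longrightarrow> matched t v"
    and A: "adapted_chart S N f G U X" and u: "u \<in> U" "X u = mp 0 v"
  obtains w where "dd w X u = a" "dd w (G \<circ> X) u = (- 8 / (27 * R ^ 3)) *\<^sub>R a"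
proof -
  have "a \<bullet> ring_dir a b v = 0" using ring_dir_orthonormal(2)[OF a b, of v] by (simp add: inner_commute)
  then have "a \<bullet> N (X u) = 0"
    using up[of 0] u by (simp add: matched_def model_normal_def)
  then obtain w where w: "dd w X u = a" by (rule adapted_chart_tangent_surj[OF A u(1)])
  let ?D = "frechet_derivative (G \<circ> X) (at u)"
  obtain L where L: "linear L \<and> (\<forall>v. L (dd v X u) = v) \<and>
    (\<forall>(F :: real^3 \<Rightarrow> real^3) D'. ((F \<circ> X) has_derivative D') (at u) \<longrightarrow>
        (F has_derivative (\<lambda>z. D' (L z))) (at (X u) within S))"
    using adapted_chart_pullback[OF A u(1), where 'c = "real^3"] ..
  note DG = adapted_chart_has_derivative(4)[OF A u(1)]
  have lin: "linear ?D" by (rule has_derivative_linear[OF DG])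
  have GS: "(G has_derivative (\<lambda>z. ?D (L z))) (at (mp 0 v) within S)"
    using L DG u(2) by simp
  have k: "((\<lambda>t. mp t v) has_derivative (\<lambda>x. x *\<^sub>R ((3 * R) *\<^sub>R a))) (at 0 within {0..})"
  proof -
    have "((\<lambda>x. mp (0 + x * 1) (v + x * 0)) has_vector_derivative model_velocity a b R (0 + 0 * 1) (v + 0 * 0) 1 0) (at 0)"
      by (rule model_point_has_vector_derivative)
    then have "((\<lambda>t. mp t v) has_vector_derivative (3 * R) *\<^sub>R a) (at 0)"
      by (simp add: model_velocity_def)
    then show ?thesis
      unfolding has_vector_derivative_def by (rule has_derivative_at_withinI)
  qed
  have "(\<lambda>t. mp t v) ` {0..} \<subseteq> S" using up by (auto simp: matched_def)
  from has_derivative_in_compose[OF k has_derivative_subset[OF GS this]]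
  have "((\<lambda>t. G (mp t v)) has_vector_derivative ?D (L ((3 * R) *\<^sub>R a))) (at 0 within {0..})"
  proof -
    assume *: "((\<lambda>t. G (mp t v)) has_derivative (\<lambda>x. ?D (L (x *\<^sub>R ((3 * R) *\<^sub>R a))))) (at 0 within {0..})"
    have "?D (L (x *\<^sub>R z)) = x *\<^sub>R ?D (L z)" for x z
      using L by (simp add: linear_cmul linear_cmul[OF lin])
    then show ?thesis using * unfolding has_vector_derivative_def by (simp only:)
  qed
  moreover have "((\<lambda>t. G (mp t v)) has_vector_derivative (- 8 / (9 * R\<^sup>2)) *\<^sub>R a) (at 0 within {0..})"
    by (rule has_vector_derivative_transform[OF _ _ has_vector_derivative_at_within[OF model_gradient_derivative_at_neck[of v]]])
      (use up in \<open>auto simp: matched_def\<close>)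
  ultimately have "?D (L ((3 * R) *\<^sub>R a)) = (- 8 / (9 * R\<^sup>2)) *\<^sub>R a"
    by (intro vector_derivative_unique_within) (auto simp: at_within_Ici_at_right)
  moreover have "L ((3 * R) *\<^sub>R a) = (3 * R) *\<^sub>R w" using L w by (metis linear_cmul)
  ultimately have "(3 * R) *\<^sub>R ?D w = (- 8 / (9 * R\<^sup>2)) *\<^sub>R a" by (simp add: linear_cmul[OF lin])
  then have "(1 / (3 * R)) *\<^sub>R (3 * R) *\<^sub>R ?D w = (1 / (3 * R)) *\<^sub>R (- 8 / (9 * R\<^sup>2)) *\<^sub>R a" by simp
  then have "?D w = (- 8 / (27 * R ^ 3)) *\<^sub>R a" using R by (simp add: eval_nat_numeral)
  then show ?thesis using that w by blast
qed

text \<open>That derivative is not zero, so the gradient does not vanish on a curve just beyond the neck, and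
  it reverses its direction there. The frame with \<open>e = G / norm G\<close> on that side therefore tends to the
  same limit as the frame of the upper half, with \<open>e\<close> tending to the axis. The first integrals are
  constant along the curve and hence equal to their limits at the neck, which are \<open>R\<close>, \<open>a\<close> and \<open>q\<close>.\<close>

lemma neck_crossing:
  assumes up: "\<And>t v. t \<ge> 0 \<Longrightarrow> matched t v"
  obtains t v where "t < 0" "matched t v"
proof -
  define v0 where "v0 = (0::real)"
  define y where "y = mp 0 v0"
  define \<rho> where "\<rho> = ring_dir a b v0"
  have m0: "y \<in> S" "N y = - \<rho>" "f y = 2 / (3 * R)" "G y = 0"
    using up[of 0 v0] by (auto simp: matched_def y_def \<rho>_def model_normal_def model_curvature_def model_slope_def)
  have y: "y = q + R *\<^sub>R \<rho>" by (simp add: y_def \<rho>_def model_point_def model_height_def)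
  obtain U X u0 where A: "adapted_chart S N f G U X" "u0 \<in> U" "X u0 = y" "open U" by (rule chart_at[OF m0(1)])
  define \<kappa> where "\<kappa> = 8 / (27 * R ^ 3)"
  have \<kappa>: "\<kappa> > 0" using R by (simp add: \<kappa>_def)
  obtain w where w: "dd w X u0 = a" "dd w (G \<circ> X) u0 = - \<kappa> *\<^sub>R a"
    by (rule gradient_across_neck[OF up A(1,2) A(3)[unfolded y_def]]) (auto simp: \<kappa>_def)
  define c where "c x = u0 + x *\<^sub>R w" for x :: real
  have c0: "c 0 = u0" by (simp add: c_def)
  have dc: "(c has_derivative (\<lambda>x. x *\<^sub>R w)) (at 0)"
    unfolding c_def[abs_def] by (auto intro!: derivative_eq_intros)
  have clim: "(c \<longlongrightarrow> u0) (at_left 0)"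
    unfolding c_def[abs_def] by (auto intro!: tendsto_eq_intros)
  have along: "((\<lambda>x. Y (c x)) \<longlongrightarrow> Y u0) (at_left 0)" if "(Y has_derivative D) (at u0)"
    for Y :: "real^2 \<Rightarrow> 'z::real_normed_vector" and D
    using isCont_tendsto_compose[OF has_derivative_continuous[OF that] clim] .
  note D = adapted_chart_has_derivative[OF A(1,2)]
  have LX: "((\<lambda>x. X (c x)) \<longlongrightarrow> y) (at_left 0)" using along[OF D(1)] A(3) by simp
  have LN: "((\<lambda>x. N (X (c x))) \<longlongrightarrow> - \<rho>) (at_left 0)" using along[OF D(2)] A(3) m0 by simp
  have Lf: "((\<lambda>x. f (X (c x))) \<longlongrightarrow> 2 / (3 * R)) (at_left 0)" using along[OF D(3)] A(3) m0 by simp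
  have LG: "((\<lambda>x. G (X (c x))) \<longlongrightarrow> 0) (at_left 0)" using along[OF D(4)] A(3) m0 by simp
  have "((\<lambda>x. G (X (c x))) has_vector_derivative - \<kappa> *\<^sub>R a) (at 0)"
  proof -
    have "((\<lambda>x. (G \<circ> X) (c x)) has_derivative (\<lambda>x. frechet_derivative (G \<circ> X) (at u0) (x *\<^sub>R w))) (at 0)"
      by (rule has_derivative_compose[OF dc, of "G \<circ> X", unfolded c0, OF D(4)])
    then show ?thesis
      unfolding has_vector_derivative_def linear_cmul[OF has_derivative_linear[OF D(4)]] w(2) o_apply .
  qed
  then have LG': "((\<lambda>x. (1 / x) *\<^sub>R G (X (c x))) \<longlongrightarrow> - \<kappa> *\<^sub>R a) (at_left 0)"
    by (rule has_vector_derivative_at_left_limit) (simp add: c0 A(3) m0)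
  define B where "B = {u \<in> U. G (X u) \<noteq> 0 \<and> f (X u) > 0}"
  define e where "e u = (1 * inverse (norm (G (X u)))) *\<^sub>R G (X u)" for u
  define F where "F u = 1 * norm (G (X u))" for u
  have I: "positive_principal_frame B X (N \<circ> X) e (f \<circ> X) F"
    using adapted_chart_positive_frame[OF A(1) _ B_def, of 1] unfolding e_def[abs_def] F_def[abs_def] by simp
  interpret I: positive_principal_frame B X "N \<circ> X" e "f \<circ> X" F by (rule I)
  have evneg: "\<forall>\<^sub>F x in at_left (0::real). x < 0"
    using eventually_at_left_real[of "- 1" "0::real"] by (rule eventually_mono) auto
  have "a \<noteq> 0" using a by auto
  have "\<forall>\<^sub>F x in at_left 0. c x \<in> U" using topological_tendstoD[OF clim A(4,2)] .
  moreover have "\<forall>\<^sub>F x in at_left 0. f (X (c x)) > 0" by (rule order_tendstoD(1)[OF Lf]) (use R in simp)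
  moreover have "\<forall>\<^sub>F x in at_left 0. (1 / x) *\<^sub>R G (X (c x)) \<noteq> 0"
    by (rule tendsto_imp_eventually_ne[OF LG']) (use \<kappa> \<open>a \<noteq> 0\<close> in simp)
  ultimately have evB: "\<forall>\<^sub>F x in at_left 0. c x \<in> B" by eventually_elim (auto simp: B_def)
  then obtain \<delta> where \<delta>: "\<delta> < 0" "\<And>x. \<delta> < x \<Longrightarrow> x < 0 \<Longrightarrow> c x \<in> B"
    unfolding eventually_at_left[of "- 1" "0::real", simplified] by blast
  \<comment> \<open>A convex set in the chart on which the first integrals are constant and whose closure contains \<open>u0\<close>.\<close>
  define K where "K = c ` {\<delta><..<0}"
  have "K = (+) u0 ` ((\<lambda>x. x *\<^sub>R w) ` {\<delta><..<0})" by (auto simp: K_def c_def image_image)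
  moreover have "convex ((\<lambda>x. x *\<^sub>R w) ` {\<delta><..<0})"
    by (rule convex_linear_image) (auto simp: linear_iff algebra_simps)
  ultimately have K: "convex K" by simp
  have KB: "K \<subseteq> B" using \<delta> by (auto simp: K_def)
  define x1 where "x1 = \<delta> / 2"
  have x1: "\<delta> < x1" "x1 < 0" using \<delta> by (auto simp: x1_def)
  have cK: "c x \<in> K" if "\<delta> < x" "x < 0" for x using that by (auto simp: K_def)
  have const: "Y (c x1) = l"
    if Y: "\<And>u u'. u \<in> K \<Longrightarrow> u' \<in> K \<Longrightarrow> Y u = Y u'" and l: "((\<lambda>x. Y (c x)) \<longlongrightarrow> l) (at_left 0)"
    for Y :: "real^2 \<Rightarrow> 'z::t2_space" and l
  proof -
    have "\<forall>\<^sub>F x in at_left 0. Y (c x) = Y (c x1)"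
      using eventually_at_left_real[OF \<delta>(1)] by (rule eventually_mono) (use Y cK x1 in auto)
    from Lim_transform_eventually[OF l this] have "((\<lambda>x. Y (c x1)) \<longlongrightarrow> l) (at_left (0::real))" .
    from tendsto_unique[OF trivial_limit_at_left_real tendsto_const this] show ?thesis .
  qed
  have LF: "((\<lambda>x. F (c x)) \<longlongrightarrow> 0) (at_left 0)"
    unfolding F_def using tendsto_norm[OF LG] by simp
  \<comment> \<open>Here \<open>x < 0\<close>, so \<open>e (c x)\<close> is the opposite of the unit vector along \<open>(1 / x) G\<close>, which tends to \<open>- \<kappa> a\<close>.\<close>
  have Le: "((\<lambda>x. e (c x)) \<longlongrightarrow> a) (at_left 0)"
  proof -
    have 1: "((\<lambda>x. - (inverse (norm ((1 / x) *\<^sub>R G (X (c x)))) *\<^sub>R ((1 / x) *\<^sub>R G (X (c x))))) \<longlongrightarrow>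
       - (inverse (norm (- \<kappa> *\<^sub>R a)) *\<^sub>R (- \<kappa> *\<^sub>R a))) (at_left 0)"
      by (intro tendsto_intros LG') (use \<kappa> \<open>a \<noteq> 0\<close> in simp)
    have 2: "- (inverse (norm (- \<kappa> *\<^sub>R a)) *\<^sub>R (- \<kappa> *\<^sub>R a)) = a" using \<kappa> a by simp
    have 3: "\<forall>\<^sub>F x in at_left 0.
        - (inverse (norm ((1 / x) *\<^sub>R G (X (c x)))) *\<^sub>R ((1 / x) *\<^sub>R G (X (c x)))) = e (c x)"
      using evneg by eventually_elim (simp add: e_def inverse_eq_divide)
    show ?thesis by (rule Lim_transform_eventually[OF 1[unfolded 2] 3])
  qed
  have Lf': "((\<lambda>x. (f \<circ> X) (c x)) \<longlongrightarrow> 2 / (3 * R)) (at_left 0)" using Lf by simp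
  have LN': "((\<lambda>x. (N \<circ> X) (c x)) \<longlongrightarrow> - \<rho>) (at_left 0)" using LN by simp
  have Lh: "((\<lambda>x. I.h (c x)) \<longlongrightarrow> 0) (at_left 0)"
    unfolding I.h_def by (rule tendsto_eq_intros LF Lf' refl)+ (use R in auto)
  have LP: "((\<lambda>x. I.P (c x)) \<longlongrightarrow> 1 / R\<^sup>2) (at_left 0)"
    unfolding I.P_def by (rule tendsto_eq_intros Lh Lf' refl)+ (use R in \<open>simp add: field_simps power2_eq_square\<close>)
  have Lsq: "((\<lambda>x. 1 / sqrt (I.P (c x))) \<longlongrightarrow> R) (at_left 0)"
  proof -
    have "((\<lambda>x. 1 / sqrt (I.P (c x))) \<longlongrightarrow> 1 / sqrt (1 / R\<^sup>2)) (at_left 0)"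
      by (intro tendsto_intros LP) (use R in simp)
    then show ?thesis using R by (simp add: real_sqrt_divide)
  qed
  have LR: "((\<lambda>x. I.neck_radius (c x)) \<longlongrightarrow> R) (at_left 0)"
    unfolding I.neck_radius_def
    by (rule tendsto_eq_intros LP Lf' refl)+ (use R in \<open>auto simp: field_simps eval_nat_numeral\<close>)
  have La: "((\<lambda>x. I.axis_dir (c x)) \<longlongrightarrow> a) (at_left 0)"
    unfolding I.axis_dir_def
    by (rule tendsto_eq_intros Lsq Lh Le LN' Lf' refl)+ (use R in \<open>auto simp: field_simps eval_nat_numeral\<close>)
  have Lr: "((\<lambda>x. I.radial (c x)) \<longlongrightarrow> \<rho>) (at_left 0)"
    unfolding I.radial_def
    by (rule tendsto_eq_intros tendsto_minus[OF Lsq] Lsq Lh Le LN' Lf' refl)+ (use R in \<open>auto simp: field_simps eval_nat_numeral\<close>)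
  have Lt: "((\<lambda>x. I.param (c x)) \<longlongrightarrow> 0) (at_left 0)"
    unfolding I.param_def
    by (rule tendsto_eq_intros Lh Lf' refl)+ (use R in \<open>auto\<close>)
  have LH: "((\<lambda>x. model_height (I.neck_radius (c x)) (I.param (c x))) \<longlongrightarrow> 0) (at_left 0)"
  proof -
    have "((\<lambda>x. model_height (I.neck_radius (c x)) (I.param (c x))) \<longlongrightarrow> 3 * R / 2 * (sinh 0 * cosh 0 + 0)) (at_left 0)"
      unfolding model_height_def by (intro tendsto_intros LR Lt) simp
    then show ?thesis by simp
  qed
  have Lq: "((\<lambda>x. I.centre (c x)) \<longlongrightarrow> q) (at_left 0)"
    unfolding I.centre_def
    by (rule tendsto_eq_intros Lsq LX Lr LH La refl)+ (simp add: y)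
  note fi = I.first_integrals_constant[OF K KB]
  have u1: "c x1 \<in> B" using \<delta> x1 by blast
  have uS: "X (c x1) \<in> S" using chart_in_surface[OF A(1)] u1 by (simp add: B_def)
  have G1: "G (X (c x1)) = F (c x1) *\<^sub>R e (c x1)" using u1 by (simp add: F_def e_def B_def)
  obtain t v where tv: "X (c x1) = mp t v" "matched t v" "sgn t = - sgn (F (c x1))"
    by (rule matched_of_integrals[OF I u1 uS G1 const[OF fi(1) LR] const[OF fi(2) La] const[OF fi(3) Lq]]) blast
  have "F (c x1) > 0" using u1 by (simp add: F_def B_def)
  then have "t < 0" using tv(3) by (auto simp: sgn_if split: if_splits)
  then show ?thesis using that tv(2) by blast
qed

lemma matched_everywhere:
  assumes "matched t0 v0" "t0 > 0"
  shows "matched t v"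
proof (cases "t \<ge> 0")
  case True
  then show ?thesis using matched_upper assms by blast
next
  case False
  obtain t1 v1 where "t1 < 0" "matched t1 v1" by (rule neck_crossing[OF matched_upper[OF assms]])
  then show ?thesis using matched_lower False by simp
qed

end

section \<open>The surface is the whole model surface\<close>

lemma model_height_strict_mono:
  assumes "R > 0" "t < t'"
  shows "model_height R t < model_height R t'"
  by (rule DERIV_pos_imp_increasing[OF assms(2)]) (use model_height_has_derivative assms(1) in fastforce)

lemma model_height_lower_bound:
  assumes "R > 0"
  shows "3 * R / 2 * \<bar>t\<bar> \<le> \<bar>model_height R t\<bar>"
proof -
  have "\<bar>t\<bar> \<le> \<bar>sinh t * cosh t + t\<bar>"
  proof (cases "t \<ge> 0")
    case True
    then have "sinh t * cosh t \<ge> 0" by simp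
    then show ?thesis using True by simp
  next
    case False
    then have "sinh t * cosh t \<le> 0" by (simp add: mult_nonpos_nonneg)
    then show ?thesis using False by simp
  qed
  then have "3 * R / 2 * \<bar>t\<bar> \<le> 3 * R / 2 * \<bar>sinh t * cosh t + t\<bar>"
    using assms by (intro mult_left_mono) auto
  then show ?thesis using assms by (simp add: model_height_def abs_mult)
qed

lemma ring_dir_range: "\<exists>w\<in>{0..2 * pi}. ring_dir a b v = ring_dir a b w"
proof -
  obtain w where "0 \<le> w" "w < 2 * pi" "cos v = cos w" "sin v = sin w"
    using sincos_total_2pi[of "cos v" "sin v"] by auto
  then show ?thesis by (intro bexI[of _ w]) (auto simp: ring_dir_def)
qed

text \<open>On a convergent sequence of model points the heights are bounded and hence also the parameters \<open>t\<close>,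
  while the angles may be taken from one period; so the sequence stays in a compact part.\<close>

lemma closed_model:
  assumes ab: "norm a = 1" "norm b = 1" "b \<bullet> a = 0" and R: "R > 0"
  shows "closed (range (\<lambda>z. model_point q a b R (fst z) (snd z)))"
  unfolding closed_sequential_limits
proof (intro allI impI, elim conjE)
  fix x l assume "\<forall>n. x n \<in> range (\<lambda>z. model_point q a b R (fst z) (snd z))" and l: "x \<longlonglongrightarrow> l"
  then have "\<forall>n. \<exists>t v. v \<in> {0..2 * pi} \<and> x n = model_point q a b R t v"
    using ring_dir_range[of a b] unfolding image_iff model_point_def by (metis (no_types, opaque_lifting))
  then obtain t v where tv: "\<And>n. v n \<in> {0..2 * pi}" "\<And>n. x n = model_point q a b R (t n) (v n)" by metis
  have "bounded (range x)" using l by (rule convergent_imp_bounded)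
  then obtain M where M: "\<And>n. norm (x n) \<le> M" unfolding bounded_iff by auto
  define T where "T = (M + norm q) / (3 * R / 2)"
  have "t n \<in> {- T..T}" for n
  proof -
    have "model_height R (t n) = (x n - q) \<bullet> a" unfolding tv(2) model_coordinates[OF ab] ..
    then have "\<bar>model_height R (t n)\<bar> \<le> norm (x n - q)"
      using Cauchy_Schwarz_ineq2[of "x n - q" a] ab by simp
    also have "\<dots> \<le> M + norm q" using norm_triangle_ineq4[of "x n" q] M[of n] by simp
    finally have "3 * R / 2 * \<bar>t n\<bar> \<le> M + norm q" using model_height_lower_bound[OF R, of "t n"] by simp
    then have "\<bar>t n\<bar> \<le> T" unfolding T_def using R by (subst pos_le_divide_eq) (auto simp: mult.commute)
    then show ?thesis by (auto simp: abs_le_iff)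
  qed
  then have "x n \<in> (\<lambda>z. model_point q a b R (fst z) (snd z)) ` (Sigma {- T..T} (\<lambda>_. {0..2 * pi}))" for n
    using tv by (auto intro!: image_eqI[of _ _ "(t n, v n)"])
  moreover have "compact ((\<lambda>z. model_point q a b R (fst z) (snd z)) ` (Sigma {- T..T} (\<lambda>_. {0..2 * pi})))"
    by (intro compact_continuous_image continuous_on_subset[OF continuous_model_point] compact_Times) auto
  then have "closed ((\<lambda>z. model_point q a b R (fst z) (snd z)) ` (Sigma {- T..T} (\<lambda>_. {0..2 * pi})))"
    by (rule compact_imp_closed)
  ultimately have "l \<in> (\<lambda>z. model_point q a b R (fst z) (snd z)) ` (Sigma {- T..T} (\<lambda>_. {0..2 * pi}))"
    using l closed_sequentially by blast
  then show "l \<in> range (\<lambda>z. model_point q a b R (fst z) (snd z))" by blast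
qed

lemma model_point_inj:
  assumes ab: "norm a = 1" "norm b = 1" "b \<bullet> a = 0" and R: "R > 0"
    and eq: "model_point q a b R t v = model_point q a b R t' v'" and v: "\<bar>v - v'\<bar> < 2 * pi"
  shows "t = t'" "v = v'"
proof -
  have "model_height R t = model_height R t'" using arg_cong[OF eq, of "\<lambda>x. (x - q) \<bullet> a"] unfolding model_coordinates[OF ab] .
  then show t: "t = t'" using model_height_strict_mono[OF R] by (metis less_irrefl linorder_neqE)
  have "cos v = cos v'" "sin v = sin v'"
    using arg_cong[OF eq, of "\<lambda>x. (x - q) \<bullet> b"] arg_cong[OF eq, of "\<lambda>x. (x - q) \<bullet> (a \<times> b)"] R
    unfolding model_coordinates[OF ab] t by simp_all
  then obtain n :: int where n: "v = v' + 2 * pi * of_int n" using sin_cos_eq_iff[of v v'] by auto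
  then have "2 * pi * \<bar>of_int n\<bar> < 2 * pi * 1" using v by (simp add: abs_mult)
  then have "\<bar>of_int n :: real\<bar> < 1" by (subst (asm) mult_less_cancel_left_pos) auto
  then have "n = 0" by linarith
  then show "v = v'" using n by simp
qed

context biconservative_model
begin

text \<open>Read in a chart of \<open>S\<close>, the parametrization of the model surface is a locally injective continuous
  map between plane sets, to which invariance of domain applies.\<close>

lemma model_open_in_surface:
  assumes sub: "range (\<lambda>z. mp (fst z) (snd z)) \<subseteq> S"
  shows "openin (top_of_set S) (range (\<lambda>z. mp (fst z) (snd z)))"
proof (subst openin_subopen, intro ballI)
  fix p assume "p \<in> range (\<lambda>z. mp (fst z) (snd z))"
  then have "p \<in> S" and "\<exists>t v. p = mp t v" using sub by auto
  from this(2) obtain t0 v0 where p: "p = mp t0 v0" by blast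
  from \<open>p \<in> S\<close> obtain U X u0 where A: "adapted_chart S N f G U X" "u0 \<in> U" "X u0 = p" "open U" by (rule chart_at)
  have XU: "openin (top_of_set S) (X ` U)" and inj: "inj_on X U" and cont: "continuous_on (X ` U) (inv_into U X)"
    using A(1) by (auto simp: adapted_chart_def)
  obtain T where T: "open T" "X ` U = S \<inter> T" using XU by (auto simp: openin_open)
  define m where "m z = mp (z $ 1) (z $ 2)" for z :: "real^2"
  have mS: "m z \<in> S" for z
    using subsetD[OF sub rangeI[of _ "(z $ 1, z $ 2)"]] by (simp add: m_def)
  have mc: "continuous_on A m" for A
    using continuous_on_compose2[OF continuous_model_point[of q a b R], of A "\<lambda>z. (z $ 1, z $ 2)"]
    unfolding m_def by (simp add: continuous_on_Pair continuous_on_component continuous_on_id)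
  define Q where "Q = m -` T \<inter> {z. \<bar>z $ 2 - v0\<bar> < pi}"
  have Q: "open Q" unfolding Q_def
    by (intro open_Int open_vimage[OF T(1)] mc open_Collect_less) (auto intro!: continuous_intros)
  have mQ: "m z \<in> X ` U" if "z \<in> Q" for z using that mS T(2) by (auto simp: Q_def)
  have "inj_on (inv_into U X \<circ> m) Q"
  proof (rule inj_onI)
    fix z z' assume z: "z \<in> Q" "z' \<in> Q" and "(inv_into U X \<circ> m) z = (inv_into U X \<circ> m) z'"
    then have "m z = m z'" using mQ[OF z(1)] mQ[OF z(2)] by (metis comp_apply f_inv_into_f)
    moreover have "\<bar>z $ 2 - z' $ 2\<bar> < 2 * pi" using z by (auto simp: Q_def)
    ultimately have "z $ 1 = z' $ 1" "z $ 2 = z' $ 2"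
      using model_point_inj[OF a b R, of q "z $ 1" "z $ 2" "z' $ 1" "z' $ 2"] by (auto simp: m_def)
    then show "z = z'" by (simp add: vec_eq_iff forall_2)
  qed
  moreover have "continuous_on Q (inv_into U X \<circ> m)"
    using mQ by (intro continuous_on_compose mc continuous_on_subset[OF cont]) auto
  ultimately have open': "open ((inv_into U X \<circ> m) ` Q)" using Q by (intro invariance_of_domain) auto
  have sub': "(inv_into U X \<circ> m) ` Q \<subseteq> U"
    using mQ by (auto intro: inv_into_into)
  have eq: "X ` (inv_into U X \<circ> m) ` Q = m ` Q"
    using mQ by (auto simp: image_image f_inv_into_f)
  define z0 :: "real^2" where "z0 = vector [t0, v0]"
  have "m z0 = p" by (simp add: m_def z0_def p)
  moreover have "z0 \<in> Q"
  proof -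
    have "p \<in> T" using A T(2) by blast
    then show ?thesis using \<open>m z0 = p\<close> by (simp add: Q_def z0_def)
  qed
  ultimately have "p \<in> m ` Q" by blast
  moreover have "m ` Q \<subseteq> range (\<lambda>z. mp (fst z) (snd z))"
  proof
    fix y assume "y \<in> m ` Q"
    then obtain z where "y = m z" by blast
    then show "y \<in> range (\<lambda>z. mp (fst z) (snd z))"
      by (intro image_eqI[of _ _ "(z $ 1, z $ 2)"]) (simp_all add: m_def)
  qed
  ultimately show "\<exists>W. openin (top_of_set S) W \<and> p \<in> W \<and> W \<subseteq> range (\<lambda>z. mp (fst z) (snd z))"
    using adapted_chart_image_open[OF A(1) sub' open'] unfolding eq by blast
qed

lemma surface_eq_model:
  assumes "matched t0 v0" "t0 > 0"
  shows "S = range (\<lambda>z. mp (fst z) (snd z))"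
proof -
  let ?M = "range (\<lambda>z. mp (fst z) (snd z))"
  have sub: "?M \<subseteq> S" using matched_everywhere[OF assms] by (auto simp: matched_def)
  have "closedin (top_of_set S) ?M"
    using closed_model[OF a b R] sub by (rule closed_subset[rotated])
  then have "?M = {} \<or> ?M = S"
    using model_open_in_surface[OF sub] connected unfolding connected_clopen by blast
  then show ?thesis by blast
qed

end

lemma smooth_on_uminus:
  assumes "open U" "smooth_on U (H \<circ> X)"
  shows "smooth_on U ((\<lambda>x. - H x) \<circ> X)"
  unfolding smooth_on_def
proof
  fix k
  have "Ck_on k U (H \<circ> X)" using assms(2) by (simp add: smooth_on_def)
  from Ck_on_minus[OF assms(1) this] show "Ck_on k U ((\<lambda>x. - H x) \<circ> X)" by (simp add: o_def)
qed

lemma adapted_chart_uminus: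
  assumes A: "adapted_chart S N f G U X"
  shows "adapted_chart S (\<lambda>x. - N x) (\<lambda>x. - f x) (\<lambda>x. - G x) U X"
proof -
  have U: "open U" using A by (simp add: adapted_chart_def)
  have eq: "(\<lambda>x. - H x) \<circ> X = (\<lambda>u. - (H \<circ> X) u)" for H :: "real^3 \<Rightarrow> 'b::real_normed_vector" by (simp add: fun_eq_iff)
  have "dd v ((\<lambda>x. - N x) \<circ> X) u = - dd v (N \<circ> X) u" "dd v ((\<lambda>x. - f x) \<circ> X) u = - dd v (f \<circ> X) u"
    if "u \<in> U" for u v
    unfolding eq
    using dd_eqI[OF has_derivative_minus[OF adapted_chart_has_derivative(2)[OF A that]]]
      dd_eqI[OF has_derivative_minus[OF adapted_chart_has_derivative(3)[OF A that]]] by auto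
  moreover have "smooth_on U (N \<circ> X)" "smooth_on U (f \<circ> X)" "smooth_on U (G \<circ> X)"
    using A by (simp_all add: adapted_chart_def)
  note smooth_on_uminus[OF U this(1)] smooth_on_uminus[OF U this(2)] smooth_on_uminus[OF U this(3)]
  ultimately show ?thesis
    using A unfolding adapted_chart_def by (simp add: algebra_simps)
qed

lemma (in biconservative_surface) uminus: "biconservative_surface S (\<lambda>x. - N x) (\<lambda>x. - f x) (\<lambda>x. - G x)"
  using charts connected complete adapted_chart_uminus by unfold_locales blast+

text \<open>The model surface is read off from the first integrals at \<open>p\<close>. The frame whose \<open>e\<close> is opposite to
  the gradient puts \<open>p\<close> on the half \<open>t > 0\<close>.\<close>

lemma (in biconservative_surface) classification_positive:
  assumes p: "p \<in> S" "G p \<noteq> 0" "f p > 0"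
  shows "\<exists>q a b R. norm a = 1 \<and> norm b = 1 \<and> b \<bullet> a = 0 \<and> R > 0 \<and> S = range (\<lambda>z. model_point q a b R (fst z) (snd z))"
proof -
  obtain U X u where A: "adapted_chart S N f G U X" "u \<in> U" "X u = p" "open U" by (rule chart_at[OF p(1)])
  define B where "B = {u \<in> U. G (X u) \<noteq> 0 \<and> f (X u) > 0}"
  define e where "e u = (- 1 * inverse (norm (G (X u)))) *\<^sub>R G (X u)" for u
  define F where "F u = - 1 * norm (G (X u))" for u
  have I: "positive_principal_frame B X (N \<circ> X) e (f \<circ> X) F"
    using adapted_chart_positive_frame[OF A(1) _ B_def, of "- 1"] unfolding e_def[abs_def] F_def[abs_def] by simp
  interpret I: positive_principal_frame B X "N \<circ> X" e "f \<circ> X" F by (rule I)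
  have u: "u \<in> B" using p A by (simp add: B_def)
  note o = I.radial_axis_orthonormal[OF u]
  interpret M: biconservative_model S N f G "I.centre u" "I.axis_dir u" "I.radial u" "I.neck_radius u"
    by unfold_locales (use o I.neck_radius_pos[OF u] in \<open>auto simp: inner_commute\<close>)
  have G: "G (X u) = F u *\<^sub>R e u" using u by (simp add: F_def e_def B_def)
  have uS: "X u \<in> S" using A p by simp
  obtain t v where tv: "M.matched t v" "sgn t = - sgn (F u)"
    by (rule M.matched_of_integrals[OF I u uS G refl refl refl]) blast
  have "F u < 0" using u by (simp add: F_def B_def)
  then have "t > 0" using tv(2) by (auto simp: sgn_if split: if_splits)
  from M.surface_eq_model[OF tv(1) this] show ?thesis
    using M.a M.b M.R by blast
qed

text \<open>The mean curvature does not vanish at \<open>p\<close> by the Codazzi equations; it is made positive by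
  reversing the normal.\<close>

lemma (in biconservative_surface) classification:
  assumes p: "p \<in> S" "G p \<noteq> 0"
  shows "\<exists>q a b R. norm a = 1 \<and> norm b = 1 \<and> b \<bullet> a = 0 \<and> R > 0 \<and> S = range (\<lambda>z. model_point q a b R (fst z) (snd z))"
proof (cases "f p > 0")
  case True
  then show ?thesis using classification_positive p by blast
next
  case False
  obtain U X u where A: "adapted_chart S N f G U X" "u \<in> U" "X u = p" "open U" by (rule chart_at[OF p(1)])
  define B where "B = U \<inter> (G \<circ> X) -` (- {0})"
  have "smooth_on U (G \<circ> X)" using A(1) by (simp add: adapted_chart_def)
  then have "continuous_on U (G \<circ> X)" unfolding smooth_on_def using Ck_on_imp_continuous_on by blast
  then have "open B" unfolding B_def by (rule continuous_open_preimage[OF _ A(4)]) auto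
  then interpret principal_frame B X "N \<circ> X" "\<lambda>u. (1 * inverse (norm (G (X u)))) *\<^sub>R G (X u)" "f \<circ> X" "\<lambda>u. 1 * norm (G (X u))"
    by (intro adapted_chart_principal_frame[OF A(1)]) (auto simp: B_def)
  have "u \<in> B" using A p by (simp add: B_def)
  from f_nz[OF this] have "- f p > 0" using False A(3) by simp
  then show ?thesis
    using biconservative_surface.classification_positive[OF uminus p(1)] p(2) by simp
qed

section \<open>The standard position of the model surface\<close>

text \<open>With \<open>\<rho> = R cosh t ^ 3\<close> and \<open>C = R powr (- 2 / 3)\<close> the expression \<open>sqrt C * \<rho> powr (1 / 3)\<close> is \<open>cosh t\<close>,
  the square root \<open>sqrt (C * \<rho> powr (2 / 3) - 1)\<close> is \<open>sinh t\<close>, and the logarithm is \<open>t\<close>.\<close>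

lemma profile_model_height:
  assumes R: "R > 0" and C: "C = R powr (- 2 / 3)" and t: "t \<ge> 0"
  shows "profile C (R * cosh t ^ 3) = model_height R t"
proof -
  define k where "k = R powr (1 / 3)"
  have k: "k > 0" using R by (simp add: k_def)
  have kR: "R = k ^ 3" using R by (simp add: k_def powr_powr flip: powr_numeral)
  have Ck: "C = 1 / k\<^sup>2"
    using R unfolding C k_def by (simp add: powr_powr powr_minus_divide flip: powr_numeral)
  define x where "x = k * cosh t"
  have x: "x > 0" using k by (simp add: x_def)
  have \<rho>: "R * cosh t ^ 3 = x ^ 3" by (simp add: kR x_def power_mult_distrib)
  have p1: "(x ^ 3) powr (1 / 3) = x" using x by (simp add: powr_powr flip: powr_numeral)
  have p2: "(x ^ 3) powr (2 / 3) = x\<^sup>2" using x by (simp add: powr_powr flip: powr_numeral)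
  have sC: "sqrt C = 1 / k" using k by (simp add: Ck real_sqrt_divide)
  have Cx: "C * x\<^sup>2 - 1 = (sinh t)\<^sup>2"
    using k cosh_square_eq[of t] by (simp add: Ck x_def power_mult_distrib)
  have s: "sqrt (C * x\<^sup>2 - 1) = sinh t" unfolding Cx using t by simp
  have kx: "1 / k * x = cosh t" using k by (simp add: x_def)
  have "profile C (R * cosh t ^ 3) = 3 / (2 * C) * (x * sinh t + 1 / (1 / k) * ln (1 / k * x + sinh t))"
    unfolding profile_def \<rho> p1 p2 s sC ..
  also have "ln (1 / k * x + sinh t) = t" unfolding kx by (simp add: cosh_plus_sinh)
  also have "3 / (2 * C) * (x * sinh t + 1 / (1 / k) * t) = model_height R t"
    using k by (simp add: Ck x_def kR model_height_def field_simps eval_nat_numeral)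
  finally show ?thesis .
qed

lemma model_surface_eq:
  assumes R: "R > 0" and C: "C = R powr (- 2 / 3)"
  shows "model_surface C =
    {vector [R * cosh t ^ 3 * cos v, R * cosh t ^ 3 * sin v, model_height R t] | t v. True}"
proof -
  define E :: "real \<Rightarrow> real \<Rightarrow> real^3" where
    "E t v = vector [R * cosh t ^ 3 * cos v, R * cosh t ^ 3 * sin v, model_height R t]" for t v
  have RC: "C powr (- 3 / 2) = R" using R unfolding C by (simp add: powr_powr)
  have odd: "model_height R (- t) = - model_height R t" for t
  proof -
    have "sinh (- t) * cosh (- t) + - t = - (sinh t * cosh t + t)" by simp
    then show ?thesis unfolding model_height_def by (simp only: mult_minus_right)
  qed
  have refl: "reflect_z (E t v) = E (- t) v" for t v
    by (simp add: reflect_z_def E_def odd)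
  have upper: "upper_half C = {E t v | t v. t > 0}"
  proof (intro subset_antisym subsetI)
    fix z assume "z \<in> upper_half C"
    then obtain \<rho> v where \<rho>: "\<rho> > R" "z = vector [\<rho> * cos v, \<rho> * sin v, profile C \<rho>]"
      unfolding upper_half_def RC by blast
    define y where "y = (\<rho> / R) powr (1 / 3)"
    have "\<rho> / R > 1" using \<rho> R by simp
    then have y: "y > 1" "y ^ 3 = \<rho> / R"
      using R by (simp_all add: y_def powr_powr abs_of_pos flip: powr_numeral)
    define t where "t = arcosh y"
    have "cosh t = y" "t \<ge> 0" using y by (simp_all add: t_def cosh_arcosh_real arcosh_nonneg_real)
    moreover from this y have "t \<noteq> 0" by auto
    ultimately have t: "t > 0" "cosh t = y" by simp_all
    have "\<rho> = R * cosh t ^ 3" using t y R by simp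
    then have "z = E t v" using \<rho>(2) profile_model_height[OF R C, of t] t by (simp add: E_def)
    then show "z \<in> {E t v | t v. t > 0}" using t by blast
  next
    fix z assume "z \<in> {E t v | t v. t > 0}"
    then obtain t v where t: "t > 0" "z = E t v" by blast
    have "cosh t > 1" using t cosh_real_nonneg_less_iff[of 0 t] by simp
    then have "cosh t ^ 3 > 1" by (rule one_less_power) simp
    then have "R * cosh t ^ 3 > R" using R by simp
    then show "z \<in> upper_half C"
      using t profile_model_height[OF R C, of t] unfolding upper_half_def RC E_def
      by (intro CollectI exI[of _ "R * cosh t ^ 3"] exI[of _ v] conjI) simp_all
  qed
  have circle: "boundary_circle C = {E 0 v | v. True}"
    unfolding boundary_circle_def RC by (auto simp: E_def model_height_def)
  have lower: "reflect_z ` upper_half C = {E t v | t v. t < 0}"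
  proof (intro subset_antisym subsetI)
    fix z assume "z \<in> reflect_z ` upper_half C"
    then obtain t v where "t > 0" "z = E (- t) v" unfolding upper by (auto simp: refl)
    then show "z \<in> {E t v | t v. t < 0}" by (intro CollectI exI[of _ "- t"] exI[of _ v]) simp
  next
    fix z assume "z \<in> {E t v | t v. t < 0}"
    then obtain t v where "t < 0" "z = E t v" by blast
    then have "z = reflect_z (E (- t) v)" "E (- t) v \<in> upper_half C" unfolding upper by (auto simp: refl)
    then show "z \<in> reflect_z ` upper_half C" by blast
  qed
  have "model_surface C = {E t v | t v. True}"
    unfolding model_surface_def lower circle unfolding upper
  proof (intro subset_antisym subsetI)
    fix z assume "z \<in> {E t v | t v. True}"
    then obtain t v where z: "z = E t v" by blast
    consider "t > 0" | "t = 0" | "t < 0" by linarith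
    then show "z \<in> {E t v |t v. t > 0} \<union> {E 0 v | v. True} \<union> {E t v |t v. t < 0}"
      using z by cases blast+
  qed blast
  then show ?thesis by (simp add: E_def)
qed

lemma model_congruent:
  assumes ab: "norm a = 1" "norm b = 1" "b \<bullet> a = 0" and R: "R > 0"
  shows "\<exists>C>0. \<exists>T :: real^3 \<Rightarrow> real^3. bij T \<and> (\<forall>x y. dist (T x) (T y) = dist x y) \<and>
      T ` range (\<lambda>z. model_point q a b R (fst z) (snd z)) = model_surface C"
proof (intro exI conjI)
  define T :: "real^3 \<Rightarrow> real^3" where
    "T x = vector [(x - q) \<bullet> b, (x - q) \<bullet> (a \<times> b), (x - q) \<bullet> a]" for x
  define D :: "real^3 \<Rightarrow> real^3" where "D y = q + y $ 1 *\<^sub>R b + y $ 2 *\<^sub>R (a \<times> b) + y $ 3 *\<^sub>R a" for y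
  have i: "a \<bullet> a = 1" "b \<bullet> b = 1" "(a \<times> b) \<bullet> (a \<times> b) = 1"
    using ab orthonormal_frame_expansion(1)[OF ab] by (auto simp: dot_square_norm)
  have ex: "z = (z \<bullet> b) *\<^sub>R b + (z \<bullet> (a \<times> b)) *\<^sub>R (a \<times> b) + (z \<bullet> a) *\<^sub>R a" for z
    by (rule orthonormal_frame_expansion(2)[OF ab])
  have 0: "a \<bullet> b = 0" "(a \<times> b) \<bullet> b = 0" "b \<bullet> (a \<times> b) = 0" "(a \<times> b) \<bullet> a = 0" "a \<bullet> (a \<times> b) = 0"
    using ab(3) by (auto simp: dot_cross_self inner_commute)
  have "D (T x) = x" for x
    using ex[of "x - q"] by (simp add: D_def T_def add.assoc)
  moreover have "T (D y) = y" for y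
    by (simp add: T_def D_def vec_eq_iff forall_3 inner_add_left i 0 ab(3))
  ultimately show "bij T" by (intro o_bij[of D]) (auto simp: fun_eq_iff)
  have "(norm (T x - T y))\<^sup>2 = (norm (x - y))\<^sup>2" for x y
  proof -
    have 1: "z \<bullet> z = (z \<bullet> b)\<^sup>2 + (z \<bullet> (a \<times> b))\<^sup>2 + (z \<bullet> a)\<^sup>2" for z
      by (subst (2) ex) (simp add: inner_add_right power2_eq_square)
    have 2: "w \<bullet> w = (w $ 1)\<^sup>2 + (w $ 2)\<^sup>2 + (w $ 3)\<^sup>2" for w :: "real^3"
      by (simp add: inner_vec_def sum_3 power2_eq_square)
    have 3: "(T x - T y) $ 1 = (x - y) \<bullet> b" "(T x - T y) $ 2 = (x - y) \<bullet> (a \<times> b)" "(T x - T y) $ 3 = (x - y) \<bullet> a"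
      by (simp_all add: T_def inner_diff_left)
    show ?thesis unfolding power2_norm_eq_inner 2[of "T x - T y"] 3 1[of "x - y"] ..
  qed
  then show "\<forall>x y. dist (T x) (T y) = dist x y" by (simp add: dist_norm power2_eq_iff_nonneg)
  show "R powr (- 2 / 3) > 0" using R by simp
  have T: "T (model_point q a b R t v) = vector [R * cosh t ^ 3 * cos v, R * cosh t ^ 3 * sin v, model_height R t]" for t v
    unfolding T_def model_coordinates[OF ab] ..
  show "T ` range (\<lambda>z. model_point q a b R (fst z) (snd z)) = model_surface (R powr (- 2 / 3))"
    unfolding model_surface_eq[OF R refl] T[symmetric]
  proof (intro subset_antisym subsetI)
    fix y assume "y \<in> {T (model_point q a b R t v) | t v. True}"
    then obtain t v where "y = T (model_point q a b R (fst (t, v)) (snd (t, v)))" by auto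
    then show "y \<in> T ` range (\<lambda>z. model_point q a b R (fst z) (snd z))" by blast
  qed blast
qed

section \<open>Charts of the given surface\<close>

definition parametrization ::
  "(real^3) set \<Rightarrow> (real^3 \<Rightarrow> real^3) \<Rightarrow> (real^2) set \<Rightarrow> (real^2 \<Rightarrow> real^3) \<Rightarrow> bool" where
  "parametrization S N U X \<longleftrightarrow> open U \<and> inj_on X U \<and> openin (top_of_set S) (X ` U) \<and>
     continuous_on (X ` U) (inv_into U X) \<and> smooth_on U X \<and> smooth_on U (N \<circ> X) \<and>
     (\<forall>u\<in>U. norm (N (X u)) = 1 \<and> inj (frechet_derivative X (at u)) \<and>
       (\<forall>v\<in>tangent_space S (X u). N (X u) \<bullet> v = 0))"

text \<open>A chart of the manifold followed by the embedding; the image is open in \<open>S\<close> because \<open>\<phi>\<close> is a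
  homeomorphism onto \<open>S\<close>.\<close>

lemma parametrization_exists:
  assumes M: "oriented_smooth_surface M \<A>" and E: "smooth_embedding M \<A> \<phi>" and S: "S = \<phi> ` topspace M"
    and N: "unit_normal_field M \<A> \<phi> \<eta>" and p: "p \<in> S"
  shows "\<exists>U X. parametrization S \<eta> U X \<and> p \<in> X ` U"
proof -
  obtain m where m: "m \<in> topspace M" "p = \<phi> m" using p S by blast
  have "m \<in> (\<Union>(U, \<psi>)\<in>\<A>. \<psi> ` U)" using m M by (simp add: oriented_smooth_surface_def)
  then obtain U \<psi> where c: "(U, \<psi>) \<in> \<A>" "m \<in> \<psi> ` U" by blast
  have "is_chart M (U, \<psi>)" using M c unfolding oriented_smooth_surface_def by blast
  then have U: "open U" and op: "openin M (\<psi> ` U)"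
    and hm: "homeomorphic_map (top_of_set U) (subtopology M (\<psi> ` U)) \<psi>" by (auto simp: is_chart_def)
  have sub: "\<psi> ` U \<subseteq> topspace M" using op by (rule openin_subset)
  have "embedding_map M euclidean \<phi>" using E by (simp add: smooth_embedding_def)
  then have hp: "homeomorphic_map M (top_of_set S) \<phi>" by (simp add: embedding_map_def S)
  have "homeomorphic_map (subtopology M (\<psi> ` U)) (subtopology (top_of_set S) (\<phi> ` \<psi> ` U)) \<phi>"
    by (rule homeomorphic_map_subtopologies[OF hp]) (use sub S in auto)
  moreover have "subtopology (top_of_set S) (\<phi> ` \<psi> ` U) = top_of_set (\<phi> ` \<psi> ` U)"
    using sub S by (simp add: subtopology_subtopology) (metis image_mono inf.absorb2)
  ultimately have h: "homeomorphic_map (top_of_set U) (top_of_set (\<phi> ` \<psi> ` U)) (\<phi> \<circ> \<psi>)"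
    using homeomorphic_map_compose[OF hm] by simp
  define X where "X = \<phi> \<circ> \<psi>"
  have XU: "X ` U = \<phi> ` \<psi> ` U" by (simp add: X_def image_comp)
  from h[folded XU X_def, unfolded homeomorphic_map_maps]
  obtain g where g: "homeomorphic_maps (top_of_set U) (top_of_set (X ` U)) X g" ..
  have gX: "g (X u) = u" if "u \<in> U" for u using g that by (auto simp: homeomorphic_maps_def)
  then have inj: "inj_on X U" by (metis inj_on_inverseI)
  have "continuous_on (X ` U) g" using g by (auto simp: homeomorphic_maps_def)
  moreover have "g y = inv_into U X y" if "y \<in> X ` U" for y using that gX inj by auto
  ultimately have cont: "continuous_on (X ` U) (inv_into U X)" using continuous_on_cong by metis
  have opX: "openin (top_of_set S) (X ` U)"
    using homeomorphic_imp_open_map[OF hp] op unfolding open_map_def XU by blast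
  have "parametrization S \<eta> U X"
    unfolding parametrization_def
  proof (intro conjI ballI U inj opX cont)
    show "smooth_on U X" "smooth_on U (\<eta> \<circ> X)"
      using E N c by (auto simp: smooth_embedding_def smooth_map_def unit_normal_field_def X_def o_assoc)
    fix u assume u: "u \<in> U"
    show "inj (frechet_derivative X (at u))" using E c u by (auto simp: smooth_embedding_def X_def)
    have "X u \<in> \<phi> ` topspace M" using u sub by (auto simp: X_def)
    then show "norm (\<eta> (X u)) = 1" "\<And>v. v \<in> tangent_space S (X u) \<Longrightarrow> \<eta> (X u) \<bullet> v = 0"
      using N S by (auto simp: unit_normal_field_def)
  qed
  moreover have "p \<in> X ` U" using m c by (auto simp: X_def)
  ultimately show ?thesis by blast
qed

text \<open>Both sides change by the square of the determinant under a change of \<open>x\<close> and \<open>y\<close>, so the formula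
  reduces to an orthonormal basis. It makes the mean curvature a rational expression in the derivatives
  of a chart.\<close>

lemma trace_in_basis:
  fixes L :: "'a::euclidean_space \<Rightarrow> 'a"
  assumes V: "subspace V" "dim V = 2"
    and L: "\<And>x y \<alpha> \<beta>. x \<in> V \<Longrightarrow> y \<in> V \<Longrightarrow> L (\<alpha> *\<^sub>R x + \<beta> *\<^sub>R y) = \<alpha> *\<^sub>R L x + \<beta> *\<^sub>R L y"
    and x: "x \<in> V" and y: "y \<in> V"
  shows "trace_on V L * ((x \<bullet> x) * (y \<bullet> y) - (x \<bullet> y)\<^sup>2) =
    (y \<bullet> y) * (L x \<bullet> x) - (x \<bullet> y) * (L x \<bullet> y + L y \<bullet> x) + (x \<bullet> x) * (L y \<bullet> y)"
proof -
  define B where "B = (SOME B. orthonormal_basis_of V B)"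
  obtain B' where "orthonormal_basis_of V B'"
    using orthonormal_basis_subspace[OF V(1)] unfolding orthonormal_basis_of_def by metis
  then have B: "orthonormal_basis_of V B" unfolding B_def by (rule someI)
  have B0: "0 \<notin> B" using B by (auto simp: orthonormal_basis_of_def)
  have "independent B"
    using B B0 by (intro pairwise_orthogonal_independent) (auto simp: orthonormal_basis_of_def)
  then have "card B = 2"
    using B V(2) by (metis dim_span_eq_card_independent orthonormal_basis_of_def)
  then obtain b c where bc: "B = {b, c}" "b \<noteq> c" by (metis card_2_iff)
  have o: "b \<bullet> b = 1" "c \<bullet> c = 1" "b \<bullet> c = 0" "c \<bullet> b = 0"
    using B bc by (auto simp: orthonormal_basis_of_def dot_square_norm pairwise_insert orthogonal_def inner_commute)
  have bV: "b \<in> V" "c \<in> V" using B bc by (auto simp: orthonormal_basis_of_def span_base)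
  have coord: "\<exists>\<alpha> \<beta>. z = \<alpha> *\<^sub>R b + \<beta> *\<^sub>R c" if "z \<in> V" for z
  proof -
    have "z \<in> span {b, c}" using that B bc by (simp add: orthonormal_basis_of_def)
    then obtain k where "z - k *\<^sub>R b \<in> span {c}" by (auto simp: span_insert)
    then obtain l where "z - k *\<^sub>R b = l *\<^sub>R c" by (auto simp: span_singleton)
    then have "z = k *\<^sub>R b + l *\<^sub>R c" by (simp add: algebra_simps)
    then show ?thesis by blast
  qed
  obtain x1 x2 y1 y2 where xy: "x = x1 *\<^sub>R b + x2 *\<^sub>R c" "y = y1 *\<^sub>R b + y2 *\<^sub>R c"
    using coord x y by metis
  have Lxy: "L x = x1 *\<^sub>R L b + x2 *\<^sub>R L c" "L y = y1 *\<^sub>R L b + y2 *\<^sub>R L c"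
    unfolding xy by (rule L[OF bV])+
  have tr: "trace_on V L = L b \<bullet> b + L c \<bullet> c"
    unfolding trace_on_def B_def[symmetric] bc(1) using bc(2) by simp
  show ?thesis
    unfolding tr Lxy unfolding xy
    by (simp add: inner_add_left inner_add_right o power2_eq_square) (simp add: algebra_simps)
qed

locale parametrized_surface =
  fixes S :: "(real^3) set" and N :: "real^3 \<Rightarrow> real^3" and U :: "(real^2) set" and X :: "real^2 \<Rightarrow> real^3"
  assumes param: "parametrization S N U X"
begin

lemma U_open: "open U" using param by (simp add: parametrization_def)
lemma opens: "openin (top_of_set S) (X ` U)" using param by (simp add: parametrization_def)

lemma in_S: "u \<in> U \<Longrightarrow> X u \<in> S" using opens openin_imp_subset by blast

lemma Ck: "Ck_on k U X" "Ck_on k U (N \<circ> X)"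
  using param by (auto simp: parametrization_def smooth_on_def)

lemma Ck_dd: "Ck_on k U (dd v X)" "Ck_on k U (dd v (N \<circ> X))"
  using Ck[of "Suc k"] by auto

lemma DX: "u \<in> U \<Longrightarrow> (X has_derivative frechet_derivative X (at u)) (at u)"
  and DN: "u \<in> U \<Longrightarrow> ((N \<circ> X) has_derivative frechet_derivative (N \<circ> X) (at u)) (at u)"
  by (rule Ck_on_imp_has_derivative[OF Ck(1)[of "Suc 0"]], assumption,
      rule Ck_on_imp_has_derivative[OF Ck(2)[of "Suc 0"]])

lemma lin: "u \<in> U \<Longrightarrow> linear (frechet_derivative X (at u))" "u \<in> U \<Longrightarrow> linear (frechet_derivative (N \<circ> X) (at u))"
  using DX DN has_derivative_linear by blast+

lemma immersion: "u \<in> U \<Longrightarrow> dd v X u = 0 \<Longrightarrow> v = 0"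
  using param lin[of u] by (auto simp: parametrization_def linear_injective_0)

lemma norm_N: "u \<in> U \<Longrightarrow> norm (N (X u)) = 1"
  using param by (simp add: parametrization_def)

lemma pullback:
  assumes u: "u \<in> U"
  shows "\<exists>L. linear L \<and> (\<forall>v. L (dd v X u) = v) \<and>
    (\<forall>(F :: real^3 \<Rightarrow> 'c::real_normed_vector) D'. ((F \<circ> X) has_derivative D') (at u) \<longrightarrow>
        (F has_derivative (\<lambda>z. D' (L z))) (at (X u) within S))"
  by (rule chart_pullback[OF u _ _ _ DX[OF u]]) (use param u in \<open>simp_all add: parametrization_def\<close>)

text \<open>A derivative of \<open>F\<close> within \<open>S\<close> exists by the pullback to the chart; on tangent vectors it is
  determined by the chain rule along \<open>X\<close>, whichever one is chosen.\<close>

lemma surface_differential_eq: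
  fixes F :: "real^3 \<Rightarrow> 'c::real_normed_vector"
  assumes u: "u \<in> U" and F: "((F \<circ> X) has_derivative D') (at u)"
  shows "surface_differential S F (X u) (dd w X u) = D' w"
proof -
  obtain L where "linear L \<and> (\<forall>v. L (dd v X u) = v) \<and>
    (\<forall>(F :: real^3 \<Rightarrow> 'c) D'. ((F \<circ> X) has_derivative D') (at u) \<longrightarrow>
        (F has_derivative (\<lambda>z. D' (L z))) (at (X u) within S))"
    using pullback[OF u, where 'c = 'c] ..
  then have "F differentiable (at (X u) within S)" using F unfolding differentiable_def by blast
  then have FD: "(F has_derivative frechet_derivative F (at (X u) within S)) (at (X u) within X ` U)"
    unfolding frechet_derivative_works by (rule has_derivative_subset[OF _ openin_imp_subset[OF opens]])
  have "((\<lambda>u. F (X u)) has_derivative (\<lambda>w. frechet_derivative F (at (X u) within S) (dd w X u))) (at u within U)"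
    by (rule has_derivative_in_compose[OF has_derivative_at_withinI[OF DX[OF u]] FD])
  then have "((F \<circ> X) has_derivative (\<lambda>w. frechet_derivative F (at (X u) within S) (dd w X u))) (at u)"
    using at_within_open[OF u U_open] by (simp add: o_def)
  then have "(\<lambda>w. frechet_derivative F (at (X u) within S) (dd w X u)) = D'"
    using F by (rule has_derivative_unique)
  then show ?thesis unfolding surface_differential_def by metis
qed

text \<open>The velocity of a curve in \<open>S\<close> is fixed by the derivative of the identity within \<open>S\<close>, which factors
  through the derivative of the chart. Conversely the images of straight segments have all the
  velocities on the right.\<close>

lemma tangent_space_eq:
  assumes u: "u \<in> U"
  shows "tangent_space S (X u) = range (\<lambda>w. dd w X u)"
proof (intro subset_antisym subsetI)
  fix v assume "v \<in> tangent_space S (X u)"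
  then obtain \<gamma> \<epsilon> where \<gamma>: "\<epsilon> > 0" "\<gamma> ` {-\<epsilon><..<\<epsilon>} \<subseteq> S" "\<gamma> 0 = X u" "(\<gamma> has_vector_derivative v) (at (0::real))"
    unfolding tangent_space_def by blast
  obtain L where L: "linear L \<and> (\<forall>v. L (dd v X u) = v) \<and>
    (\<forall>(F :: real^3 \<Rightarrow> real^3) D'. ((F \<circ> X) has_derivative D') (at u) \<longrightarrow>
        (F has_derivative (\<lambda>z. D' (L z))) (at (X u) within S))"
    using pullback[OF u, where 'c = "real^3"] ..
  have "(id has_derivative (\<lambda>z. dd (L z) X u)) (at (X u) within S)"
    using L DX[OF u] by (simp only: id_comp)
  then have i: "(id has_derivative (\<lambda>z. dd (L z) X u)) (at (\<gamma> 0) within \<gamma> ` {-\<epsilon><..<\<epsilon>})"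
    using \<gamma>(2,3) by (metis has_derivative_subset)
  have g: "(\<gamma> has_derivative (\<lambda>x. x *\<^sub>R v)) (at 0 within {-\<epsilon><..<\<epsilon>})"
    using \<gamma>(4) unfolding has_vector_derivative_def by (rule has_derivative_at_withinI)
  have at0: "at 0 within {-\<epsilon><..<\<epsilon>} = at (0::real)"
    by (rule at_within_open) (use \<gamma>(1) in auto)
  from has_derivative_in_compose[OF g i]
  have "(\<gamma> has_derivative (\<lambda>x. dd (L (x *\<^sub>R v)) X u)) (at 0)" by (simp add: at0)
  moreover have "(\<gamma> has_derivative (\<lambda>x. x *\<^sub>R v)) (at 0)" using g by (simp add: at0)
  ultimately have "(\<lambda>x. dd (L (x *\<^sub>R v)) X u) = (\<lambda>x. x *\<^sub>R v)" by (rule has_derivative_unique)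
  from fun_cong[OF this, of 1] have "v = dd (L v) X u" by simp
  then show "v \<in> range (\<lambda>w. dd w X u)" by blast
next
  fix v assume "v \<in> range (\<lambda>w. dd w X u)"
  then obtain w where w: "v = dd w X u" by blast
  obtain d where d: "d > 0" "ball u d \<subseteq> U" using U_open u open_contains_ball by blast
  define \<epsilon> where "\<epsilon> = d / (norm w + 1)"
  have n: "norm w + 1 > 0" by (simp add: add_nonneg_pos)
  have \<epsilon>: "\<epsilon> > 0" using d n by (simp add: \<epsilon>_def)
  have inU: "u + x *\<^sub>R w \<in> U" if "x \<in> {-\<epsilon><..<\<epsilon>}" for x
  proof -
    have "\<bar>x\<bar> * (norm w + 1) < d" using that n by (simp add: \<epsilon>_def abs_less_iff pos_less_divide_eq[symmetric])
    moreover have "norm (x *\<^sub>R w) \<le> \<bar>x\<bar> * (norm w + 1)" by (simp add: distrib_left)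
    ultimately have "u + x *\<^sub>R w \<in> ball u d" by (simp add: dist_norm)
    then show ?thesis using d by blast
  qed
  define \<gamma> where "\<gamma> x = X (u + x *\<^sub>R w)" for x :: real
  have "smooth_on {-\<epsilon><..<\<epsilon>} \<gamma>"
    unfolding smooth_on_def \<gamma>_def
    by (intro allI Ck_on_affine[OF _ bounded_linear_scaleR_left inU Ck(1)]) auto
  moreover have "\<gamma> ` {-\<epsilon><..<\<epsilon>} \<subseteq> S" using inU in_S by (auto simp: \<gamma>_def)
  moreover have "\<gamma> 0 = X u" by (simp add: \<gamma>_def)
  moreover have "(\<gamma> has_vector_derivative v) (at 0)"
  proof -
    have "((\<lambda>x. u + x *\<^sub>R w) has_derivative (\<lambda>x. x *\<^sub>R w)) (at 0)" by (auto intro!: derivative_eq_intros)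
    from has_derivative_compose[OF this, of X "frechet_derivative X (at u)"] DX[OF u]
    show ?thesis
      by (simp add: has_vector_derivative_def \<gamma>_def[abs_def] w linear_cmul[OF lin(1)[OF u]])
  qed
  ultimately show "v \<in> tangent_space S (X u)" unfolding tangent_space_def using \<epsilon> by blast
qed

lemma N_tangent: "u \<in> U \<Longrightarrow> dd w X u \<bullet> N (X u) = 0"
  using param tangent_space_eq[of u] by (auto simp: parametrization_def inner_commute)

lemma tangent_space_normal:
  assumes u: "u \<in> U"
  shows "tangent_space S (X u) = {z. z \<bullet> N (X u) = 0}"
  unfolding tangent_space_eq[OF u]
  by (rule injective_onto_orthogonal_complement[OF lin(1)[OF u]])
    (use immersion[OF u] N_tangent[OF u] norm_N[OF u] in auto)

lemma tangent_space_subspace: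
  assumes u: "u \<in> U"
  shows "subspace (tangent_space S (X u))" "dim (tangent_space S (X u)) = 2"
proof -
  have eq: "tangent_space S (X u) = {z. N (X u) \<bullet> z = 0}"
    using tangent_space_normal[OF u] by (simp add: inner_commute)
  have "N (X u) \<noteq> 0" using norm_N[OF u] by auto
  then show "subspace (tangent_space S (X u))" "dim (tangent_space S (X u)) = 2"
    unfolding eq using subspace_hyperplane[of "N (X u)"] dim_hyperplane[of "N (X u)"] by auto
qed

lemma shape_operator_eq: "u \<in> U \<Longrightarrow> shape_operator S N (X u) (dd w X u) = - dd w (N \<circ> X) u"
  unfolding shape_operator_def using surface_differential_eq[OF _ DN] by simp

lemma shape_symmetric:
  assumes u: "u \<in> U"
  shows "dd v (N \<circ> X) u \<bullet> dd w X u = dd w (N \<circ> X) u \<bullet> dd v X u"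
proof -
  have *: "dd v (dd w X) u \<bullet> N (X u) = - (dd w X u \<bullet> dd v (N \<circ> X) u)" for v w
  proof -
    have "dd w X differentiable (at u)" "(N \<circ> X) differentiable (at u)"
      using Ck_dd(1)[of "Suc 0" w] Ck(2)[of "Suc 0"] u by auto
    from dd_inner_const[OF U_open u this, of 0 v] show ?thesis using N_tangent by simp
  qed
  show ?thesis
    using *[of v w] *[of w v] dd_commute[OF Ck(1) U_open u, of v w] by (simp add: inner_commute)
qed

lemma trace_formula:
  assumes u: "u \<in> U"
  shows "mean_curvature S N (X u) * ((dd v X u \<bullet> dd v X u) * (dd w X u \<bullet> dd w X u) - (dd v X u \<bullet> dd w X u)\<^sup>2) =
    - ((dd w X u \<bullet> dd w X u) * (dd v (N \<circ> X) u \<bullet> dd v X u)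
       - 2 * (dd v X u \<bullet> dd w X u) * (dd v (N \<circ> X) u \<bullet> dd w X u)
       + (dd v X u \<bullet> dd v X u) * (dd w (N \<circ> X) u \<bullet> dd w X u))"
proof -
  let ?L = "shape_operator S N (X u)"
  have "?L (\<alpha> *\<^sub>R x + \<beta> *\<^sub>R y) = \<alpha> *\<^sub>R ?L x + \<beta> *\<^sub>R ?L y"
    if xy: "x \<in> tangent_space S (X u)" "y \<in> tangent_space S (X u)" for x y \<alpha> \<beta>
  proof -
    obtain a b where ab: "x = dd a X u" "y = dd b X u" using xy unfolding tangent_space_eq[OF u] by blast
    have "\<alpha> *\<^sub>R x + \<beta> *\<^sub>R y = dd (\<alpha> *\<^sub>R a + \<beta> *\<^sub>R b) X u"
      by (simp add: ab linear_add[OF lin(1)[OF u]] linear_cmul[OF lin(1)[OF u]])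
    then show ?thesis
      by (simp add: ab shape_operator_eq[OF u] linear_add[OF lin(2)[OF u]] linear_cmul[OF lin(2)[OF u]] algebra_simps)
  qed
  note tr = trace_in_basis[OF tangent_space_subspace[OF u] this, of "dd v X u" "dd w X u", folded mean_curvature_def]
  have "dd v X u \<in> tangent_space S (X u)" "dd w X u \<in> tangent_space S (X u)"
    unfolding tangent_space_eq[OF u] by blast+
  from tr[OF _ _ this]
  show ?thesis by (simp add: shape_operator_eq[OF u] shape_symmetric[OF u, of w v] algebra_simps)
qed

end

section \<open>Mean curvature and gradient in a chart\<close>

context parametrized_surface
begin

abbreviation "i\<^sub>1 \<equiv> axis 1 1 :: real^2"
abbreviation "i\<^sub>2 \<equiv> axis 2 1 :: real^2"
abbreviation "f \<equiv> mean_curvature S N"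
abbreviation "G \<equiv> surface_grad S f"

definition gram where
  "gram u = (dd i\<^sub>1 X u \<bullet> dd i\<^sub>1 X u) * (dd i\<^sub>2 X u \<bullet> dd i\<^sub>2 X u) - (dd i\<^sub>1 X u \<bullet> dd i\<^sub>2 X u) * (dd i\<^sub>1 X u \<bullet> dd i\<^sub>2 X u)"

lemma axis_decomposition: "v = v $ 1 *\<^sub>R i\<^sub>1 + v $ 2 *\<^sub>R i\<^sub>2" for v :: "real^2"
  by (simp add: vec_eq_iff forall_2 axis_def)

lemma gram_nz:
  assumes u: "u \<in> U"
  shows "gram u \<noteq> 0"
proof
  assume g: "gram u = 0"
  let ?x = "dd i\<^sub>1 X u" and ?y = "dd i\<^sub>2 X u"
  define v where "v = (?y \<bullet> ?y) *\<^sub>R i\<^sub>1 - (?x \<bullet> ?y) *\<^sub>R i\<^sub>2"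
  have z: "dd v X u = (?y \<bullet> ?y) *\<^sub>R ?x - (?x \<bullet> ?y) *\<^sub>R ?y"
    unfolding v_def by (simp add: linear_diff[OF lin(1)[OF u]] linear_cmul[OF lin(1)[OF u]])
  have "dd v X u \<bullet> ?x = 0" "dd v X u \<bullet> ?y = 0"
    using g unfolding z gram_def by (simp_all add: inner_diff_left inner_commute[of ?y ?x] mult.commute)
  then have "dd v X u \<bullet> dd v X u = 0" by (subst (2) z) (simp add: inner_diff_right)
  then have "v = 0" using immersion[OF u] by simp
  then have "v $ 1 = 0" by simp
  then have "?y = 0" by (simp add: v_def axis_def)
  from immersion[OF u this] show False by (simp add: axis_eq_0_iff)
qed

lemma mean_curvature_chart:
  assumes u: "u \<in> U"
  shows "(f \<circ> X) u = - ((dd i\<^sub>2 X u \<bullet> dd i\<^sub>2 X u) * (dd i\<^sub>1 (N \<circ> X) u \<bullet> dd i\<^sub>1 X u)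
       - 2 * (dd i\<^sub>1 X u \<bullet> dd i\<^sub>2 X u) * (dd i\<^sub>1 (N \<circ> X) u \<bullet> dd i\<^sub>2 X u)
       + (dd i\<^sub>1 X u \<bullet> dd i\<^sub>1 X u) * (dd i\<^sub>2 (N \<circ> X) u \<bullet> dd i\<^sub>2 X u)) * inverse (gram u)"
  using trace_formula[OF u, of i\<^sub>1 i\<^sub>2] gram_nz[OF u] unfolding gram_def power2_eq_square
  by (simp add: field_simps)

lemma Ck_gram: "Ck_on k U gram"
  unfolding gram_def[abs_def] by (intro Ck_on_diff Ck_on_mult Ck_on_inner Ck_dd U_open)

lemma Ck_inverse_gram: "Ck_on k U (\<lambda>u. inverse (gram u))"
  by (rule Ck_on_inverse[OF U_open Ck_gram gram_nz])

lemma Ck_mean_curvature: "Ck_on k U (f \<circ> X)"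
proof (rule Ck_on_cong[OF U_open mean_curvature_chart[symmetric]])
  show "Ck_on k U (\<lambda>u. - ((dd i\<^sub>2 X u \<bullet> dd i\<^sub>2 X u) * (dd i\<^sub>1 (N \<circ> X) u \<bullet> dd i\<^sub>1 X u)
       - 2 * (dd i\<^sub>1 X u \<bullet> dd i\<^sub>2 X u) * (dd i\<^sub>1 (N \<circ> X) u \<bullet> dd i\<^sub>2 X u)
       + (dd i\<^sub>1 X u \<bullet> dd i\<^sub>1 X u) * (dd i\<^sub>2 (N \<circ> X) u \<bullet> dd i\<^sub>2 X u)) * inverse (gram u))"
    by (intro Ck_on_mult Ck_on_minus Ck_on_add Ck_on_diff Ck_on_inner Ck_on_const Ck_dd Ck_inverse_gram U_open)
qed

lemma Df: "u \<in> U \<Longrightarrow> ((f \<circ> X) has_derivative frechet_derivative (f \<circ> X) (at u)) (at u)"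
  by (rule Ck_on_imp_has_derivative[OF Ck_mean_curvature[of "Suc 0"]])

lemma surface_grad_eqI:
  assumes u: "u \<in> U" and w: "w \<in> tangent_space S (X u)" "\<And>v. w \<bullet> dd v X u = dd v (f \<circ> X) u"
  shows "G (X u) = w"
  unfolding surface_grad_def
proof (rule the_equality, intro conjI w(1) ballI)
  have sd: "surface_differential S f (X u) (dd v X u) = dd v (f \<circ> X) u" for v
    by (rule surface_differential_eq[OF u Df[OF u]])
  fix v assume "v \<in> tangent_space S (X u)"
  then show "w \<bullet> v = surface_differential S f (X u) v"
    unfolding tangent_space_eq[OF u] using w(2) sd by auto
next
  have sd: "surface_differential S f (X u) (dd v X u) = dd v (f \<circ> X) u" for v
    by (rule surface_differential_eq[OF u Df[OF u]])
  fix w' assume w': "w' \<in> tangent_space S (X u) \<and> (\<forall>v\<in>tangent_space S (X u). w' \<bullet> v = surface_differential S f (X u) v)"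
  then have "w' - w \<in> tangent_space S (X u)"
    using w(1) tangent_space_subspace(1)[OF u] subspace_diff by blast
  then obtain v where v: "w' - w = dd v X u" unfolding tangent_space_eq[OF u] by blast
  have "w' \<bullet> dd v X u = dd v (f \<circ> X) u"
    using w' sd[of v] unfolding tangent_space_eq[OF u] by auto
  then have "(w' - w) \<bullet> (w' - w) = 0" using w(2)[of v] by (simp add: v[symmetric] inner_diff_left)
  then show "w' = w" by simp
qed

text \<open>The gradient is the inverse of the Gram matrix of the coordinate vectors applied to the partial
  derivatives; this formula shows its smoothness.\<close>

definition chart_grad where
  "chart_grad u = (((dd i\<^sub>2 X u \<bullet> dd i\<^sub>2 X u) * dd i\<^sub>1 (f \<circ> X) u - (dd i\<^sub>1 X u \<bullet> dd i\<^sub>2 X u) * dd i\<^sub>2 (f \<circ> X) u) * inverse (gram u)) *\<^sub>R dd i\<^sub>1 X u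
     + (((dd i\<^sub>1 X u \<bullet> dd i\<^sub>1 X u) * dd i\<^sub>2 (f \<circ> X) u - (dd i\<^sub>1 X u \<bullet> dd i\<^sub>2 X u) * dd i\<^sub>1 (f \<circ> X) u) * inverse (gram u)) *\<^sub>R dd i\<^sub>2 X u"

lemma chart_grad_inner:
  assumes u: "u \<in> U"
  shows "chart_grad u \<bullet> dd v X u = dd v (f \<circ> X) u"
proof -
  let ?x = "dd i\<^sub>1 X u" and ?y = "dd i\<^sub>2 X u"
  have c: "?y \<bullet> ?x = ?x \<bullet> ?y" by (rule inner_commute)
  have 1: "chart_grad u \<bullet> ?x = dd i\<^sub>1 (f \<circ> X) u * (gram u * inverse (gram u))"
    and 2: "chart_grad u \<bullet> ?y = dd i\<^sub>2 (f \<circ> X) u * (gram u * inverse (gram u))"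
    by (simp_all add: chart_grad_def inner_add_left c gram_def[of u] algebra_simps)
  have "dd v Y u = v $ 1 *\<^sub>R dd i\<^sub>1 Y u + v $ 2 *\<^sub>R dd i\<^sub>2 Y u"
    if "(Y has_derivative frechet_derivative Y (at u)) (at u)" for Y :: "real^2 \<Rightarrow> 'z::real_normed_vector"
    using has_derivative_linear[OF that] by (subst axis_decomposition[of v]) (simp add: linear_add linear_cmul)
  from this[OF DX[OF u]] this[OF Df[OF u]] show ?thesis
    using 1 2 gram_nz[OF u] by (simp add: inner_add_right)
qed

lemma surface_grad_chart:
  assumes u: "u \<in> U"
  shows "G (X u) = chart_grad u"
proof (rule surface_grad_eqI[OF u _ chart_grad_inner[OF u]])
  have "dd i X u \<in> tangent_space S (X u)" for i using tangent_space_eq[OF u] by auto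
  then show "chart_grad u \<in> tangent_space S (X u)"
    unfolding chart_grad_def using tangent_space_subspace(1)[OF u] by (intro subspace_add subspace_scale)
qed

lemma Ck_surface_grad: "Ck_on k U (G \<circ> X)"
proof (rule Ck_on_cong[OF U_open])
  have "Ck_on k U (dd v (f \<circ> X))" for v using Ck_mean_curvature[of "Suc k"] by simp
  then show "Ck_on k U chart_grad"
    unfolding chart_grad_def[abs_def]
    by (intro Ck_on_add Ck_on_scaleR Ck_on_mult Ck_on_diff Ck_on_inner Ck_dd Ck_inverse_gram U_open)
qed (simp add: surface_grad_chart)

text \<open>The biconservative equation makes \<open>G\<close> a principal direction for \<open>- f / 2\<close>. By the symmetry of the
  shape operator \<open>N \<times> G\<close> is a principal direction too, and the trace \<open>f\<close> leaves \<open>3 * f / 2\<close> for it.\<close>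

lemma shape_of_biconservative:
  assumes u: "u \<in> U"
    and bc: "shape_operator S N (X u) (G (X u)) = - (f (X u) / 2) *\<^sub>R G (X u)"
  shows "(G (X u) \<bullet> G (X u)) *\<^sub>R dd v (N \<circ> X) u =
          (f (X u) / 2 * (dd v X u \<bullet> G (X u))) *\<^sub>R G (X u)
          - (3 * f (X u) / 2 * (dd v X u \<bullet> (N (X u) \<times> G (X u)))) *\<^sub>R (N (X u) \<times> G (X u))"
proof (cases "G (X u) = 0")
  case True
  then show ?thesis by simp
next
  case False
  let ?n = "N (X u)" and ?k = "f (X u)"
  define g where "g = G (X u)"
  define E where "E = ?n \<times> g"
  have g0: "g \<bullet> g \<noteq> 0" using False by (simp add: g_def)
  have gT: "g \<in> tangent_space S (X u)"
    unfolding g_def surface_grad_chart[OF u] chart_grad_def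
    using tangent_space_subspace(1)[OF u] tangent_space_eq[OF u] by (intro subspace_add subspace_scale) auto
  then have gn: "g \<bullet> ?n = 0" using tangent_space_normal[OF u] by simp
  have nn: "norm ?n = 1" by (rule norm_N[OF u])
  have En: "E \<bullet> ?n = 0" and Eg: "E \<bullet> g = 0" by (simp_all add: E_def dot_cross_self)
  have EE: "E \<bullet> E = g \<bullet> g"
    using norm_cross[of ?n g] nn gn by (simp add: E_def power2_norm_eq_inner inner_commute)
  obtain a where a: "g = dd a X u" using gT unfolding tangent_space_eq[OF u] by blast
  have "E \<in> tangent_space S (X u)" using En tangent_space_normal[OF u] by simp
  then obtain b where b: "E = dd b X u" unfolding tangent_space_eq[OF u] by blast
  have Na: "dd a (N \<circ> X) u = (?k / 2) *\<^sub>R g"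
  proof -
    have "- dd a (N \<circ> X) u = - ((?k / 2) *\<^sub>R g)"
      using bc shape_operator_eq[OF u, of a] unfolding a[symmetric] g_def[symmetric] by simp
    then show ?thesis by (simp only: neg_equal_iff_equal)
  qed
  have Nn: "dd w (N \<circ> X) u \<bullet> ?n = 0" for w
  proof -
    have d: "(N \<circ> X) differentiable (at u)" using DN[OF u] differentiable_def by blast
    have "dd w (N \<circ> X) u \<bullet> (N \<circ> X) u = - ((N \<circ> X) u \<bullet> dd w (N \<circ> X) u)"
      by (rule dd_inner_const[OF U_open u d d, of 1]) (simp add: norm_N dot_square_norm)
    then show ?thesis by (simp add: inner_commute)
  qed
  have expand: "(g \<bullet> g) *\<^sub>R z = (z \<bullet> g) *\<^sub>R g + (z \<bullet> E) *\<^sub>R E" if z: "z \<bullet> ?n = 0" for z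
  proof -
    let ?e = "(1 / norm g) *\<^sub>R g"
    have e: "norm ?e = 1" "?e \<bullet> ?n = 0" using g0 gn by simp_all
    have "z = (z \<bullet> ?e) *\<^sub>R ?e + (z \<bullet> (?n \<times> ?e)) *\<^sub>R (?n \<times> ?e)"
      using orthonormal_frame_expansion(2)[OF nn e, of z] z by simp
    also have "\<dots> = (1 / (g \<bullet> g)) *\<^sub>R ((z \<bullet> g) *\<^sub>R g + (z \<bullet> E) *\<^sub>R E)"
      by (simp add: cross_mult_right E_def dot_square_norm power2_eq_square scaleR_add_right)
    finally have "(g \<bullet> g) *\<^sub>R z = (g \<bullet> g) *\<^sub>R ((1 / (g \<bullet> g)) *\<^sub>R ((z \<bullet> g) *\<^sub>R g + (z \<bullet> E) *\<^sub>R E))" by (rule arg_cong)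
    then show ?thesis using g0 by simp
  qed
  have NbE: "dd b (N \<circ> X) u \<bullet> E = - (3 * ?k / 2) * (g \<bullet> g)"
  proof -
    have "?k * ((g \<bullet> g) * (g \<bullet> g)) = - ((g \<bullet> g) * (?k / 2 * (g \<bullet> g)) + (g \<bullet> g) * (dd b (N \<circ> X) u \<bullet> E))"
      using trace_formula[OF u, of a b] Eg by (simp add: a[symmetric] b[symmetric] EE Na inner_commute)
    then have "(g \<bullet> g) * (?k * (g \<bullet> g)) = (g \<bullet> g) * (- (?k / 2 * (g \<bullet> g)) - dd b (N \<circ> X) u \<bullet> E)"
      by (simp add: algebra_simps)
    then have "?k * (g \<bullet> g) = - (?k / 2 * (g \<bullet> g)) - dd b (N \<circ> X) u \<bullet> E" using g0 mult_left_cancel by blast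
    then show ?thesis by (simp add: field_simps)
  qed
  have Nbg: "dd b (N \<circ> X) u \<bullet> g = 0"
    using shape_symmetric[OF u, of b a] Eg by (simp add: a[symmetric] b[symmetric] Na inner_commute)
  have "(g \<bullet> g) *\<^sub>R dd b (N \<circ> X) u = (g \<bullet> g) *\<^sub>R (- (3 * ?k / 2) *\<^sub>R E)"
    unfolding expand[OF Nn] NbE Nbg by simp
  then have Nb: "dd b (N \<circ> X) u = - (3 * ?k / 2) *\<^sub>R E" using g0 scaleR_cancel_left by blast
  have vg: "dd v (N \<circ> X) u \<bullet> g = ?k / 2 * (dd v X u \<bullet> g)"
    using shape_symmetric[OF u, of v a] by (simp add: a[symmetric] Na inner_commute)
  have vE: "dd v (N \<circ> X) u \<bullet> E = - (3 * ?k / 2) * (dd v X u \<bullet> E)"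
    using shape_symmetric[OF u, of v b] by (simp add: b[symmetric] Nb inner_commute)
  show ?thesis
    using expand[OF Nn[of v]] unfolding vg vE g_def[symmetric] E_def[symmetric] by simp
qed

lemma biconservative_imp_adapted:
  assumes "biconservative S N"
  shows "adapted_chart S N f G U X"
  unfolding adapted_chart_def
proof (intro conjI ballI allI impI)
  show "open U" "inj_on X U" "openin (top_of_set S) (X ` U)" "continuous_on (X ` U) (inv_into U X)"
    using param by (simp_all add: parametrization_def)
  show "smooth_on U X" "smooth_on U (N \<circ> X)" "smooth_on U (f \<circ> X)" "smooth_on U (G \<circ> X)"
    unfolding smooth_on_def using Ck Ck_mean_curvature Ck_surface_grad by blast+
  fix u assume u: "u \<in> U"
  show "norm (N (X u)) = 1" by (rule norm_N[OF u])
  show "G (X u) \<bullet> N (X u) = 0"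
    unfolding surface_grad_chart[OF u] chart_grad_def by (simp add: inner_add_left N_tangent[OF u])
  fix v
  show "dd v X u \<bullet> N (X u) = 0" by (rule N_tangent[OF u])
  show "dd v X u = 0 \<Longrightarrow> v = 0" by (rule immersion[OF u])
  show "dd v (f \<circ> X) u = G (X u) \<bullet> dd v X u"
    unfolding surface_grad_chart[OF u] by (rule chart_grad_inner[OF u, symmetric])
  show "(G (X u) \<bullet> G (X u)) *\<^sub>R dd v (N \<circ> X) u =
          (f (X u) / 2 * (dd v X u \<bullet> G (X u))) *\<^sub>R G (X u)
          - (3 * f (X u) / 2 * (dd v X u \<bullet> (N (X u) \<times> G (X u)))) *\<^sub>R (N (X u) \<times> G (X u))"
    using assms in_S[OF u] by (intro shape_of_biconservative[OF u]) (simp add: biconservative_def)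
qed

end

lemma embedded_surface_connected:
  assumes "oriented_smooth_surface M \<A>" "smooth_embedding M \<A> \<phi>"
  shows "connected (\<phi> ` topspace M)"
proof -
  have "embedding_map M euclidean \<phi>" using assms(2) by (simp add: smooth_embedding_def)
  then have "homeomorphic_map M (top_of_set (\<phi> ` topspace M)) \<phi>" by (simp add: embedding_map_def)
  then have "continuous_map M euclidean \<phi>"
    using homeomorphic_imp_continuous_map continuous_map_into_fulltopology by blast
  moreover have "connectedin M (topspace M)"
    using assms(1) by (simp add: connectedin_topspace oriented_smooth_surface_def)
  ultimately have "connectedin euclidean (\<phi> ` topspace M)" by (rule connectedin_continuous_map_image)
  then show ?thesis by simp
qed

section \<open>Complete biconservative surfaces\<close>

theorem theorem3p7:
  fixes M :: "'m topology" and \<A> :: "'m chart set" and \<phi> :: "'m \<Rightarrow> real^3"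
    and S :: "(real^3) set" and \<eta> :: "real^3 \<Rightarrow> real^3"
  assumes "oriented_smooth_surface M \<A>"
    and "smooth_embedding M \<A> \<phi>"
    and "S = \<phi> ` topspace M"
    and "unit_normal_field M \<A> \<phi> \<eta>"
    and "complete_surface S"
    and "biconservative S \<eta>"
    and "non_CMC S \<eta>"
  shows "\<exists>C>0. \<exists>T :: real^3 \<Rightarrow> real^3.
           bij T \<and> (\<forall>x y. dist (T x) (T y) = dist x y) \<and> T ` S = model_surface C"
proof -
  interpret biconservative_surface S \<eta> "mean_curvature S \<eta>" "surface_grad S (mean_curvature S \<eta>)"
  proof
    fix p assume "p \<in> S"
    then obtain U X where X: "parametrization S \<eta> U X" "p \<in> X ` U"
      using parametrization_exists[OF assms(1-4)] by blast
    interpret parametrized_surface S \<eta> U X by unfold_locales (rule X)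
    show "\<exists>U X. adapted_chart S \<eta> (mean_curvature S \<eta>) (surface_grad S (mean_curvature S \<eta>)) U X \<and> p \<in> X ` U"
      using biconservative_imp_adapted[OF assms(6)] X(2) by blast
  qed (use embedded_surface_connected assms in blast)+
  obtain p where "p \<in> S" "surface_grad S (mean_curvature S \<eta>) p \<noteq> 0"
    using assms(7) by (auto simp: non_CMC_def)
  from classification[OF this] obtain q a b R
    where "norm a = 1" "norm b = 1" "b \<bullet> a = 0" "R > 0" "S = range (\<lambda>z. model_point q a b R (fst z) (snd z))"
    by blast
  then show ?thesis using model_congruent[of a b R q] by simp
qed

end
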